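(* A topologically typical Extreme Value copula $C$ has degenerated discrete component, is not absolutely continuous and has full support; that is, the set of all $C\in\mathcal{C}_{ev}$ with $\mu_C^{dis}(\mathbb{I}^2)=0$, $\mu_C^{abs}(\mathbb{I}^2)\neq1$ and $\mathrm{supp}(\mu_C)=\mathbb{I}^2$ is co-meager in $(\mathcal{C}_{ev},d_\infty)$. In particular, for a typical Extreme Value copula $C$ (i.e. for all $C$ in a co-meager subset of $(\mathcal{C}_{ev},d_\infty)$) the partial derivative $\partial_1C(x,y)$ exists for every $(x,y)\in(0,1)^2$.
   Context: $\mathbb{I}=[0,1]$; $\lambda$ is Lebesgue measure on $\mathbb{I}$. A bivariate copula $C$ is the restriction to $\mathbb{I}^2$ of a bivariate distribution function with uniform marginals on $\mathbb{I}$; $\mu_C$ is its doubly stochastic measure, $\mu_C([0,x]\times[0,y])=C(x,y)$. $\mathcal{C}_{ev}$ is the set of Extreme Value copulas: copulas $C$ for which there is a copula $B$ with $C(x,y)=\lim_{n\to\infty}B^n(x^{1/n},y^{1/n})$ for all $x,y\in\mathbb{I}$. $d_\infty$ is the uniform metric. $\partial_1C$ is the partial derivative with respect to the first argument. A finite measure is called singular if it has no point masses and is concentrated on a Lebesgue null set. Let $K_C$ be the Markov kernel of $C$ (regular conditional distribution of $Y$ given $X$ for $(X,Y)\sim C$, so $\mu_C(E\times F)=\int_EK_C(x,F)\,d\lambda(x)$), and decompose $K_C(x,\cdot)=K_C^{abs}(x,\cdot)+K_C^{dis}(x,\cdot)+K_C^{sing}(x,\cdot)$ into absolutely continuous, discrete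 and singular sub-Markov kernels. For $\ast\in\{abs,dis,sing\}$, $\mu_C^{\ast}$ is the measure on $\mathbb{I}^2$ with $\mu_C^{\ast}(E\times F)=\int_EK_C^{\ast}(x,F)\,d\lambda(x)$. $C$ is absolutely continuous if $\mu_C^{abs}(\mathbb{I}^2)=1$; a component is degenerated if it has total mass $0$. A subset of a topological space is nowhere dense if its closure has empty interior, meager if it is covered by countably many nowhere dense sets, and co-meager if its complement is meager. *)

theory Defs
  imports "HOL-Probability.Probability"
begin

section \<open>Baire category in a topological space\<close>

definition nowhere_dense_in :: "'a topology \<Rightarrow> 'a set \<Rightarrow> bool" where
  "nowhere_dense_in X N \<longleftrightarrow> N \<subseteq> topspace X \<and> X interior_of (X closure_of N) = {}"

definition meager_in :: "'a topology \<Rightarrow> 'a set \<Rightarrow> bool" where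
  "meager_in X A \<longleftrightarrow> (\<exists>\<N>. countable \<N> \<and> (\<forall>N\<in>\<N>. nowhere_dense_in X N) \<and> A \<subseteq> \<Union>\<N>)"

definition comeager_in :: "'a topology \<Rightarrow> 'a set \<Rightarrow> bool" where
  "comeager_in X A \<longleftrightarrow> A \<subseteq> topspace X \<and> meager_in X (topspace X - A)"


section \<open>Copulas and Extreme Value copulas\<close>

abbreviation unit_interval :: "real set" where
  "unit_interval \<equiv> {0..1}"

abbreviation unit_square :: "(real \<times> real) set" where
  "unit_square \<equiv> unit_interval \<times> unit_interval"

abbreviation unit_lebesgue :: "real measure" where
  "unit_lebesgue \<equiv> restrict_space lborel unit_interval"

definition joint_cdf :: "(real \<times> real) measure \<Rightarrow> real \<times> real \<Rightarrow> real" where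
  "joint_cdf M = (\<lambda>(x, y). measure M ({..x} \<times> {..y}))"

text \<open>
  Copulas are functions on the unit square only, hence represented by extensional functions
  (\<^term>\<open>undefined\<close> elsewhere), so that equality of copulas is HOL equality.
\<close>

definition copula :: "(real \<times> real \<Rightarrow> real) \<Rightarrow> bool" where
  "copula C \<longleftrightarrow>
     (\<exists>M. prob_space M \<and> sets M = sets borel \<and>
          distr M borel fst = uniform_measure lborel unit_interval \<and>
          distr M borel snd = uniform_measure lborel unit_interval \<and>
          C = restrict (joint_cdf M) unit_square)"

definition ev_copulas :: "(real \<times> real \<Rightarrow> real) set" where
  "ev_copulas = {C. copula C \<and>
     (\<exists>B. copula B \<and>
        (\<forall>x\<in>unit_interval. \<forall>y\<in>unit_interval.
           (\<lambda>n. B (root n x, root n y) ^ n) \<longlonglongrightarrow> C (x, y)))}"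

text \<open>
  The metric of \<^const>\<open>funspace\<close> is the supremum metric on bounded extensional functions.
\<close>

definition ev_topology :: "(real \<times> real \<Rightarrow> real) topology" where
  "ev_topology = mtopology_of (submetric (funspace unit_square euclidean_metric) ev_copulas)"

lemma copula_extensional: "copula C \<Longrightarrow> C \<in> extensional unit_square"
  unfolding copula_def by auto

lemma copula_range:
  assumes "copula C" "z \<in> unit_square"
  shows "C z \<in> unit_interval"
  using assms unfolding copula_def joint_cdf_def
  by (auto simp: prob_space.prob_le_1)

lemma topspace_ev_topology [simp]: "topspace ev_topology = ev_copulas"
proof -
  have "C \<in> mspace (funspace unit_square euclidean_metric)" if "copula C" for C
  proof -
    have "C ` unit_square \<subseteq> unit_interval"
      using copula_range[OF that] by blast
    then have "bounded (C ` unit_square)"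
      using bounded_closed_interval bounded_subset by blast
    then show ?thesis
      using copula_extensional[OF that] by (simp add: Met_TC.fspace_def)
  qed
  then show ?thesis
    unfolding ev_topology_def by (auto simp: ev_copulas_def)
qed


section \<open>The measure of a copula and its support\<close>

definition doubly_stochastic :: "(real \<times> real) measure \<Rightarrow> bool" where
  "doubly_stochastic M \<longleftrightarrow>
     sets M = sets (unit_lebesgue \<Otimes>\<^sub>M unit_lebesgue) \<and>
     distr M unit_lebesgue fst = unit_lebesgue \<and>
     distr M unit_lebesgue snd = unit_lebesgue"

definition copula_measure :: "(real \<times> real \<Rightarrow> real) \<Rightarrow> (real \<times> real) measure" where
  "copula_measure C = (THE M. doubly_stochastic M \<and>
     (\<forall>x\<in>unit_interval. \<forall>y\<in>unit_interval. measure M ({0..x} \<times> {0..y}) = C (x, y)))"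

definition measure_support :: "'a::topological_space measure \<Rightarrow> 'a set" where
  "measure_support M =
     {z \<in> space M. \<forall>U. open U \<longrightarrow> z \<in> U \<longrightarrow> emeasure M (U \<inter> space M) > 0}"


section \<open>Markov kernels and the three components\<close>

text \<open>
  The \<open>\<sigma>\<close>-algebras of \<^const>\<open>prob_algebra\<close> and \<^const>\<open>subprob_algebra\<close> depend only on
  the measurable space underlying \<^term>\<open>unit_lebesgue\<close>; the arrows below therefore say
  ``Markov kernel'' and ``sub-Markov kernel'' on the unit interval.
\<close>

definition is_copula_kernel ::
    "(real \<times> real \<Rightarrow> real) \<Rightarrow> (real \<Rightarrow> real measure) \<Rightarrow> bool" where
  "is_copula_kernel C K \<longleftrightarrow>
     K \<in> unit_lebesgue \<rightarrow>\<^sub>M prob_algebra unit_lebesgue \<and>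
     (\<forall>E\<in>sets unit_lebesgue. \<forall>F\<in>sets unit_lebesgue.
        emeasure (copula_measure C) (E \<times> F) = (\<integral>\<^sup>+x\<in>E. emeasure (K x) F \<partial>unit_lebesgue))"

definition discrete_measure :: "real measure \<Rightarrow> bool" where
  "discrete_measure \<nu> \<longleftrightarrow> (\<exists>S\<in>sets \<nu>. countable S \<and> emeasure \<nu> (space \<nu> - S) = 0)"

definition singular_measure :: "real measure \<Rightarrow> bool" where
  "singular_measure \<nu> \<longleftrightarrow>
     (\<forall>y\<in>space \<nu>. emeasure \<nu> {y} = 0) \<and>
     (\<exists>N\<in>null_sets unit_lebesgue. emeasure \<nu> (space \<nu> - N) = 0)"

definition kernel_decomposition ::
    "(real \<Rightarrow> real measure) \<Rightarrow>
     (real \<Rightarrow> real measure) \<times> (real \<Rightarrow> real measure) \<times> (real \<Rightarrow> real measure) \<Rightarrow> bool" where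
  "kernel_decomposition K = (\<lambda>(Kabs, Kdis, Ksing).
     Kabs \<in> unit_lebesgue \<rightarrow>\<^sub>M subprob_algebra unit_lebesgue \<and>
     Kdis \<in> unit_lebesgue \<rightarrow>\<^sub>M subprob_algebra unit_lebesgue \<and>
     Ksing \<in> unit_lebesgue \<rightarrow>\<^sub>M subprob_algebra unit_lebesgue \<and>
     (\<forall>x\<in>unit_interval.
        absolutely_continuous unit_lebesgue (Kabs x) \<and>
        discrete_measure (Kdis x) \<and>
        singular_measure (Ksing x) \<and>
        (\<forall>F\<in>sets unit_lebesgue.
           emeasure (K x) F = emeasure (Kabs x) F + emeasure (Kdis x) F + emeasure (Ksing x) F)))"

text \<open>
  The kernel of a copula is determined only up to a Lebesgue null set of \<open>x\<close>, so a version is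
  fixed by choice. For a given version the decomposition is unique, and the measures
  \<open>abs_component\<close>, \<open>dis_component\<close>, \<open>sing_component\<close> below do not depend on the version.
\<close>

definition copula_kernel_parts ::
    "(real \<times> real \<Rightarrow> real) \<Rightarrow>
     (real \<Rightarrow> real measure) \<times> (real \<Rightarrow> real measure) \<times> (real \<Rightarrow> real measure)" where
  "copula_kernel_parts C =
     (SOME P. \<exists>K. is_copula_kernel C K \<and> kernel_decomposition K P)"

definition kernel_measure :: "(real \<Rightarrow> real measure) \<Rightarrow> (real \<times> real) measure" where
  "kernel_measure K =
     unit_lebesgue \<bind> (\<lambda>x. distr (K x) (unit_lebesgue \<Otimes>\<^sub>M unit_lebesgue) (Pair x))"

definition abs_component :: "(real \<times> real \<Rightarrow> real) \<Rightarrow> (real \<times> real) measure" where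
  "abs_component C = kernel_measure (fst (copula_kernel_parts C))"

definition dis_component :: "(real \<times> real \<Rightarrow> real) \<Rightarrow> (real \<times> real) measure" where
  "dis_component C = kernel_measure (fst (snd (copula_kernel_parts C)))"

definition sing_component :: "(real \<times> real \<Rightarrow> real) \<Rightarrow> (real \<times> real) measure" where
  "sing_component C = kernel_measure (snd (snd (copula_kernel_parts C)))"

lemma emeasure_kernel_measure:
  assumes K: "K \<in> unit_lebesgue \<rightarrow>\<^sub>M subprob_algebra unit_lebesgue"
    and E: "E \<in> sets unit_lebesgue" and F: "F \<in> sets unit_lebesgue"
  shows "emeasure (kernel_measure K) (E \<times> F) = (\<integral>\<^sup>+x\<in>E. emeasure (K x) F \<partial>unit_lebesgue)"
proof -
  let ?L = unit_lebesgue
  note K[measurable]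
  have "(\<lambda>x. distr (K x) (?L \<Otimes>\<^sub>M ?L) (Pair x)) \<in> ?L \<rightarrow>\<^sub>M subprob_algebra (?L \<Otimes>\<^sub>M ?L)"
    by (rule measurable_distr2[where M = ?L]) (use K in measurable)
  moreover have "E \<times> F \<in> sets (?L \<Otimes>\<^sub>M ?L)"
    using E F by simp
  ultimately have "emeasure (kernel_measure K) (E \<times> F) =
      (\<integral>\<^sup>+x. emeasure (distr (K x) (?L \<Otimes>\<^sub>M ?L) (Pair x)) (E \<times> F) \<partial>?L)"
    unfolding kernel_measure_def by (intro emeasure_bind) auto
  also have "\<dots> = (\<integral>\<^sup>+x. emeasure (K x) F * indicator E x \<partial>?L)"
  proof (rule nn_integral_cong)
    fix x assume x: "x \<in> space ?L"
    have sK: "sets (K x) = sets ?L"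
      using sets_kernel[OF K x] .
    have sp: "space (K x) = space ?L"
      using sets_eq_imp_space_eq[OF sK] .
    have P: "Pair x \<in> K x \<rightarrow>\<^sub>M ?L \<Otimes>\<^sub>M ?L"
      using measurable_Pair1'[OF x, of ?L] by (simp add: measurable_cong_sets[OF sK refl])
    have "Pair x -` (E \<times> F) \<inter> space (K x) = (if x \<in> E then F else {})"
      using sets.sets_into_space[OF F] by (auto simp: sp)
    then show "emeasure (distr (K x) (?L \<Otimes>\<^sub>M ?L) (Pair x)) (E \<times> F) = emeasure (K x) F * indicator E x"
      using E F by (subst emeasure_distr[OF P]) (auto simp: indicator_def)
  qed
  finally show ?thesis .
qed

end

theory Submission
  imports Defs
begin

text \<open>
  An Extreme Value copula has the form \<open>C(x, y) = y powr h(ln x / ln y)\<close> on the open unit square, where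
  \<open>h\<close> is convex on the positive reals and \<open>max 1 s \<le> h s \<le> 1 + s\<close>; conversely every such \<open>h\<close>
  occurs. The conditional distribution function at \<open>x\<close> is \<open>C(x, y) / x * h'(ln x / ln y)\<close>
  with the right derivative \<open>h'\<close>. Hence the kernels have no atoms and \<open>\<partial>\<^sub>1 C\<close> exists as
  soon as \<open>h'\<close> is continuous, the support is full as soon as \<open>h s > max 1 s\<close>, and \<open>C\<close> is not
  absolutely continuous if \<open>h'\<close> gains a fixed amount on finite unions of intervals of
  arbitrarily small total length. Each of these properties fails only on countably many
  nowhere dense sets: mixing \<open>h\<close> with \<open>1 + s\<close> makes it larger than \<open>max 1 s\<close>, averaging \<open>M\<close>
  rescalings \<open>h(a\<^sub>j s)\<close> pushes all jumps of \<open>h'\<close> below a multiple of \<open>1 / M\<close> because the total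
  increase of \<open>h'\<close> is at most \<open>1\<close>, and piecewise linear interpolation concentrates the increase of
  \<open>h'\<close> in finitely many points.
\<close>

section \<open>Profiles and their right derivatives\<close>

text \<open>Uniform convergence of copulas controls neither kernels nor derivatives, so conditions
  on \<open>rderiv h\<close> are not closed conditions as they stand. They are tested by difference
  quotients of the stable tail dependence function, \<open>tail_fun C s 1 = h s\<close>, at fixed
  arguments; these are continuous functionals of \<open>C\<close>, and convexity of \<open>h\<close>
  bounds \<open>rderiv h\<close> by them from both sides. Exceptional sets cut out by weak
  inequalities between such functionals are closed, and nowhere dense once every profile in them has
  arbitrarily small perturbations that leave the set. A perturbation of \<open>h\<close> may be as
  large as \<open>e * max 1 s\<close> at \<open>s\<close>: after exponentiation it moves the copula
  by at most \<open>e\<close>. This tolerance admits rescalings of \<open>s\<close>, whose error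
  grows linearly. The components of a copula come from a version of its kernel fixed by choice,
  about which nothing is known until some version is shown to have a measurable decomposition. That
  existence is proved for kernels without atoms, from one Lebesgue decomposition of the measure on
  the square.\<close>

text \<open>
  The Pickands dependence function of the copula is \<open>A t = (1 - t) * h (t / (1 - t))\<close>.
\<close>

locale profile =
  fixes h :: "real \<Rightarrow> real"
  assumes convex: "convex_on {0<..} h"
    and ge_one: "0 < s \<Longrightarrow> 1 \<le> h s"
    and ge_id: "0 < s \<Longrightarrow> s \<le> h s"
    and le_succ: "0 < s \<Longrightarrow> h s \<le> 1 + s"

lemma convex_on_slope_mono:
  fixes f :: "real \<Rightarrow> real"
  assumes "convex_on I f" "a \<in> I" "c \<in> I" "a < b" "b < c"
  shows "(f b - f a) / (b - a) \<le> (f c - f b) / (c - b)"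
proof -
  have "(f a - f b) / (a - b) \<le> (f b - f c) / (b - c)"
    using convex_on_slope_le[OF assms] by linarith
  then show ?thesis
    by (metis minus_diff_eq minus_divide_divide)
qed

text \<open>Right chord slopes of a convex function decrease as \<open>t\<close> approaches
  \<open>s\<close>, so their infimum is the right derivative. The infimum form gives comparisons
  with chord slopes without taking limits.\<close>

definition rderiv :: "(real \<Rightarrow> real) \<Rightarrow> real \<Rightarrow> real" where
  "rderiv h s = (INF t\<in>{s<..}. (h t - h s) / (t - s))"

context profile
begin

lemma slope_mono:
  assumes "0 < a" "a < b" "b < c"
  shows "(h b - h a) / (b - a) \<le> (h c - h b) / (c - b)"
  using convex_on_slope_mono[OF convex, of a c b] assms by simp

text \<open>If some chord had negative slope, then by convexity so would all chords to its left,
  hence \<open>h a < h r\<close> for all small \<open>r\<close>. But \<open>h r \<le> 1 + r\<close>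
  comes arbitrarily close to \<open>1\<close>, while \<open>h a > h b \<ge> 1\<close>.\<close>

lemma mono:
  assumes "0 < a" "a \<le> b" shows "h a \<le> h b"
proof (rule ccontr)
  assume neg: "\<not> h a \<le> h b"
  then have ab: "a < b" using assms by (cases "a = b") auto
  have *: "h a \<le> 1 + r" if "0 < r" "r < a" for r
  proof -
    have "(h a - h r) / (a - r) \<le> (h b - h a) / (b - a)"
      using slope_mono that ab by blast
    also have "\<dots> < 0" using neg ab by (simp add: divide_neg_pos)
    finally have "h a < h r" using that by (simp add: divide_less_0_iff)
    then show ?thesis using le_succ[of r] that by simp
  qed
  have "h a - 1 > 0" using neg ge_one[of b] assms by simp
  moreover define r where "r = min (a / 2) ((h a - 1) / 2)"
  ultimately have "0 < r" "r < a" "1 + r < h a" using assms by (auto simp: min_def field_simps)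
  then show False using *[of r] by simp
qed

text \<open>A chord slope above \<open>1\<close> would be inherited by all chords further right, and
  \<open>h\<close> would eventually exceed \<open>1 + s\<close>.\<close>

lemma lipschitz:
  assumes "0 < a" "a \<le> b" shows "h b - h a \<le> b - a"
proof (rule ccontr)
  assume neg: "\<not> h b - h a \<le> b - a"
  then have ab: "a < b" using assms by (cases "a = b") auto
  define q where "q = (h b - h a) / (b - a)"
  have q: "q > 1" using neg ab by (simp add: q_def)
  have *: "q * (c - b) \<le> 1 + c - h b" if "b < c" for c
  proof -
    have "q \<le> (h c - h b) / (c - b)" unfolding q_def using slope_mono assms ab that by blast
    then have "q * (c - b) \<le> h c - h b" using that by (simp add: pos_le_divide_eq)
    then show ?thesis using le_succ[of c] that assms by simp
  qed
  \<comment> \<open>Far enough out that \<open>(q - 1) * (c - b)\<close> exceeds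
    \<open>1 + b - h b\<close>, the bound imposed on it by the preceding fact.\<close>
  define c where "c = b + (2 + b) / (q - 1)"
  have c: "b < c" using q assms by (simp add: c_def)
  have "(q - 1) * (c - b) = 2 + b" using q by (simp add: c_def)
  then have "q * (c - b) = 2 + b + (c - b)" by (simp add: algebra_simps)
  then show False using *[OF c] ge_one[of b] assms by simp
qed

lemma abs_diff_le: "0 < a \<Longrightarrow> 0 < b \<Longrightarrow> \<bar>h b - h a\<bar> \<le> \<bar>b - a\<bar>"
  using lipschitz[of a b] lipschitz[of b a] mono[of a b] mono[of b a] by (cases "a \<le> b") auto

lemma continuous: "continuous_on {0<..} h"
  by (rule convex_on_continuous[OF _ convex]) simp

lemma tendsto_compose:
  assumes "(f \<longlongrightarrow> s) F" "0 < s" shows "((\<lambda>x. h (f x)) \<longlongrightarrow> h s) F"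
  using continuous_on_tendsto_compose[OF continuous assms(1)] assms order_tendstoD(1)[OF assms(1,2)]
  by simp

lemma bdd_below_slopes: "0 < s \<Longrightarrow> bdd_below ((\<lambda>t. (h t - h s) / (t - s)) ` {s<..})"
  by (rule bdd_belowI2[of _ 0]) (use mono[of s] in auto)

lemma rderiv_le_slope:
  assumes "0 < s" "s < t" shows "rderiv h s \<le> (h t - h s) / (t - s)"
  unfolding rderiv_def by (rule cINF_lower[OF bdd_below_slopes]) (use assms in auto)

lemma slope_le_rderiv:
  assumes "0 < r" "r < s" shows "(h s - h r) / (s - r) \<le> rderiv h s"
  unfolding rderiv_def by (rule cINF_greatest) (use assms slope_mono in auto)

lemma rderiv_mono: "0 < s \<Longrightarrow> s \<le> t \<Longrightarrow> rderiv h s \<le> rderiv h t"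
  using rderiv_le_slope[of s t] slope_le_rderiv[of s t] by (cases "s = t") auto

lemma rderiv_nonneg: "0 < s \<Longrightarrow> 0 \<le> rderiv h s"
  unfolding rderiv_def by (rule cINF_greatest) (use mono in auto)

lemma rderiv_le_one: "0 < s \<Longrightarrow> rderiv h s \<le> 1"
  using rderiv_le_slope[of s "s+1"] lipschitz[of s "s+1"] by auto

lemma rderiv_approx:
  assumes "0 < s" "rderiv h s < b"
  obtains t where "s < t" "(h t - h s) / (t - s) < b"
  using assms cINF_less_iff[OF _ bdd_below_slopes, of s b] unfolding rderiv_def by auto

lemma slope_left_mono:
  assumes "0 < s" "s < t" "t \<le> c" shows "(h t - h s) / (t - s) \<le> (h c - h s) / (c - s)"
proof (cases "t = c")
  case False
  then show ?thesis using convex_on_slope_le(1)[OF convex, of s c t] assms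
    by (metis greaterThan_iff less_trans order_le_less minus_diff_eq minus_divide_divide)
qed simp

lemma tendsto_rderiv:
  assumes "0 < s" shows "((\<lambda>t. (h t - h s) / (t - s)) \<longlongrightarrow> rderiv h s) (at_right s)"
proof (rule order_tendstoI)
  fix a assume a: "a < rderiv h s"
  show "\<forall>\<^sub>F t in at_right s. a < (h t - h s) / (t - s)"
    using eventually_at_right_less[of s] by eventually_elim (use rderiv_le_slope[OF assms] a in force)
next
  fix b assume "rderiv h s < b"
  then obtain c where c: "s < c" "(h c - h s) / (c - s) < b" using rderiv_approx[OF assms] by blast
  have "(h t - h s) / (t - s) < b" if "s < t" "t < c" for t
    using slope_left_mono[of s t c] assms that c by auto
  then show "\<forall>\<^sub>F t in at_right s. (h t - h s) / (t - s) < b"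
    unfolding eventually_at_right_field using c by blast
qed

text \<open>The slope of the chord from \<open>t\<close> to a fixed \<open>c\<close> bounds
  \<open>rderiv h t\<close> from above and is continuous in \<open>t\<close>, so a value below
  \<open>b\<close> at \<open>s\<close> persists to the right. The lower bound is
  monotonicity.\<close>

lemma rderiv_right_continuous:
  assumes "0 < s" shows "(rderiv h \<longlongrightarrow> rderiv h s) (at_right s)"
proof (rule order_tendstoI)
  fix a assume a: "a < rderiv h s"
  show "\<forall>\<^sub>F t in at_right s. a < rderiv h t"
    using eventually_at_right_less[of s]
  proof eventually_elim
    case (elim x)
    then show ?case using rderiv_mono[OF assms, of x] a by simp
  qed
next
  fix b assume "rderiv h s < b"
  then obtain c where c: "s < c" "(h c - h s) / (c - s) < b" using rderiv_approx[OF assms] by blast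
  have "((\<lambda>t. (h c - h t) / (c - t)) \<longlongrightarrow> (h c - h s) / (c - s)) (at_right s)"
    using c assms by (intro tendsto_intros tendsto_compose) auto
  then have "\<forall>\<^sub>F t in at_right s. (h c - h t) / (c - t) < b"
    using c order_tendstoD(2) by blast
  moreover have "\<forall>\<^sub>F t in at_right s. s < t \<and> t < c"
    unfolding eventually_at_right_field using c by blast
  ultimately show "\<forall>\<^sub>F t in at_right s. rderiv h t < b"
  proof eventually_elim
    case (elim x)
    then show ?case using rderiv_le_slope[of x c] assms by auto
  qed
qed

text \<open>Right quotients converge by \<open>tendsto_rderiv\<close>. The left quotient at
  \<open>t\<close> lies between \<open>rderiv h t\<close> and \<open>rderiv h s\<close> by
  convexity, so continuity of \<open>rderiv h\<close> squeezes it.\<close>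

lemma has_real_derivative_rderiv:
  assumes "0 < s" and cont: "(rderiv h \<longlongrightarrow> rderiv h s) (at s)"
  shows "(h has_real_derivative rderiv h s) (at s)"
proof -
  have "((\<lambda>t. (h t - h s) / (t - s)) \<longlongrightarrow> rderiv h s) (at_left s)"
  proof (rule tendsto_sandwich)
    have *: "\<forall>\<^sub>F t in at_left s. 0 < t \<and> t < s"
      unfolding eventually_at_left_field using assms by blast
    show "\<forall>\<^sub>F t in at_left s. rderiv h t \<le> (h t - h s) / (t - s)"
      using *
    proof eventually_elim
      case (elim t)
      then show ?case using rderiv_le_slope[of t s] by (metis minus_diff_eq minus_divide_divide)
    qed
    show "\<forall>\<^sub>F t in at_left s. (h t - h s) / (t - s) \<le> rderiv h s"
      using *
    proof eventually_elim
      case (elim t)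
      then show ?case using slope_le_rderiv[of t s] by (metis minus_diff_eq minus_divide_divide)
    qed
    show "(rderiv h \<longlongrightarrow> rderiv h s) (at_left s)"
      using cont by (simp add: filterlim_at_split)
  qed simp
  then show ?thesis
    unfolding has_field_derivative_iff
    using tendsto_rderiv[OF assms(1)] by (simp add: filterlim_at_split)
qed

end

section \<open>The function and the conditional distributions of a profile\<close>

text \<open>
  The left difference quotients of \<open>g\<close> are bounded, so their integrals, which telescope,
  converge to the integral of \<open>f\<close>. No exceptional set has to be discussed this way.
\<close>

lemma has_integral_left_derivative:
  fixes g f :: "real \<Rightarrow> real"
  assumes lip: "\<And>s t. \<bar>g s - g t\<bar> \<le> \<bar>s - t\<bar>" and ab: "a \<le> b"
    and der: "\<And>x. a < x \<Longrightarrow> x < b \<Longrightarrow> (g has_real_derivative f x) (at x within {..x})"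
  shows "(f has_integral (g b - g a)) {a<..<b}"
proof -
  have contg: "continuous_on UNIV g"
    unfolding continuous_on_iff dist_real_def using lip by (meson le_less_trans)
  define \<delta> where "\<delta> n = 1 / real (Suc n)" for n
  have \<delta>: "0 < \<delta> n" "\<delta> n \<le> 1" for n by (auto simp: \<delta>_def)
  have \<delta>0: "\<delta> \<longlonglongrightarrow> 0" unfolding \<delta>_def using LIMSEQ_inverse_real_of_nat by (simp add: inverse_eq_divide)
  \<comment> \<open>A primitive of \<open>g\<close> is needed down to \<open>a - \<delta> n\<close>;
    starting at \<open>a - 2\<close> leaves room because \<open>\<delta> n \<le> 1\<close>. The
    integral of \<open>?q n\<close> is a difference of two difference quotients of
    \<open>G\<close>.\<close>
  define G where "G x = integral {a - 2..x} g" for x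
  have G: "(G has_real_derivative g x) (at x)" if "a - 2 < x" for x
  proof -
    have "((\<lambda>u. integral {a - 2..u} g) has_real_derivative g x) (at x within {a - 2..x + 1})"
      by (rule integral_has_real_derivative) (use that contg continuous_on_subset in auto)
    then show ?thesis unfolding G_def using that by (simp add: at_within_Icc_at)
  qed
  let ?q = "\<lambda>n t. (g t - g (t - \<delta> n)) / \<delta> n"
  have q_int: "(?q n has_integral ((G b - G (b - \<delta> n)) / \<delta> n - (G a - G (a - \<delta> n)) / \<delta> n)) {a<..<b}" for n
  proof -
    have "((\<lambda>t. (G t - G (t - \<delta> n)) / \<delta> n) has_real_derivative ?q n t) (at t within {a..b})" if "t \<in> {a..b}" for t
    proof -
      have "(G has_real_derivative g t) (at t)" using that by (intro G) simp
      moreover have "((\<lambda>t. G (t - \<delta> n)) has_real_derivative g (t - \<delta> n) * 1) (at t)"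
        using that \<delta>[of n]
        by (intro DERIV_chain2[where f=G and g="\<lambda>t. t - \<delta> n"] G) (auto intro!: derivative_eq_intros)
      ultimately show ?thesis
        using DERIV_cdivide[OF DERIV_diff] has_field_derivative_at_within by fastforce
    qed
    then have "(?q n has_integral ((G b - G (b - \<delta> n)) / \<delta> n - (G a - G (a - \<delta> n)) / \<delta> n)) {a..b}"
      using fundamental_theorem_of_calculus[OF ab, of "\<lambda>t. (G t - G (t - \<delta> n)) / \<delta> n" "?q n"]
      by (simp add: has_real_derivative_iff_has_vector_derivative)
    then show ?thesis using has_integral_Icc_iff_Ioo by blast
  qed
  have filt: "filterlim (\<lambda>n. - \<delta> n) (at 0) sequentially"
  proof -
    have "- \<delta> n \<noteq> 0" for n using \<delta>(1)[of n] by simp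
    then show ?thesis unfolding filterlim_at using tendsto_minus[OF \<delta>0] by simp
  qed
  have G_lim: "(\<lambda>n. (G x - G (x - \<delta> n)) / \<delta> n) \<longlonglongrightarrow> g x" if "a - 2 < x" for x
  proof -
    have "(\<lambda>n. (G (x + - \<delta> n) - G x) / (- \<delta> n)) \<longlonglongrightarrow> g x"
      using filterlim_compose[OF G[OF that, unfolded DERIV_def] filt] by simp
    moreover have "(G (x + - \<delta> n) - G x) / (- \<delta> n) = (G x - G (x - \<delta> n)) / \<delta> n" for n
      using \<delta>[of n] by (simp add: field_simps)
    ultimately show ?thesis by simp
  qed
  have lim: "(\<lambda>n. ?q n x) \<longlonglongrightarrow> f x" if "x \<in> {a<..<b}" for x
  proof -
    have "((\<lambda>t. (g t - g x) / (t - x)) \<longlongrightarrow> f x) (at x within {..x})"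
      using der that by (simp add: has_field_derivative_iff)
    moreover have "filterlim (\<lambda>n. x - \<delta> n) (at x within {..x}) sequentially"
    proof -
      have "x - \<delta> n \<in> {..x} \<and> x - \<delta> n \<noteq> x" for n using \<delta>(1)[of n] by simp
      then show ?thesis unfolding filterlim_at using tendsto_diff[OF tendsto_const \<delta>0, of x] by simp
    qed
    ultimately have "(\<lambda>n. (g (x - \<delta> n) - g x) / (x - \<delta> n - x)) \<longlonglongrightarrow> f x"
      by (rule filterlim_compose)
    moreover have "(g (x - \<delta> n) - g x) / (x - \<delta> n - x) = (g x - g (x - \<delta> n)) / \<delta> n" for n
      using \<delta>[of n] by (simp add: field_simps)
    ultimately show ?thesis by simp
  qed
  have bound: "norm (?q n x) \<le> 1" for n x
    using lip[of x "x - \<delta> n"] \<delta>[of n] by (simp add: abs_divide)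
  have dc: "f integrable_on {a<..<b}" "(\<lambda>n. integral {a<..<b} (?q n)) \<longlonglongrightarrow> integral {a<..<b} f"
  proof -
    have 1: "?q n integrable_on {a<..<b}" for n using q_int by blast
    have 2: "(\<lambda>_. 1 :: real) integrable_on {a<..<b}" by (simp add: integrable_on_open_interval_real integrable_continuous_interval)
    show "f integrable_on {a<..<b}" "(\<lambda>n. integral {a<..<b} (?q n)) \<longlonglongrightarrow> integral {a<..<b} f"
      using dominated_convergence[OF 1 2 bound lim] by blast+
  qed
  have "(\<lambda>n. integral {a<..<b} (?q n)) \<longlonglongrightarrow> g b - g a"
    using tendsto_diff[OF G_lim[of b] G_lim[of a]] ab integral_unique[OF q_int] by simp
  then have "integral {a<..<b} f = g b - g a" by (rule LIMSEQ_unique[OF dc(2)])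
  then show ?thesis using integrable_integral[OF dc(1)] by simp
qed

text \<open>
  \<open>min x y\<close> gives the boundary values on the unit square; the values for \<open>x\<close> outside the unit
  interval make \<open>ev_fun h\<close> Lipschitz in \<open>x\<close> on the whole line.
\<close>

definition ev_fun :: "(real \<Rightarrow> real) \<Rightarrow> real \<Rightarrow> real \<Rightarrow> real" where
  "ev_fun h x y = (if x \<in> {0<..<1} \<and> y \<in> {0<..<1} then exp (ln y * h (ln x / ln y)) else min x y)"

text \<open>Since \<open>ln x / ln y\<close> increases with \<open>y\<close> and decreases with
  \<open>x\<close>, the right derivative of \<open>h\<close> makes this right-continuous in
  \<open>y\<close> and equal to the left partial derivative of \<open>ev_fun h\<close> in
  \<open>x\<close>. The values outside the unit interval complete it to a distribution function on
  the line.\<close>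

definition cond_cdf :: "(real \<Rightarrow> real) \<Rightarrow> real \<Rightarrow> real \<Rightarrow> real" where
  "cond_cdf h x y = (if y \<le> 0 then 0 else if 1 \<le> y then 1
     else ev_fun h x y / x * rderiv h (ln x / ln y))"

lemma ln_ratio_pos: "x \<in> {0<..<1} \<Longrightarrow> y \<in> {0<..<1} \<Longrightarrow> 0 < ln x / ln (y::real)"
  by (simp add: divide_neg_neg)

lemma ln_ratio_mono_right:
  assumes "x \<in> {0<..<1}" "y \<in> {0<..<1}" "y' \<in> {0<..<1}" "y < (y'::real)"
  shows "ln x / ln y < ln x / ln y'"
proof -
  have "ln y < ln y'" "ln y' < 0" "ln x < 0" using assms by auto
  then show ?thesis by (simp add: divide_strict_left_mono_neg mult_neg_neg)
qed

lemma ln_ratio_mono_right':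
  assumes "x \<in> {0<..<1}" "y \<in> {0<..<1}" "y' \<in> {0<..<1}" "y \<le> (y'::real)"
  shows "ln x / ln y \<le> ln x / ln y'"
  using ln_ratio_mono_right[of x y y'] assms by (cases "y = y'") auto

lemma ln_ratio_mono_left:
  assumes "x \<in> {0<..<1}" "y \<in> {0<..<1}" "x \<le> (x'::real)"
  shows "ln x' / ln y \<le> ln x / ln y"
  using assms by (intro divide_right_mono_neg) auto

section \<open>Bounds and monotonicity of the copula function and its conditional
  distributions\<close>

context profile
begin

lemma ev_fun_pos: "x \<in> {0<..<1} \<Longrightarrow> y \<in> {0<..<1} \<Longrightarrow> 0 < ev_fun h x y"
  by (simp add: ev_fun_def)

text \<open>Multiplication by \<open>ln y < 0\<close> reverses the bounds on \<open>h\<close>: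
  \<open>h s \<le> 1 + s\<close> puts the independence copula below, and \<open>s \<le> h s\<close>,
  \<open>1 \<le> h s\<close> put \<open>min x y\<close> above in the next two lemmas.\<close>

lemma ev_fun_ge_mult:
  assumes "x \<in> {0<..<1}" "y \<in> {0<..<1}" shows "x * y \<le> ev_fun h x y"
proof -
  have "ln x + ln y = ln y * (1 + ln x / ln y)" using assms by (simp add: field_simps)
  also have "\<dots> \<le> ln y * h (ln x / ln y)"
    using le_succ[OF ln_ratio_pos[OF assms]] assms by (intro mult_left_mono_neg) auto
  finally have "exp (ln x + ln y) \<le> ev_fun h x y" using assms by (simp add: ev_fun_def)
  then show ?thesis using assms by (simp add: exp_add)
qed

lemma ev_fun_le_left:
  assumes "x \<in> {0<..<1}" "y \<in> {0<..<1}" shows "ev_fun h x y \<le> x"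
proof -
  have "ln y * h (ln x / ln y) \<le> ln y * (ln x / ln y)"
    using ge_id[OF ln_ratio_pos[OF assms]] assms by (intro mult_left_mono_neg) auto
  also have "\<dots> = ln x" using assms by simp
  finally have "exp (ln y * h (ln x / ln y)) \<le> exp (ln x)" by simp
  also have "exp (ln x) = x" using assms by simp
  finally show ?thesis using assms by (simp add: ev_fun_def)
qed

lemma ev_fun_le_right:
  assumes "x \<in> {0<..<1}" "y \<in> {0<..<1}" shows "ev_fun h x y \<le> y"
proof -
  have "ln y * h (ln x / ln y) \<le> ln y * 1"
    using ge_one[OF ln_ratio_pos[OF assms]] assms by (intro mult_left_mono_neg) auto
  then have "exp (ln y * h (ln x / ln y)) \<le> exp (ln y)" by simp
  also have "exp (ln y) = y" using assms by simp
  finally show ?thesis using assms by (simp add: ev_fun_def)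
qed

lemma ev_fun_mono_left:
  assumes "x \<in> {0<..<1}" "x' \<in> {0<..<1}" "y \<in> {0<..<1}" "x \<le> x'"
  shows "ev_fun h x y \<le> ev_fun h x' y"
proof -
  have "h (ln x' / ln y) \<le> h (ln x / ln y)"
    using assms by (intro mono ln_ratio_mono_left ln_ratio_pos) auto
  then have "ln y * h (ln x / ln y) \<le> ln y * h (ln x' / ln y)"
    using assms by (intro mult_left_mono_neg) auto
  then show ?thesis using assms by (simp add: ev_fun_def)
qed

text \<open>The Lipschitz bound of \<open>h\<close> gives the ratio bound
  \<open>C(x', y) / C(x, y) \<le> x' / x\<close>, and \<open>C(x, y) \<le> x\<close> turns the ratio
  into a difference.\<close>

lemma ev_fun_diff_left_aux:
  assumes "x \<in> {0<..<1}" "x' \<in> {0<..<1}" "y \<in> {0<..<1}" "x \<le> x'"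
  shows "ev_fun h x' y - ev_fun h x y \<le> x' - x"
proof -
  have "h (ln x / ln y) - h (ln x' / ln y) \<le> ln x / ln y - ln x' / ln y"
    using assms by (intro lipschitz ln_ratio_mono_left ln_ratio_pos) auto
  then have "ln y * (ln x / ln y - ln x' / ln y) \<le> ln y * (h (ln x / ln y) - h (ln x' / ln y))"
    using assms by (intro mult_left_mono_neg) auto
  then have "ln y * h (ln x' / ln y) \<le> ln y * h (ln x / ln y) + (ln x' - ln x)"
    using assms by (simp add: algebra_simps)
  then have "exp (ln y * h (ln x' / ln y)) \<le> exp (ln y * h (ln x / ln y) + (ln x' - ln x))" by simp
  then have "ev_fun h x' y \<le> ev_fun h x y * (x' / x)"
    using assms by (simp add: ev_fun_def exp_add exp_diff)
  then have "ev_fun h x' y - ev_fun h x y \<le> ev_fun h x y * (x' / x - 1)" by (simp add: algebra_simps)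
  also have "\<dots> \<le> x * (x' / x - 1)"
    using assms ev_fun_le_left[of x y] by (intro mult_right_mono) auto
  also have "\<dots> = x' - x" using assms by (simp add: field_simps)
  finally show ?thesis .
qed

lemma ev_fun_left_bounds:
  assumes y: "y \<in> {0<..<1}" and "s \<le> t"
  shows "0 \<le> ev_fun h t y - ev_fun h s y" "ev_fun h t y - ev_fun h s y \<le> t - s"
proof -
  consider "t \<le> 0" | "s \<le> 0" "t \<in> {0<..<1}" | "s \<le> 0" "1 \<le> t" | "s \<in> {0<..<1}" "t \<in> {0<..<1}"
    | "s \<in> {0<..<1}" "1 \<le> t" | "1 \<le> s" using \<open>s \<le> t\<close> by fastforce
  then have "0 \<le> ev_fun h t y - ev_fun h s y \<and> ev_fun h t y - ev_fun h s y \<le> t - s"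
  proof cases
    case 2
    then show ?thesis using y ev_fun_le_left[of t y] ev_fun_pos[of t y] by (auto simp: ev_fun_def[of h s])
  next
    case 4
    then show ?thesis using y assms ev_fun_diff_left_aux[of s t y] ev_fun_mono_left[of s t y] by auto
  next
    case 5
    \<comment> \<open>To the right of \<open>1\<close> the value is \<open>y\<close>, so
      \<open>y - ev_fun h s y \<le> 1 - s\<close> is needed; it follows from
      \<open>ev_fun h s y \<ge> s * y\<close>.\<close>
    have "0 \<le> (1 - s) * (1 - y)" using 5 y by simp
    then have "y - s * y \<le> 1 - s" by (simp add: algebra_simps)
    moreover have "ev_fun h t y = y" using 5 y by (simp add: ev_fun_def)
    ultimately show ?thesis using 5 y ev_fun_le_right[of s y] ev_fun_ge_mult[of s y] by auto
  qed (use y assms in \<open>auto simp: ev_fun_def\<close>)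
  then show "0 \<le> ev_fun h t y - ev_fun h s y" "ev_fun h t y - ev_fun h s y \<le> t - s" by auto
qed

lemma ev_fun_lipschitz_left:
  assumes "y \<in> {0<..<1}" shows "\<bar>ev_fun h s y - ev_fun h t y\<bar> \<le> \<bar>s - t\<bar>"
  using ev_fun_left_bounds[OF assms, of s t] ev_fun_left_bounds[OF assms, of t s] by (cases "s \<le> t") auto

text \<open>As \<open>y\<close> grows to \<open>y'\<close>, the Lipschitz bound limits the growth of
  \<open>h\<close>, and the exponent gains at least \<open>(ln y' - ln y) * (h s - s)\<close>. The
  sign of \<open>h s - s\<close> thus gives monotonicity, or strict monotonicity, in
  \<open>y\<close>.\<close>

lemma ev_fun_diff_right:
  assumes "x \<in> {0<..<1}" "y \<in> {0<..<1}" "y' \<in> {0<..<1}" "y \<le> y'"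
  defines "s \<equiv> ln x / ln y"
  shows "ln y * h s + (ln y' - ln y) * (h s - s) \<le> ln y' * h (ln x / ln y')"
proof -
  have "s \<le> ln x / ln y'" unfolding s_def using ln_ratio_mono_right[of x y y'] assms by (cases "y = y'") auto
  then have "h (ln x / ln y') \<le> h s + (ln x / ln y' - s)"
    using lipschitz[of s "ln x / ln y'"] ln_ratio_pos[of x y] assms by auto
  then have "ln y' * (h s + (ln x / ln y' - s)) \<le> ln y' * h (ln x / ln y')"
    using assms by (intro mult_left_mono_neg) auto
  moreover have "ln y' * (h s + (ln x / ln y' - s)) = ln y' * h s + ln x - ln y' * s"
    using assms by (simp add: algebra_simps)
  moreover have "ln x = ln y * s" using assms by (simp add: s_def)
  ultimately show ?thesis by (simp add: algebra_simps)
qed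

lemma ev_fun_mono_right:
  assumes "x \<in> {0<..<1}" "y \<in> {0<..<1}" "y' \<in> {0<..<1}" "y \<le> y'"
  shows "ev_fun h x y \<le> ev_fun h x y'"
proof -
  have "0 \<le> (ln y' - ln y) * (h (ln x / ln y) - ln x / ln y)"
    using assms ge_id[OF ln_ratio_pos[of x y]] by (intro mult_nonneg_nonneg) auto
  then have "ln y * h (ln x / ln y) \<le> ln y' * h (ln x / ln y')"
    using ev_fun_diff_right[OF assms] by linarith
  then show ?thesis using assms by (simp add: ev_fun_def)
qed

lemma ev_fun_strict_mono_right:
  assumes "x \<in> {0<..<1}" "y \<in> {0<..<1}" "y' \<in> {0<..<1}" "y < y'"
    and "ln x / ln y < h (ln x / ln y)"
  shows "ev_fun h x y < ev_fun h x y'"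
proof -
  have "0 < (ln y' - ln y) * (h (ln x / ln y) - ln x / ln y)"
    using assms by (intro mult_pos_pos) auto
  then have "ln y * h (ln x / ln y) < ln y' * h (ln x / ln y')"
    using ev_fun_diff_right[OF assms(1-3) less_imp_le[OF assms(4)]] by linarith
  then show ?thesis using assms by (simp add: ev_fun_def)
qed

text \<open>\<open>cond_cdf\<close> is a product of two nonnegative factors that are nondecreasing
  in \<open>y\<close>; each bound keeps the increase of one factor only. The increase of
  \<open>rderiv h\<close> later yields mass on thin sets, the increase of \<open>ev_fun h\<close>
  full support.\<close>

lemma cond_cdf_diff:
  assumes x: "x \<in> {0<..<1}" and "y \<in> {0<..<1}" "y' \<in> {0<..<1}" "y \<le> y'"
  shows "ev_fun h x y / x * (rderiv h (ln x / ln y') - rderiv h (ln x / ln y)) \<le> cond_cdf h x y' - cond_cdf h x y"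
    and "(ev_fun h x y' - ev_fun h x y) / x * rderiv h (ln x / ln y) \<le> cond_cdf h x y' - cond_cdf h x y"
proof -
  let ?D = "rderiv h (ln x / ln y)" and ?D' = "rderiv h (ln x / ln y')"
  have C: "ev_fun h x y / x \<le> ev_fun h x y' / x"
    using ev_fun_mono_right[OF assms] x by (simp add: divide_right_mono)
  have D: "0 \<le> ?D" "?D \<le> ?D'"
    using rderiv_nonneg[OF ln_ratio_pos] rderiv_mono[OF ln_ratio_pos ln_ratio_mono_right'] assms by auto
  have eq: "cond_cdf h x y' - cond_cdf h x y = ev_fun h x y' / x * ?D' - ev_fun h x y / x * ?D"
    using assms by (simp add: cond_cdf_def)
  have "ev_fun h x y / x * ?D' \<le> ev_fun h x y' / x * ?D'"
    using C D by (intro mult_right_mono) auto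
  then show "ev_fun h x y / x * (?D' - ?D) \<le> cond_cdf h x y' - cond_cdf h x y"
    unfolding eq by (simp add: algebra_simps)
  have "ev_fun h x y' / x * ?D \<le> ev_fun h x y' / x * ?D'"
    using D ev_fun_pos[of x y'] assms by (intro mult_left_mono) auto
  then show "(ev_fun h x y' - ev_fun h x y) / x * ?D \<le> cond_cdf h x y' - cond_cdf h x y"
    unfolding eq by (simp add: algebra_simps diff_divide_distrib)
qed

lemma cond_cdf_bounds:
  assumes "x \<in> {0<..<1}"
  shows "0 \<le> cond_cdf h x y" "cond_cdf h x y \<le> 1" "0 < y \<Longrightarrow> y < 1 \<Longrightarrow> cond_cdf h x y \<le> ev_fun h x y / x"
proof -
  have "0 \<le> cond_cdf h x y \<and> cond_cdf h x y \<le> ev_fun h x y / x \<and> ev_fun h x y / x \<le> 1" if "y \<in> {0<..<1}"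
  proof -
    have D: "0 \<le> rderiv h (ln x / ln y)" "rderiv h (ln x / ln y) \<le> 1"
      using assms that by (auto intro!: rderiv_nonneg rderiv_le_one ln_ratio_pos)
    have C: "0 \<le> ev_fun h x y / x" "ev_fun h x y / x \<le> 1"
      using assms that ev_fun_pos[of x y] ev_fun_le_left[of x y] by auto
    have eq: "cond_cdf h x y = ev_fun h x y / x * rderiv h (ln x / ln y)"
      using that by (simp add: cond_cdf_def)
    show ?thesis unfolding eq using D C mult_nonneg_nonneg mult_left_le by blast
  qed
  then show "0 \<le> cond_cdf h x y" "cond_cdf h x y \<le> 1" "0 < y \<Longrightarrow> y < 1 \<Longrightarrow> cond_cdf h x y \<le> ev_fun h x y / x"
    by (cases "y \<in> {0<..<1}"; force simp: cond_cdf_def)+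
qed

lemma cond_cdf_mono:
  assumes "x \<in> {0<..<1}" "y \<le> y'" shows "cond_cdf h x y \<le> cond_cdf h x y'"
proof -
  consider "y \<le> 0" | "1 \<le> y'" | "y \<in> {0<..<1}" "y' \<in> {0<..<1}" using assms by fastforce
  then show ?thesis
  proof cases
    case 3
    then have "rderiv h (ln x / ln y) \<le> rderiv h (ln x / ln y')"
      using rderiv_mono[OF ln_ratio_pos ln_ratio_mono_right'] assms by auto
    then have "0 \<le> ev_fun h x y / x * (rderiv h (ln x / ln y') - rderiv h (ln x / ln y))"
      using assms 3 ev_fun_pos[of x y] by (intro mult_nonneg_nonneg) auto
    then show ?thesis using cond_cdf_diff(1)[OF assms(1) 3 assms(2)] by linarith
  qed (use assms cond_cdf_bounds[of x] in \<open>auto simp: cond_cdf_def\<close>)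
qed

lemma continuous_ev_fun_right:
  assumes "x \<in> {0<..<1}" "y \<in> {0<..<1}" shows "(ev_fun h x \<longlongrightarrow> ev_fun h x y) (at y)"
proof -
  have "((\<lambda>y. exp (ln y * h (ln x / ln y))) \<longlongrightarrow> exp (ln y * h (ln x / ln y))) (at y)"
    using assms by (intro tendsto_intros tendsto_compose ln_ratio_pos) auto
  moreover have "\<forall>\<^sub>F y in at y. exp (ln y * h (ln x / ln y)) = ev_fun h x y"
    using assms eventually_at_in_open'[of "{0<..<1}" y] by (auto simp: ev_fun_def elim: eventually_mono)
  ultimately have "(ev_fun h x \<longlongrightarrow> exp (ln y * h (ln x / ln y))) (at y)"
    by (rule Lim_transform_eventually)
  then show ?thesis using assms by (simp add: ev_fun_def[of h x y])
qed

lemma filterlim_ln_ratio_at_right: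
  fixes x y :: real
  assumes "x \<in> {0<..<1}" "y \<in> {0<..<1}"
  shows "filterlim (\<lambda>y. ln x / ln y) (at_right (ln x / ln y)) (at_right y)"
  unfolding filterlim_at
proof
  have "\<forall>\<^sub>F t in at_right y. t \<in> {y<..<1}"
    using eventually_at_right_real[of y 1] assms by simp
  then show "\<forall>\<^sub>F t in at_right y. ln x / ln t \<in> {ln x / ln y<..} \<and> ln x / ln t \<noteq> ln x / ln y"
    by eventually_elim (use ln_ratio_mono_right[of x y] assms in force)
  show "((\<lambda>y. ln x / ln y) \<longlongrightarrow> ln x / ln y) (at_right y)"
    using assms by (intro tendsto_intros) auto
qed

lemma cond_cdf_right_continuous:
  assumes x: "x \<in> {0<..<1}" shows "continuous (at_right y) (cond_cdf h x)"
proof -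
  consider "y < 0" | "y = 0" | "y \<in> {0<..<1}" | "1 \<le> y" by fastforce
  then have "(cond_cdf h x \<longlongrightarrow> cond_cdf h x y) (at_right y)"
  proof cases
    case 1
    have "\<forall>\<^sub>F t in at_right y. cond_cdf h x t = 0"
      using eventually_at_right_real[OF 1] by eventually_elim (auto simp: cond_cdf_def)
    moreover have "cond_cdf h x y = 0" using 1 by (simp add: cond_cdf_def)
    ultimately show ?thesis by (simp add: tendsto_eventually)
  next
    case 2
    have ev: "\<forall>\<^sub>F t in at_right y. t \<in> {0<..<1}" unfolding 2 by (intro eventually_at_right_real) auto
    have "(cond_cdf h x \<longlongrightarrow> 0) (at_right y)"
    proof (rule tendsto_sandwich)
      show "\<forall>\<^sub>F t in at_right y. 0 \<le> cond_cdf h x t" using cond_cdf_bounds[OF x] by simp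
      show "\<forall>\<^sub>F t in at_right y. cond_cdf h x t \<le> t / x"
        using ev
      proof eventually_elim
        case (elim t)
        then have "cond_cdf h x t \<le> ev_fun h x t / x" using cond_cdf_bounds[OF x] by simp
        also have "\<dots> \<le> t / x" using elim x ev_fun_le_right[of x t] by (simp add: divide_right_mono)
        finally show ?case .
      qed
      show "((\<lambda>t. t / x) \<longlongrightarrow> 0) (at_right y)" unfolding 2 using x by (auto intro!: tendsto_eq_intros)
    qed simp
    then show ?thesis by (simp add: 2 cond_cdf_def)
  next
    case 3
    have "((\<lambda>t. ev_fun h x t / x * rderiv h (ln x / ln t)) \<longlongrightarrow> ev_fun h x y / x * rderiv h (ln x / ln y)) (at_right y)"
      using x 3 tendsto_within_subset[OF continuous_ev_fun_right[OF x 3], of "{y<..}"]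
      by (intro tendsto_intros filterlim_compose[OF rderiv_right_continuous filterlim_ln_ratio_at_right] ln_ratio_pos) auto
    moreover have "\<forall>\<^sub>F t in at_right y. ev_fun h x t / x * rderiv h (ln x / ln t) = cond_cdf h x t"
      using eventually_at_right_real[of y 1] 3 by (auto simp: cond_cdf_def elim: eventually_mono)
    ultimately have "(cond_cdf h x \<longlongrightarrow> ev_fun h x y / x * rderiv h (ln x / ln y)) (at_right y)"
      by (rule Lim_transform_eventually)
    moreover have "cond_cdf h x y = ev_fun h x y / x * rderiv h (ln x / ln y)"
      using 3 by (simp add: cond_cdf_def)
    ultimately show ?thesis by simp
  next
    case 4
    have "\<forall>\<^sub>F t in at_right y. cond_cdf h x t = 1"
      using eventually_at_right_less[of y] by eventually_elim (use 4 in \<open>auto simp: cond_cdf_def\<close>)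
    moreover have "cond_cdf h x y = 1" using 4 by (simp add: cond_cdf_def)
    ultimately show ?thesis by (simp add: tendsto_eventually)
  qed
  then show ?thesis by (simp add: continuous_within)
qed

text \<open>When \<open>x\<close> is approached from the left, \<open>ln x / ln y\<close> is
  approached from the right, where the one-sided derivative of \<open>h\<close> always exists. So
  the chain rule works at every \<open>x\<close>.\<close>

lemma has_left_derivative_ev_fun:
  assumes x: "x \<in> {0<..<1}" and y: "y \<in> {0<..<1}"
  shows "((\<lambda>t. ev_fun h t y) has_real_derivative cond_cdf h x y) (at x within {..x})"
proof -
  let ?r = "\<lambda>t. ln t / ln y"
  have "(h has_real_derivative rderiv h (?r x)) (at (?r x) within {?r x..})"
    using tendsto_rderiv[OF ln_ratio_pos[OF x y]] unfolding has_field_derivative_iff at_within_Ici_at_right .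
  then have "(h has_real_derivative rderiv h (?r x)) (at (?r x) within ?r ` {0<..x})"
    by (rule has_field_derivative_subset) (use x y in \<open>auto intro!: ln_ratio_mono_left\<close>)
  then have "((h \<circ> ?r) has_real_derivative rderiv h (?r x) * (1 / (x * ln y))) (at x within {0<..x})"
    using x y by (intro DERIV_image_chain) (auto intro!: derivative_eq_intros simp: field_simps)
  then have "((\<lambda>t. exp (ln y * h (?r t))) has_real_derivative
      exp (ln y * h (?r x)) * (ln y * (rderiv h (?r x) * (1 / (x * ln y))))) (at x within {0<..x})"
    by (auto simp: o_def intro!: derivative_eq_intros)
  also have "exp (ln y * h (?r x)) * (ln y * (rderiv h (?r x) * (1 / (x * ln y)))) = cond_cdf h x y"
    using x y by (simp add: cond_cdf_def ev_fun_def)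
  finally have "((\<lambda>t. ev_fun h t y) has_real_derivative cond_cdf h x y) (at x within {0<..x})"
    by (rule has_field_derivative_transform_within[where d=1]) (use x y in \<open>auto simp: ev_fun_def\<close>)
  moreover have "at x within {0<..x} = at x within {..x}"
    using x by (intro at_within_nhd[of _ "{0<..}"]) auto
  ultimately show ?thesis by simp
qed

lemma differentiable_ev_fun:
  assumes x: "x \<in> {0<..<1}" and y: "y \<in> {0<..<1}"
    and h: "(h has_real_derivative d) (at (ln x / ln y))"
  shows "(\<lambda>t. ev_fun h t y) differentiable (at x)"
proof -
  have "((\<lambda>t. exp (ln y * h (ln t / ln y))) has_real_derivative
      exp (ln y * h (ln x / ln y)) * (ln y * (d * (1 / (x * ln y))))) (at x)"
    using x y by (auto intro!: derivative_eq_intros DERIV_chain2[where f=h and g="\<lambda>t. ln t / ln y", OF h])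
  then have "((\<lambda>t. ev_fun h t y) has_real_derivative
      exp (ln y * h (ln x / ln y)) * (ln y * (d * (1 / (x * ln y))))) (at x)"
    by (rule has_field_derivative_transform_within_open[of _ _ _ "{0<..<1}"]) (use x y in \<open>auto simp: ev_fun_def\<close>)
  then show ?thesis using real_differentiable_def by blast
qed

section \<open>Measurability and integration of the conditional distributions\<close>

lemma rderiv_measurable: "(\<lambda>s. if 0 < s then rderiv h s else 0) \<in> borel_measurable borel"
  by (rule borel_measurable_mono) (auto simp: mono_def rderiv_nonneg rderiv_mono)

lemma continuous_on_ev_fun_left: "y \<in> {0<..<1} \<Longrightarrow> continuous_on UNIV (\<lambda>x. ev_fun h x y)"
  unfolding continuous_on_iff dist_real_def using ev_fun_lipschitz_left by (meson le_less_trans)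

lemma cond_cdf_measurable:
  "(\<lambda>x. if x \<in> {0<..<1} then cond_cdf h x y else 0) \<in> borel_measurable borel"
proof (cases "y \<in> {0<..<1}")
  case True
  have [measurable]: "(\<lambda>x. ev_fun h x y) \<in> borel_measurable borel"
    using continuous_on_ev_fun_left[OF True] by (rule borel_measurable_continuous_onI)
  note rderiv_measurable[measurable]
  have "(\<lambda>x. if x \<in> {0<..<1} then ev_fun h x y / x * (if 0 < ln x / ln y then rderiv h (ln x / ln y) else 0) else 0)
      \<in> borel_measurable borel"
    by (measurable; (rule measurable_compose[OF _ rderiv_measurable])?) measurable
  also have "?this \<longleftrightarrow> ?thesis"
    using True ln_ratio_pos[of _ y] by (intro measurable_cong) (auto simp: cond_cdf_def)
  finally show ?thesis .
next
  case False
  then have "(\<lambda>x. if x \<in> {0<..<1} then cond_cdf h x y else 0) = (\<lambda>x. if y \<le> 0 then 0 else indicator {0<..<1} x)"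
    by (auto simp: cond_cdf_def indicator_def)
  then show ?thesis by simp
qed

lemma nn_integral_cond_cdf:
  assumes a: "0 \<le> a" "a \<le> 1" and y: "0 \<le> y" "y \<le> 1"
  shows "(\<integral>\<^sup>+x\<in>{0<..<a}. ennreal (cond_cdf h x y) \<partial>lborel) = ennreal (ev_fun h a y)"
proof -
  consider "y \<in> {0<..<1}" | "y = 0" | "y = 1" using y by fastforce
  then show ?thesis
  proof cases
    case 1
    have "((\<lambda>x. cond_cdf h x y) has_integral (ev_fun h a y - ev_fun h 0 y)) {0<..<a}"
      using a by (intro has_integral_left_derivative[where g="\<lambda>x. ev_fun h x y"] ev_fun_lipschitz_left has_left_derivative_ev_fun 1) auto
    moreover have "ev_fun h 0 y = 0" using 1 by (simp add: ev_fun_def)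
    ultimately have "((\<lambda>x. if x \<in> {0<..<a} then cond_cdf h x y else 0) has_integral ev_fun h a y) UNIV"
      by (subst has_integral_restrict_UNIV) simp
    moreover have "(\<lambda>x. if x \<in> {0<..<a} then cond_cdf h x y else 0) = (\<lambda>x. indicator {0<..<a} x * cond_cdf h x y)"
      by (auto simp: indicator_def)
    ultimately have "((\<lambda>x. indicator {0<..<a} x * cond_cdf h x y) has_integral ev_fun h a y) UNIV"
      by simp
    moreover have "(\<lambda>x. indicator {0<..<a} x * cond_cdf h x y) \<in> borel_measurable borel"
    proof -
      have "(\<lambda>x. indicator {0<..<a} x * (if x \<in> {0<..<1} then cond_cdf h x y else 0)) \<in> borel_measurable borel"
        using cond_cdf_measurable by measurable
      also have "?this \<longleftrightarrow> ?thesis"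
        using a by (intro measurable_cong) (auto simp: indicator_def)
      finally show ?thesis .
    qed
    ultimately have "integral\<^sup>N lborel (\<lambda>x. ennreal (indicator {0<..<a} x * cond_cdf h x y)) = ev_fun h a y"
      using a cond_cdf_bounds by (intro nn_integral_has_integral_lborel) (auto simp: indicator_def)
    moreover have "(\<integral>\<^sup>+x\<in>{0<..<a}. ennreal (cond_cdf h x y) \<partial>lborel) = integral\<^sup>N lborel (\<lambda>x. ennreal (indicator {0<..<a} x * cond_cdf h x y))"
      by (rule nn_integral_cong) (auto simp: indicator_def)
    ultimately show ?thesis by simp
  next
    case 2 then show ?thesis using a by (simp add: cond_cdf_def ev_fun_def)
  next
    case 3
    have "(\<integral>\<^sup>+x\<in>{0<..<a}. ennreal (cond_cdf h x y) \<partial>lborel) = (\<integral>\<^sup>+x. indicator {0<..<a} x \<partial>lborel)"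
      by (rule nn_integral_cong) (use 3 in \<open>auto simp: cond_cdf_def indicator_def\<close>)
    then show ?thesis using a 3 by (simp add: ev_fun_def)
  qed
qed

end

section \<open>The copula of a profile\<close>

abbreviation unit_lebesgue2 :: "(real \<times> real) measure" where
  "unit_lebesgue2 \<equiv> unit_lebesgue \<Otimes>\<^sub>M unit_lebesgue"

lemma prob_space_unit_lebesgue: "prob_space unit_lebesgue"
  by (rule prob_spaceI) (simp add: emeasure_restrict_space space_restrict_space)

lemma space_unit_lebesgue [simp]: "space unit_lebesgue = unit_interval"
  by (simp add: space_restrict_space)

lemma sets_unit_lebesgue_iff: "A \<in> sets unit_lebesgue \<longleftrightarrow> A \<in> sets borel \<and> A \<subseteq> unit_interval"
  by (auto simp: sets_restrict_space_iff)

lemma unit_lebesgue_to_borel [measurable]: "(\<lambda>x. x) \<in> unit_lebesgue \<rightarrow>\<^sub>M borel"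
  by (rule measurable_restrict_space1) simp

lemma emeasure_distr_unit_to_borel:
  assumes "sets M = sets unit_lebesgue" "A \<in> sets borel"
  shows "emeasure (distr M borel (\<lambda>x. x)) A = emeasure M (A \<inter> unit_interval)"
proof -
  have "(\<lambda>x. x) \<in> M \<rightarrow>\<^sub>M borel"
    using unit_lebesgue_to_borel measurable_cong_sets[OF assms(1) refl] by blast
  moreover have "space M = unit_interval" using sets_eq_imp_space_eq[OF assms(1)] by simp
  ultimately show ?thesis using assms(2) by (simp add: emeasure_distr vimage_def Int_def)
qed

text \<open>Right-continuity of distribution functions reduces the test to rational
  \<open>q\<close>. A countable test set is what lets equalities holding for almost every
  \<open>x\<close> be combined when kernels are compared.\<close>

lemma unit_measure_eqI:
  assumes fin: "finite_measure M" "finite_measure N"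
    and sets: "sets M = sets unit_lebesgue" "sets N = sets unit_lebesgue"
    and eq: "\<And>q. q \<in> \<rat> \<Longrightarrow> 0 \<le> q \<Longrightarrow> q \<le> 1 \<Longrightarrow> emeasure M {0..q} = emeasure N {0..q}"
  shows "M = N"
proof -
  let ?b = "\<lambda>M. distr M borel (\<lambda>x::real. x)"
  have fbm: "finite_borel_measure (?b M)" if "finite_measure M" "sets M = sets unit_lebesgue" for M
  proof -
    have "(\<lambda>x. x) \<in> M \<rightarrow>\<^sub>M borel"
      using unit_lebesgue_to_borel measurable_cong_sets[OF that(2) refl] by blast
    then interpret finite_measure "?b M"
      using that by (intro finite_measure.finite_measure_distr)
    show ?thesis by unfold_locales simp
  qed
  interpret bM: finite_borel_measure "?b M" by (rule fbm) (use fin sets in auto)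
  interpret bN: finite_borel_measure "?b N" by (rule fbm) (use fin sets in auto)
  have ratq: "cdf (?b M) q = cdf (?b N) q" if "q \<in> \<rat>" for q
  proof -
    consider "q < 0" | "q \<in> {0..1}" | "1 < q" by fastforce
    then have "emeasure M ({..q} \<inter> unit_interval) = emeasure N ({..q} \<inter> unit_interval)"
    proof cases
      case 1 then have "{..q} \<inter> unit_interval = {}" by auto
      then show ?thesis by simp
    next
      case 2 then have "{..q} \<inter> unit_interval = {0..q}" by auto
      then show ?thesis using eq[OF that] 2 by simp
    next
      case 3 then have "{..q} \<inter> unit_interval = {0..1}" by auto
      then show ?thesis using eq[of 1] by simp
    qed
    then show ?thesis
      unfolding cdf_def measure_def by (simp add: emeasure_distr_unit_to_borel sets)
  qed
  have le: "cdf A y \<le> cdf B y"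
    if A: "finite_borel_measure A" and B: "finite_borel_measure B"
      and rat: "\<And>q. q \<in> \<rat> \<Longrightarrow> cdf A q = cdf B q" for A B y
  proof (rule field_le_epsilon)
    fix e :: real assume "0 < e"
    have "(cdf B \<longlongrightarrow> cdf B y) (at_right y)"
      using finite_borel_measure.cdf_is_right_cont[OF B, of y] by (simp add: continuous_within)
    then have "\<forall>\<^sub>F z in at_right y. cdf B z < cdf B y + e"
      by (rule order_tendstoD) (use \<open>0 < e\<close> in simp)
    then obtain b where b: "y < b" "\<And>z. y < z \<Longrightarrow> z < b \<Longrightarrow> cdf B z < cdf B y + e"
      unfolding eventually_at_right_field by blast
    obtain q where q: "q \<in> \<rat>" "y < q" "q < b" using Rats_dense_in_real[OF b(1)] by blast
    have "cdf A y \<le> cdf A q" using finite_borel_measure.cdf_nondecreasing[OF A] q by simp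
    also have "\<dots> \<le> cdf B y + e" using rat b q by (simp add: less_imp_le)
    finally show "cdf A y \<le> cdf B y + e" .
  qed
  have "?b M = ?b N"
    using le[OF bM.finite_borel_measure_axioms bN.finite_borel_measure_axioms ratq]
      le[OF bN.finite_borel_measure_axioms bM.finite_borel_measure_axioms ratq[symmetric]]
    by (intro cdf_unique' bM.finite_borel_measure_axioms bN.finite_borel_measure_axioms) (auto simp: fun_eq_iff intro: antisym)
  show ?thesis
  proof (rule measure_eqI)
    fix A assume "A \<in> sets M"
    then have A: "A \<in> sets borel" "A \<inter> unit_interval = A" using sets sets_unit_lebesgue_iff by auto
    show "emeasure M A = emeasure N A"
      using emeasure_distr_unit_to_borel[OF sets(1) A(1)] emeasure_distr_unit_to_borel[OF sets(2) A(1)]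
        \<open>?b M = ?b N\<close> A(2) by simp
  qed (use sets in simp)
qed

section \<open>The Markov kernel of a profile\<close>

lemma Icc_in_sets_unit: "0 \<le> x \<Longrightarrow> y \<le> 1 \<Longrightarrow> {x..y} \<in> sets unit_lebesgue"
  by (auto simp: sets_unit_lebesgue_iff)

text \<open>\<open>interval_measure\<close> yields a measure on the whole line; clipping moves it to
  the unit interval without changing the values on \<open>{0..y}\<close>. At the two end points
  Lebesgue measure is the default; it has no atoms, so atomlessness can later be stated for every
  \<open>x\<close>.\<close>

definition cond_kernel :: "(real \<Rightarrow> real) \<Rightarrow> real \<Rightarrow> real measure" where
  "cond_kernel h x = (if x \<in> {0<..<1}
     then distr (interval_measure (cond_cdf h x)) unit_lebesgue (\<lambda>y. max 0 (min 1 y))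
     else unit_lebesgue)"

lemma clip_measurable:
  assumes "sets M = sets borel" shows "(\<lambda>y::real. max 0 (min 1 y)) \<in> M \<rightarrow>\<^sub>M unit_lebesgue"
  unfolding measurable_cong_sets[OF assms refl] by (intro measurable_restrict_space2) auto

context profile
begin

lemma real_distribution_cond_cdf:
  assumes x: "x \<in> {0<..<1}" shows "real_distribution (interval_measure (cond_cdf h x))"
proof (rule real_distribution_interval_measure)
  have "\<forall>\<^sub>F y in at_bot. cond_cdf h x y = 0"
    using eventually_le_at_bot[of 0] by eventually_elim (simp add: cond_cdf_def)
  then show "(cond_cdf h x \<longlongrightarrow> 0) at_bot" by (rule tendsto_eventually)
  have "\<forall>\<^sub>F y in at_top. cond_cdf h x y = 1"
    using eventually_ge_at_top[of 1] by eventually_elim (simp add: cond_cdf_def)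
  then show "(cond_cdf h x \<longlongrightarrow> 1) at_top" by (rule tendsto_eventually)
qed (use x cond_cdf_mono cond_cdf_right_continuous in auto)

lemma emeasure_interval_cond_cdf:
  assumes x: "x \<in> {0<..<1}" shows "emeasure (interval_measure (cond_cdf h x)) {..y} = ennreal (cond_cdf h x y)"
proof (rule emeasure_interval_measure_Iic)
  have "\<forall>\<^sub>F y in at_bot. cond_cdf h x y = 0"
    using eventually_le_at_bot[of 0] by eventually_elim (simp add: cond_cdf_def)
  then show "(cond_cdf h x \<longlongrightarrow> 0) at_bot" by (rule tendsto_eventually)
qed (use x cond_cdf_mono cond_cdf_right_continuous in auto)

lemma emeasure_cond_kernel:
  assumes x: "x \<in> {0<..<1}" and A: "A \<in> sets unit_lebesgue"
  shows "emeasure (cond_kernel h x) A = emeasure (interval_measure (cond_cdf h x)) ((\<lambda>y. max 0 (min 1 y)) -` A)"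
  using x A by (simp add: cond_kernel_def emeasure_distr clip_measurable)

lemma emeasure_cond_kernel_Icc:
  assumes x: "x \<in> {0<..<1}" and y: "0 \<le> y" "y \<le> 1"
  shows "emeasure (cond_kernel h x) {0..y} = ennreal (cond_cdf h x y)"
proof (cases "y = 1")
  case True
  interpret real_distribution "interval_measure (cond_cdf h x)" by (rule real_distribution_cond_cdf[OF x])
  have "(\<lambda>y::real. max 0 (min 1 y)) -` {0..y} = UNIV" using True by auto
  then show ?thesis
    using emeasure_cond_kernel[OF x Icc_in_sets_unit] emeasure_space_1 True by (simp add: cond_cdf_def)
next
  case False
  then have "(\<lambda>y::real. max 0 (min 1 y)) -` {0..y} = {..y}" using y by auto
  then show ?thesis
    using emeasure_cond_kernel[OF x Icc_in_sets_unit] emeasure_interval_cond_cdf[OF x] y by simp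
qed

lemma cond_kernel_measurable: "cond_kernel h \<in> unit_lebesgue \<rightarrow>\<^sub>M prob_algebra unit_lebesgue"
proof -
  \<comment> \<open>A version on the whole line, with a point mass as default outside the open
    interval: its measurability in \<open>x\<close> can be tested on the half-lines that generate
    the Borel sets.\<close>
  define K where "K x = (if x \<in> {0<..<1} then interval_measure (cond_cdf h x) else return borel 0)" for x
  have "K \<in> unit_lebesgue \<rightarrow>\<^sub>M prob_algebra borel"
  proof (rule measurable_prob_algebra_generated[where G="range (\<lambda>y. {..y})" and \<Omega>=UNIV])
    show "sets (borel :: real measure) = sigma_sets UNIV (range (\<lambda>y. {..y}))"
      by (simp add: borel_eq_atMost)
    show "Int_stable (range (\<lambda>y::real. {..y}))" by (auto simp: Int_stable_def)
    show "prob_space (K a)" for a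
      using real_distribution_cond_cdf[of a] prob_space_return[of "0::real" borel]
      by (auto simp: K_def real_distribution_def)
    fix A assume "A \<in> range (\<lambda>y::real. {..y})"
    then obtain y where A: "A = {..y}" by auto
    define f where "f x = (if x \<in> {0<..<1} then cond_cdf h x y else 0)" for x
    define g :: "real \<Rightarrow> real" where "g x = (if x \<in> {0<..<1} then 0 else indicator {..y} 0)" for x
    have [measurable]: "f \<in> borel_measurable borel" "g \<in> borel_measurable borel"
      unfolding f_def g_def by (rule cond_cdf_measurable, measurable)
    have "(\<lambda>x. ennreal (f x + g x)) \<in> borel_measurable borel" by measurable
    then have "(\<lambda>x. ennreal (f x + g x)) \<in> borel_measurable unit_lebesgue"
      by (intro measurable_restrict_space1) simp
    then show "(\<lambda>x. emeasure (K x) A) \<in> borel_measurable unit_lebesgue"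
      by (rule measurable_cong[THEN iffD1, rotated])
        (auto simp: K_def f_def g_def A emeasure_interval_cond_cdf indicator_def)
  qed (auto simp: K_def)
  then have 1: "(\<lambda>x. distr (K x) unit_lebesgue (\<lambda>y. max 0 (min 1 y))) \<in> unit_lebesgue \<rightarrow>\<^sub>M prob_algebra unit_lebesgue"
    by (rule measurable_compose[OF _ measurable_distr_prob_space[OF clip_measurable[OF refl]]])
  have "unit_lebesgue \<in> space (prob_algebra unit_lebesgue)"
    using prob_space_unit_lebesgue by (simp add: space_prob_algebra)
  then have 2: "(\<lambda>_. unit_lebesgue) \<in> unit_lebesgue \<rightarrow>\<^sub>M prob_algebra unit_lebesgue"
    by (rule measurable_const)
  have eq: "{x \<in> space unit_lebesgue. x \<in> {0<..<1}} = {0<..<1}" by auto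
  have "{0<..<1::real} \<subseteq> unit_interval" by auto
  then have 3: "{x \<in> space unit_lebesgue. x \<in> {0<..<1}} \<in> sets unit_lebesgue"
    unfolding eq sets_unit_lebesgue_iff by simp
  have "(\<lambda>x. if x \<in> {0<..<1} then distr (K x) unit_lebesgue (\<lambda>y. max 0 (min 1 y)) else unit_lebesgue)
      \<in> unit_lebesgue \<rightarrow>\<^sub>M prob_algebra unit_lebesgue"
    by (rule measurable_If[OF 1 2 3])
  then show ?thesis
    by (rule measurable_cong[THEN iffD1, rotated]) (auto simp: K_def cond_kernel_def)
qed

lemma cond_kernel_measurable_subprob: "cond_kernel h \<in> unit_lebesgue \<rightarrow>\<^sub>M subprob_algebra unit_lebesgue"
  using cond_kernel_measurable by (rule measurable_prob_algebraD)

lemma sets_cond_kernel: "sets (cond_kernel h x) = sets unit_lebesgue"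
  by (simp add: cond_kernel_def)

lemma prob_space_cond_kernel: "prob_space (cond_kernel h x)"
proof (cases "x \<in> {0<..<1}")
  case True
  then interpret real_distribution "interval_measure (cond_cdf h x)" by (rule real_distribution_cond_cdf)
  show ?thesis using True by (simp add: cond_kernel_def prob_space_distr clip_measurable)
qed (use prob_space_unit_lebesgue in \<open>auto simp: cond_kernel_def\<close>)

lemma emeasure_cond_kernel_space: "emeasure (cond_kernel h x) unit_interval = 1"
  using prob_space.emeasure_space_1[OF prob_space_cond_kernel[of x]] sets_eq_imp_space_eq[OF sets_cond_kernel[of x]] by simp

abbreviation "ev_measure \<equiv> kernel_measure (cond_kernel h)"

lemma emeasure_ev_measure:
  assumes "E \<in> sets unit_lebesgue" "F \<in> sets unit_lebesgue"
  shows "emeasure ev_measure (E \<times> F) = (\<integral>\<^sup>+x\<in>E. emeasure (cond_kernel h x) F \<partial>unit_lebesgue)"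
  by (rule emeasure_kernel_measure[OF cond_kernel_measurable_subprob assms])

lemma emeasure_ev_measure_Icc:
  assumes a: "0 \<le> a" "a \<le> 1" and y: "0 \<le> y" "y \<le> 1"
  shows "emeasure ev_measure ({0..a} \<times> {0..y}) = ennreal (ev_fun h a y)"
proof -
  have "emeasure ev_measure ({0..a} \<times> {0..y})
      = (\<integral>\<^sup>+x. emeasure (cond_kernel h x) {0..y} * indicator {0..a} x * indicator unit_interval x \<partial>lborel)"
    using a y emeasure_ev_measure[of "{0..a}" "{0..y}"] Icc_in_sets_unit by (simp add: nn_integral_restrict_space)
  also have "\<dots> = (\<integral>\<^sup>+x\<in>{0<..<a}. ennreal (cond_cdf h x y) \<partial>lborel)"
  proof (rule nn_integral_cong_AE)
    show "AE x in lborel. emeasure (cond_kernel h x) {0..y} * indicator {0..a} x * indicator unit_interval x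
        = ennreal (cond_cdf h x y) * indicator {0<..<a} x"
      using AE_lborel_singleton[of 0] AE_lborel_singleton[of a]
      by eventually_elim (use a y in \<open>auto simp: indicator_def emeasure_cond_kernel_Icc\<close>)
  qed
  finally show ?thesis using nn_integral_cond_cdf[OF assms] by simp
qed

end

section \<open>Doubly stochastic measures and copulas\<close>

lemma sets_kernel_measure:
  assumes "K \<in> unit_lebesgue \<rightarrow>\<^sub>M subprob_algebra unit_lebesgue"
  shows "sets (kernel_measure K) = sets unit_lebesgue2"
  unfolding kernel_measure_def
  by (rule sets_bind[where N="unit_lebesgue2"]) auto

lemma emeasure_fst_marginal:
  assumes "sets M = sets unit_lebesgue2" "A \<in> sets unit_lebesgue"
  shows "emeasure (distr M unit_lebesgue fst) A = emeasure M (A \<times> unit_interval)"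
proof -
  have f: "fst \<in> M \<rightarrow>\<^sub>M unit_lebesgue" using measurable_cong_sets[OF assms(1) refl] measurable_fst by blast
  have "fst -` A \<inter> space M = A \<times> unit_interval"
    using sets_eq_imp_space_eq[OF assms(1)] sets.sets_into_space[OF assms(2)] by (auto simp: space_pair_measure)
  then show ?thesis using f assms(2) by (simp add: emeasure_distr)
qed

lemma emeasure_snd_marginal:
  assumes "sets M = sets unit_lebesgue2" "A \<in> sets unit_lebesgue"
  shows "emeasure (distr M unit_lebesgue snd) A = emeasure M (unit_interval \<times> A)"
proof -
  have f: "snd \<in> M \<rightarrow>\<^sub>M unit_lebesgue" using measurable_cong_sets[OF assms(1) refl] measurable_snd by blast
  have "snd -` A \<inter> space M = unit_interval \<times> A"
    using sets_eq_imp_space_eq[OF assms(1)] sets.sets_into_space[OF assms(2)] by (auto simp: space_pair_measure)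
  then show ?thesis using f assms(2) by (simp add: emeasure_distr)
qed

lemma doubly_stochastic_finite:
  assumes "doubly_stochastic M" shows "finite_measure M"
proof (rule finite_measureI)
  have s: "sets M = sets unit_lebesgue2" "distr M unit_lebesgue fst = unit_lebesgue"
    using assms by (auto simp: doubly_stochastic_def)
  have "emeasure M (unit_interval \<times> unit_interval) = emeasure unit_lebesgue unit_interval"
    using emeasure_fst_marginal[OF s(1), of unit_interval] s(2) Icc_in_sets_unit by simp
  moreover have "space M = unit_interval \<times> unit_interval"
    using sets_eq_imp_space_eq[OF s(1)] by (simp add: space_pair_measure)
  ultimately show "emeasure M (space M) \<noteq> \<infinity>"
    using prob_space.emeasure_space_1[OF prob_space_unit_lebesgue] by simp
qed

text \<open>Anchored rectangles are generalised one side at a time. For fixed \<open>y\<close>,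
  \<open>E \<mapsto> M (E \<times> {0..y})\<close> is a finite measure determined by its values on
  intervals \<open>{0..q}\<close>; then the same is done in the second factor for fixed
  \<open>E\<close>, and rectangles generate the product \<open>\<sigma>\<close>-algebra.\<close>

lemma doubly_stochastic_eqI:
  assumes M: "doubly_stochastic M" and N: "doubly_stochastic N"
    and eq: "\<And>x y. x \<in> unit_interval \<Longrightarrow> y \<in> unit_interval \<Longrightarrow>
      measure M ({0..x} \<times> {0..y}) = measure N ({0..x} \<times> {0..y})"
  shows "M = N"
proof -
  interpret M: finite_measure M by (rule doubly_stochastic_finite[OF M])
  interpret N: finite_measure N by (rule doubly_stochastic_finite[OF N])
  have s: "sets M = sets unit_lebesgue2" "sets N = sets unit_lebesgue2"
    using M N by (auto simp: doubly_stochastic_def)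
  have eq': "emeasure M ({0..x} \<times> {0..y}) = emeasure N ({0..x} \<times> {0..y})" if "x \<in> {0..1}" "y \<in> {0..1}" for x y
    using eq[OF that] by (simp add: M.emeasure_eq_measure N.emeasure_eq_measure)
  let ?fst = "\<lambda>M F. distr (restrict_space M (unit_interval \<times> F)) unit_lebesgue fst"
  let ?snd = "\<lambda>M E. distr (restrict_space M (E \<times> unit_interval)) unit_lebesgue snd"
  have fst: "emeasure (?fst P F) E = emeasure P (E \<times> F)" "finite_measure (?fst P F)"
    if P: "finite_measure P" "sets P = sets unit_lebesgue2" and EF: "E \<in> sets unit_lebesgue" "F \<in> sets unit_lebesgue" for P E F
  proof -
    interpret finite_measure P by fact
    have rect: "unit_interval \<times> F \<in> sets P" using P EF Icc_in_sets_unit by auto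
    have meas: "fst \<in> restrict_space P (unit_interval \<times> F) \<rightarrow>\<^sub>M unit_lebesgue"
      using measurable_cong_sets[OF P(2) refl] measurable_fst by (intro measurable_restrict_space1) blast
    have sub: "E \<subseteq> unit_interval" "F \<subseteq> unit_interval" using EF sets_unit_lebesgue_iff by auto
    have "fst -` E \<inter> space (restrict_space P (unit_interval \<times> F)) = E \<times> F"
      using sets_eq_imp_space_eq[OF P(2)] sub by (auto simp: space_restrict_space space_pair_measure)
    then show "emeasure (?fst P F) E = emeasure P (E \<times> F)"
      using meas EF rect sub by (simp add: emeasure_distr emeasure_restrict_space Sigma_mono)
    have "finite_measure (restrict_space P (unit_interval \<times> F))"
      using rect by (intro finite_measure_restrict_space finite_measure_axioms) auto
    then show "finite_measure (?fst P F)" using meas by (intro finite_measure.finite_measure_distr)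
  qed
  have snd: "emeasure (?snd P E) F = emeasure P (E \<times> F)" "finite_measure (?snd P E)"
    if P: "finite_measure P" "sets P = sets unit_lebesgue2" and EF: "E \<in> sets unit_lebesgue" "F \<in> sets unit_lebesgue" for P E F
  proof -
    interpret finite_measure P by fact
    have rect: "E \<times> unit_interval \<in> sets P" using P EF Icc_in_sets_unit by auto
    have meas: "snd \<in> restrict_space P (E \<times> unit_interval) \<rightarrow>\<^sub>M unit_lebesgue"
      using measurable_cong_sets[OF P(2) refl] measurable_snd by (intro measurable_restrict_space1) blast
    have sub: "E \<subseteq> unit_interval" "F \<subseteq> unit_interval" using EF sets_unit_lebesgue_iff by auto
    have "snd -` F \<inter> space (restrict_space P (E \<times> unit_interval)) = E \<times> F"
      using sets_eq_imp_space_eq[OF P(2)] sub by (auto simp: space_restrict_space space_pair_measure)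
    then show "emeasure (?snd P E) F = emeasure P (E \<times> F)"
      using meas EF rect sub by (simp add: emeasure_distr emeasure_restrict_space Sigma_mono)
    have "finite_measure (restrict_space P (E \<times> unit_interval))"
      using rect by (intro finite_measure_restrict_space finite_measure_axioms) auto
    then show "finite_measure (?snd P E)" using meas by (intro finite_measure.finite_measure_distr)
  qed
  have 1: "emeasure M (E \<times> {0..y}) = emeasure N (E \<times> {0..y})" if E: "E \<in> sets unit_lebesgue" and y: "y \<in> {0..1}" for E y
  proof -
    have y': "{0..y} \<in> sets unit_lebesgue" using y Icc_in_sets_unit by auto
    have "?fst M {0..y} = ?fst N {0..y}"
    proof (rule unit_measure_eqI)
      show "finite_measure (?fst M {0..y})" "finite_measure (?fst N {0..y})"
        using fst(2)[OF M.finite_measure_axioms s(1) y' y'] fst(2)[OF N.finite_measure_axioms s(2) y' y'] .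
      fix q :: real assume q: "0 \<le> q" "q \<le> 1"
      have q': "{0..q} \<in> sets unit_lebesgue" using q Icc_in_sets_unit by auto
      show "emeasure (?fst M {0..y}) {0..q} = emeasure (?fst N {0..y}) {0..q}"
        unfolding fst(1)[OF M.finite_measure_axioms s(1) q' y'] fst(1)[OF N.finite_measure_axioms s(2) q' y']
        using eq'[of q y] q y by simp
    qed simp_all
    then show ?thesis
      using fst(1)[OF M.finite_measure_axioms s(1) E y'] fst(1)[OF N.finite_measure_axioms s(2) E y'] by simp
  qed
  have 2: "emeasure M (E \<times> F) = emeasure N (E \<times> F)" if EF: "E \<in> sets unit_lebesgue" "F \<in> sets unit_lebesgue" for E F
  proof -
    have "?snd M E = ?snd N E"
    proof (rule unit_measure_eqI)
      show "finite_measure (?snd M E)" "finite_measure (?snd N E)"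
        using snd(2)[OF M.finite_measure_axioms s(1) EF] snd(2)[OF N.finite_measure_axioms s(2) EF] .
      fix q :: real assume q: "0 \<le> q" "q \<le> 1"
      have q': "{0..q} \<in> sets unit_lebesgue" using q Icc_in_sets_unit by auto
      show "emeasure (?snd M E) {0..q} = emeasure (?snd N E) {0..q}"
        unfolding snd(1)[OF M.finite_measure_axioms s(1) EF(1) q'] snd(1)[OF N.finite_measure_axioms s(2) EF(1) q']
        using 1[OF EF(1), of q] q by simp
    qed simp_all
    then show ?thesis
      using snd(1)[OF M.finite_measure_axioms s(1) EF] snd(1)[OF N.finite_measure_axioms s(2) EF] by simp
  qed
  show ?thesis
  proof (rule measure_eqI_generator_eq[OF Int_stable_pair_measure_generator[of unit_lebesgue unit_lebesgue], where A="\<lambda>_. unit_interval \<times> unit_interval" and \<Omega>="unit_interval \<times> unit_interval"])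
    show "{a \<times> b |a b. a \<in> sets unit_lebesgue \<and> b \<in> sets unit_lebesgue} \<subseteq> Pow (unit_interval \<times> unit_interval)"
      by (auto simp: sets_unit_lebesgue_iff)
    show "sets M = sigma_sets (unit_interval \<times> unit_interval) {a \<times> b |a b. a \<in> sets unit_lebesgue \<and> b \<in> sets unit_lebesgue}"
      "sets N = sigma_sets (unit_interval \<times> unit_interval) {a \<times> b |a b. a \<in> sets unit_lebesgue \<and> b \<in> sets unit_lebesgue}"
      using s by (simp_all add: sets_pair_measure)
    show "range (\<lambda>_::nat. unit_interval \<times> unit_interval) \<subseteq> {a \<times> b |a b. a \<in> sets unit_lebesgue \<and> b \<in> sets unit_lebesgue}"
      using Icc_in_sets_unit by blast
  qed (use 2 in auto)
qed

definition ev_of :: "(real \<Rightarrow> real) \<Rightarrow> real \<times> real \<Rightarrow> real" where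
  "ev_of h = restrict (\<lambda>(x, y). ev_fun h x y) unit_square"

lemma unit_lebesgue2_to_borel: "(\<lambda>z. z) \<in> unit_lebesgue2 \<rightarrow>\<^sub>M borel"
proof -
  have "(\<lambda>z. (fst z, snd z)) \<in> unit_lebesgue2 \<rightarrow>\<^sub>M borel \<Otimes>\<^sub>M borel"
    by (intro measurable_Pair measurable_compose[OF measurable_fst unit_lebesgue_to_borel]
        measurable_compose[OF measurable_snd unit_lebesgue_to_borel])
  then show ?thesis by (simp add: borel_prod)
qed

lemma distr_unit_lebesgue_borel: "distr unit_lebesgue borel (\<lambda>x. x) = uniform_measure lborel unit_interval"
proof (rule measure_eqI)
  fix A assume "A \<in> sets (distr unit_lebesgue borel (\<lambda>x. x))"
  then have A: "A \<in> sets borel" by simp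
  then have "emeasure (distr unit_lebesgue borel (\<lambda>x. x)) A = emeasure lborel (A \<inter> unit_interval)"
    by (subst emeasure_distr_unit_to_borel) (auto simp: emeasure_restrict_space)
  then show "emeasure (distr unit_lebesgue borel (\<lambda>x. x)) A = emeasure (uniform_measure lborel unit_interval) A"
    using A by (simp add: emeasure_uniform_measure Int_commute divide_ennreal_def)
qed simp

text \<open>\<open>copula\<close> refers to Borel measures on the plane,
  \<open>doubly_stochastic\<close> to measures on the square. The image under the inclusion map
  translates, since \<open>{..x} \<times> {..y}\<close> meets the square in
  \<open>{0..x} \<times> {0..y}\<close>.\<close>

lemma doubly_stochastic_imp_copula:
  assumes M: "doubly_stochastic M"
  shows "copula (restrict (\<lambda>(x, y). measure M ({0..x} \<times> {0..y})) unit_square)"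
proof -
  let ?M = "distr M borel (\<lambda>z. z)"
  have s: "sets M = sets unit_lebesgue2" "distr M unit_lebesgue fst = unit_lebesgue" "distr M unit_lebesgue snd = unit_lebesgue"
    using M by (auto simp: doubly_stochastic_def)
  have m: "(\<lambda>z. z) \<in> M \<rightarrow>\<^sub>M borel"
    using unit_lebesgue2_to_borel measurable_cong_sets[OF s(1) refl] by blast
  have f: "fst \<in> M \<rightarrow>\<^sub>M unit_lebesgue" "snd \<in> M \<rightarrow>\<^sub>M unit_lebesgue"
    using measurable_cong_sets[OF s(1) refl] measurable_fst measurable_snd by blast+
  have sp: "space M = unit_square" using sets_eq_imp_space_eq[OF s(1)] by (simp add: space_pair_measure)
  have "prob_space M"
  proof (rule prob_spaceI)
    show "emeasure M (space M) = 1"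
      using emeasure_fst_marginal[OF s(1), of unit_interval] s(2) Icc_in_sets_unit sp
        prob_space.emeasure_space_1[OF prob_space_unit_lebesgue] by simp
  qed
  then have 1: "prob_space ?M" using m by (rule prob_space.prob_space_distr)
  have 2: "distr ?M borel fst = uniform_measure lborel unit_interval"
  proof -
    have "distr ?M borel fst = distr M borel fst" by (subst distr_distr[OF _ m]) (auto simp: o_def borel_measurable_continuous_onI continuous_on_fst)
    also have "\<dots> = distr (distr M unit_lebesgue fst) borel (\<lambda>x. x)" by (subst distr_distr[OF unit_lebesgue_to_borel f(1)]) (simp add: o_def)
    finally show ?thesis using s(2) distr_unit_lebesgue_borel by simp
  qed
  have 3: "distr ?M borel snd = uniform_measure lborel unit_interval"
  proof -
    have "distr ?M borel snd = distr M borel snd" by (subst distr_distr[OF _ m]) (auto simp: o_def borel_measurable_continuous_onI continuous_on_snd)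
    also have "\<dots> = distr (distr M unit_lebesgue snd) borel (\<lambda>x. x)" by (subst distr_distr[OF unit_lebesgue_to_borel f(2)]) (simp add: o_def)
    finally show ?thesis using s(3) distr_unit_lebesgue_borel by simp
  qed
  have 4: "joint_cdf ?M (x, y) = measure M ({0..x} \<times> {0..y})" if "x \<in> {0..1}" "y \<in> {0..1}" for x y
  proof -
    have S: "{..x} \<times> {..y} \<in> sets (borel :: (real \<times> real) measure)" by (intro borel_closed closed_Times) auto
    have "joint_cdf ?M (x, y) = measure M ((\<lambda>z. z) -` ({..x} \<times> {..y}) \<inter> space M)"
      using measure_distr[OF m S] by (simp add: joint_cdf_def)
    also have "(\<lambda>z. z) -` ({..x} \<times> {..y}) \<inter> space M = {0..x} \<times> {0..y}"
    proof -
      have "{..x} \<inter> unit_interval = {0..x}" "{..y} \<inter> unit_interval = {0..y}" using that by auto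
      then show ?thesis unfolding sp vimage_ident Times_Int_Times by (simp only:)
    qed
    finally show ?thesis .
  qed
  have "restrict (\<lambda>(x, y). measure M ({0..x} \<times> {0..y})) unit_square = restrict (joint_cdf ?M) unit_square"
  proof (rule restrict_ext)
    fix z :: "real \<times> real" assume "z \<in> unit_square"
    then obtain x y where z: "z = (x, y)" and xy: "x \<in> {0..1}" "y \<in> {0..1}" by (rule SigmaE)
    show "(case z of (x, y) \<Rightarrow> measure M ({0..x} \<times> {0..y})) = joint_cdf ?M z"
      unfolding z prod.case by (rule 4[OF xy, symmetric])
  qed
  moreover have "sets ?M = sets borel" by simp
  ultimately show ?thesis
    unfolding copula_def using 1 2 3 by (intro exI[of _ ?M] conjI)
qed

section \<open>From a profile to an Extreme Value copula\<close>

context profile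
begin

text \<open>The first marginal is uniform because every kernel measure has mass \<open>1\<close>;
  the second because the conditional distribution functions integrate to
  \<open>ev_fun h 1 y = y\<close>.\<close>

lemma doubly_stochastic_ev_measure: "doubly_stochastic ev_measure"
  unfolding doubly_stochastic_def
proof (intro conjI)
  show s: "sets ev_measure = sets unit_lebesgue2"
    by (rule sets_kernel_measure[OF cond_kernel_measurable_subprob])
  show "distr ev_measure unit_lebesgue fst = unit_lebesgue"
  proof (rule measure_eqI)
    fix A assume "A \<in> sets (distr ev_measure unit_lebesgue fst)"
    then have A: "A \<in> sets unit_lebesgue" by simp
    then have "emeasure (distr ev_measure unit_lebesgue fst) A = (\<integral>\<^sup>+x\<in>A. 1 \<partial>unit_lebesgue)"
      using emeasure_ev_measure[OF A, of unit_interval] Icc_in_sets_unit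
      by (simp add: emeasure_fst_marginal[OF s] emeasure_cond_kernel_space)
    then show "emeasure (distr ev_measure unit_lebesgue fst) A = emeasure unit_lebesgue A" using A by simp
  qed simp
  show "distr ev_measure unit_lebesgue snd = unit_lebesgue"
  proof (rule unit_measure_eqI)
    have m: "emeasure (distr ev_measure unit_lebesgue snd) {0..y} = ennreal y" if "0 \<le> y" "y \<le> 1" for y
      using that emeasure_snd_marginal[OF s, of "{0..y}"] emeasure_ev_measure_Icc[of 1 y] Icc_in_sets_unit[of 0 y]
      by (simp add: ev_fun_def)
    show "finite_measure (distr ev_measure unit_lebesgue snd)"
      by (rule finite_measureI) (use m[of 1] in simp)
    show "finite_measure unit_lebesgue" using prob_space_unit_lebesgue by (simp add: prob_space_def)
    fix q :: real assume "0 \<le> q" "q \<le> 1"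
    then show "emeasure (distr ev_measure unit_lebesgue snd) {0..q} = emeasure unit_lebesgue {0..q}"
      by (subst m) (auto simp: emeasure_restrict_space)
  qed auto
qed

lemma ev_fun_nonneg: "x \<in> {0..1} \<Longrightarrow> y \<in> {0..1} \<Longrightarrow> 0 \<le> ev_fun h x y"
  by (auto simp: ev_fun_def)

lemma measure_ev_measure_Icc:
  assumes "x \<in> {0..1}" "y \<in> {0..1}"
  shows "measure ev_measure ({0..x} \<times> {0..y}) = ev_fun h x y"
  using assms emeasure_ev_measure_Icc[of x y] ev_fun_nonneg[OF assms] by (simp add: measure_def)

lemma ev_of_eq_measure: "ev_of h = restrict (\<lambda>(x, y). measure ev_measure ({0..x} \<times> {0..y})) unit_square"
  unfolding ev_of_def by (auto simp: restrict_def fun_eq_iff measure_ev_measure_Icc)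

lemma copula_ev_of: "copula (ev_of h)"
  unfolding ev_of_eq_measure by (rule doubly_stochastic_imp_copula[OF doubly_stochastic_ev_measure])

lemma copula_measure_ev_of: "copula_measure (ev_of h) = ev_measure"
  unfolding copula_measure_def
proof (rule the_equality)
  show *: "doubly_stochastic ev_measure \<and> (\<forall>x\<in>unit_interval. \<forall>y\<in>unit_interval. measure ev_measure ({0..x} \<times> {0..y}) = ev_of h (x, y))"
    using doubly_stochastic_ev_measure measure_ev_measure_Icc by (simp add: ev_of_def)
  show "M = ev_measure" if "doubly_stochastic M \<and> (\<forall>x\<in>unit_interval. \<forall>y\<in>unit_interval. measure M ({0..x} \<times> {0..y}) = ev_of h (x, y))" for M
    by (rule doubly_stochastic_eqI) (use that * in auto)
qed

text \<open>Taking roots divides \<open>ln x\<close> and \<open>ln y\<close> by the same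
  \<open>n\<close>, so the argument of \<open>h\<close> does not move. This is max-stability, and it
  lets the copula serve as its own \<open>B\<close> in the definition of
  \<open>ev_copulas\<close>.\<close>

lemma ev_fun_root:
  assumes "x \<in> {0..1}" "y \<in> {0..1}" "0 < n"
  shows "ev_fun h (root n x) (root n y) ^ n = ev_fun h x y"
proof (cases "x \<in> {0<..<1} \<and> y \<in> {0<..<1}")
  case True
  then have "root n x \<in> {0<..<1}" "root n y \<in> {0<..<1}" using assms by auto
  moreover have "ln (root n x) = ln x / n" "ln (root n y) = ln y / n"
    using True assms by (auto simp: ln_root)
  moreover have "exp (ln y / n * h (ln x / ln y)) ^ n = exp (ln y * h (ln x / ln y))"
    using assms by (simp flip: exp_of_nat_mult)
  ultimately show ?thesis using True assms by (simp add: ev_fun_def)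
next
  case False
  then have "\<not> (root n x \<in> {0<..<1} \<and> root n y \<in> {0<..<1})"
    using assms by auto
  then have "ev_fun h (root n x) (root n y) ^ n = min (root n x) (root n y) ^ n"
    unfolding ev_fun_def by (simp only: if_False)
  also have "\<dots> = min x y"
    using assms by (auto simp: min_def)
  finally show ?thesis using False unfolding ev_fun_def by (simp only: if_False)
qed

lemma ev_of_in_ev_copulas: "ev_of h \<in> ev_copulas"
proof -
  have "(\<lambda>n. ev_of h (root n x, root n y) ^ n) \<longlonglongrightarrow> ev_of h (x, y)" if "x \<in> {0..1}" "y \<in> {0..1}" for x y
  proof (rule tendsto_eventually)
    show "\<forall>\<^sub>F n in sequentially. ev_of h (root n x, root n y) ^ n = ev_of h (x, y)"
      using eventually_gt_at_top[of 0]
    proof eventually_elim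
      case (elim n)
      then have "root n x \<in> {0..1}" "root n y \<in> {0..1}" using that by auto
      then show ?case using ev_fun_root[OF that elim] that by (simp add: ev_of_def)
    qed
  qed
  then show ?thesis using copula_ev_of by (auto simp: ev_copulas_def)
qed

lemma is_copula_kernel_cond_kernel: "is_copula_kernel (ev_of h) (cond_kernel h)"
  using cond_kernel_measurable emeasure_ev_measure by (simp add: is_copula_kernel_def copula_measure_ev_of)

end

section \<open>Every Extreme Value copula has a profile\<close>

text \<open>
  At the rightmost maximum of \<open>h\<close> minus a chord, the slope to the left is nonnegative and the slope
  to the right is negative, which contradicts the slope condition.
\<close>

lemma convex_on_geometric_slopes:
  fixes h :: "real \<Rightarrow> real"
  assumes cont: "continuous_on {0<..} h"
    and slope: "\<And>b q. 0 < b \<Longrightarrow> 1 < q \<Longrightarrow> q * (h b - h (b / q)) \<le> h (b * q) - h b"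
  shows "convex_on {0<..} h"
proof (rule convex_on_linorderI)
  fix t a c :: real assume t: "0 < t" "t < 1" and ac: "a \<in> {0<..}" "c \<in> {0<..}" "a < c"
  define \<beta> where "\<beta> = (h c - h a) / (c - a)"
  define g where "g s = h s - (h a + \<beta> * (s - a))" for s
  have ga: "g a = 0" and gc: "g c = 0" using ac by (auto simp: g_def \<beta>_def)
  \<comment> \<open>Subtracting the chord preserves the slope condition, which affine functions
    satisfy with equality.\<close>
  have gslope: "q * (g b - g (b / q)) \<le> g (b * q) - g b" if "0 < b" "1 < q" for b q
  proof -
    have "q * (\<beta> * (b - a) - \<beta> * (b / q - a)) = \<beta> * (b * q - a) - \<beta> * (b - a)"
      using that by (simp add: field_simps)
    then show ?thesis using slope[OF that] by (simp add: g_def algebra_simps)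
  qed
  have contg: "continuous_on {a..c} g"
    unfolding g_def using ac by (intro continuous_intros continuous_on_subset[OF cont]) auto
  obtain m where m: "m \<in> {a..c}" "\<And>s. s \<in> {a..c} \<Longrightarrow> g s \<le> g m"
    using continuous_attains_sup[OF compact_Icc _ contg] ac by fastforce
  have gm: "g m \<le> 0"
  proof (rule ccontr)
    assume pos: "\<not> g m \<le> 0"
    let ?S = "{s \<in> {a..c}. g s = g m}"
    have "closed ?S" using continuous_closed_preimage_constant[OF contg closed_atLeastAtMost] .
    moreover have "bounded ?S" by (rule bounded_subset[OF bounded_closed_interval[of a c]]) auto
    ultimately have "compact ?S" by (simp add: compact_eq_bounded_closed)
    moreover have "?S \<noteq> {}" using m(1) by blast
    ultimately obtain b where "b \<in> ?S" "\<forall>s\<in>?S. s \<le> b"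
      using compact_attains_sup[of ?S] by metis
    then have b: "b \<in> {a..c}" "g b = g m" "\<And>s. s \<in> {a..c} \<Longrightarrow> g s = g m \<Longrightarrow> s \<le> b"
      by simp_all
    have "b \<noteq> a" "b \<noteq> c" using b(2) pos ga gc by auto
    then have b': "a < b" "b < c" "g b = g m" using b(1,2) by auto
    \<comment> \<open>The largest ratio for which both \<open>b * q\<close> and \<open>b / q\<close>
      stay in \<open>{a..c}\<close>.\<close>
    define q where "q = min (c / b) (b / a)"
    have q: "1 < q" "b * q \<le> c" "a \<le> b / q"
      using b' ac by (auto simp: q_def min_def field_simps)
    have "b < b * q" using q b' ac by simp
    have "b / q < b" using q b' ac by (simp add: field_simps)
    have "0 < b" using b' ac by simp
    have "g (b * q) \<le> g m" using m(2)[of "b * q"] \<open>b < b * q\<close> q b' by simp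
    moreover have "g (b * q) \<noteq> g m" using b(3)[of "b * q"] \<open>b < b * q\<close> q b' by auto
    ultimately have "g (b * q) - g b < 0" using b' by simp
    moreover have "g (b / q) \<le> g m" using m(2)[of "b / q"] \<open>b / q < b\<close> q b' by simp
    then have "0 \<le> q * (g b - g (b / q))" using q b' by simp
    ultimately show False using gslope[OF \<open>0 < b\<close> q(1)] by linarith
  qed
  let ?s = "(1 - t) * a + t * c"
  have "?s = a + t * (c - a)" by (simp add: algebra_simps)
  moreover have "0 < t * (c - a)" "t * (c - a) < c - a" using t ac by auto
  ultimately have "?s \<in> {a..c}" by simp
  then have "g ?s \<le> 0" using m(2) gm by force
  moreover have "h a + \<beta> * (?s - a) = (1 - t) * h a + t * h c"
  proof -
    have "?s - a = t * (c - a)" by (simp add: algebra_simps)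
    moreover have "\<beta> * (t * (c - a)) = t * (h c - h a)" using ac by (simp add: \<beta>_def)
    ultimately show ?thesis by (simp add: algebra_simps)
  qed
  ultimately show "h ((1 - t) *\<^sub>R a + t *\<^sub>R c) \<le> (1 - t) * h a + t * h c"
    by (simp add: g_def)
qed simp

section \<open>Elementary properties of copulas\<close>

lemma copula_marginals:
  assumes "copula C" "x \<in> {0..1}"
  shows "C (x, 1) = x" "C (1, x) = x"
proof -
  obtain M where M: "prob_space M" "sets M = sets borel"
    "distr M borel fst = uniform_measure lborel unit_interval"
    "distr M borel snd = uniform_measure lborel unit_interval"
    "C = restrict (joint_cdf M) unit_square"
    using assms(1) unfolding copula_def by blast
  interpret prob_space M by fact
  have sp: "space M = UNIV" using sets_eq_imp_space_eq[OF M(2)] by simp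
  have [measurable]: "fst \<in> M \<rightarrow>\<^sub>M borel" "snd \<in> M \<rightarrow>\<^sub>M borel"
    by (simp_all add: measurable_cong_sets[OF M(2) refl] borel_measurable_continuous_onI continuous_on_fst continuous_on_snd)
  have S: "{..x} \<times> {..y} \<in> sets M" for x y :: real
    unfolding M(2) by (intro borel_closed closed_Times) auto
  have fst: "measure M (fst -` A) = measure lborel (unit_interval \<inter> A)"
    and snd: "measure M (snd -` A) = measure lborel (unit_interval \<inter> A)" if "A \<in> sets borel" for A
  proof -
    have "measure M (fst -` A) = measure (distr M borel fst) A" "measure M (snd -` A) = measure (distr M borel snd) A"
      using that by (simp_all add: measure_distr sp)
    then show "measure M (fst -` A) = measure lborel (unit_interval \<inter> A)"
      "measure M (snd -` A) = measure lborel (unit_interval \<inter> A)"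
      using that by (simp_all add: M(3,4))
  qed
  \<comment> \<open>The uniform marginals leave no mass beyond \<open>1\<close>, so cutting off one
    coordinate at \<open>1\<close> removes only a null set.\<close>
  have fst_null: "fst -` {1<..} \<in> null_sets M" and snd_null: "snd -` {1<..} \<in> null_sets M"
  proof -
    have "unit_interval \<inter> {1<..} = {}" by auto
    moreover have "fst -` {1<..} \<in> sets M" "snd -` {1<..} \<in> sets M"
      using measurable_sets[of fst M borel "{1<..}"] measurable_sets[of snd M borel "{1<..}"] by (auto simp: sp)
    ultimately show "fst -` {1<..} \<in> null_sets M" "snd -` {1<..} \<in> null_sets M"
      using fst[of "{1<..}"] snd[of "{1<..}"] by (auto simp: null_sets_def emeasure_eq_measure)
  qed
  have len: "measure lborel (unit_interval \<inter> {..x}) = x"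
  proof -
    have "unit_interval \<inter> {..x} = {0..x}" using assms by auto
    then show ?thesis using assms by simp
  qed
  have fS: "fst -` {..x} \<in> sets M" "snd -` {..x} \<in> sets M"
    using measurable_sets[of fst M borel "{..x}"] measurable_sets[of snd M borel "{..x}"] by (auto simp: sp)
  have "{..x} \<times> {..1 :: real} = fst -` {..x} - snd -` {1<..}" by auto
  then have "measure M ({..x} \<times> {..1}) = x"
    using measure_Diff_null_set[OF fS(1) snd_null] fst[of "{..x}"] len by simp
  moreover have "{..1 :: real} \<times> {..x} = snd -` {..x} - fst -` {1<..}" by auto
  then have "measure M ({..1} \<times> {..x}) = x"
    using measure_Diff_null_set[OF fS(2) fst_null] snd[of "{..x}"] len by simp
  ultimately show "C (x, 1) = x" "C (1, x) = x"
    using assms by (simp_all add: M(5) joint_cdf_def)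
qed

text \<open>The 2-increasing property: inclusion-exclusion for two quadrants contained in a third,
  whose intersection is the fourth.\<close>

lemma copula_rectangle:
  assumes "copula C" "0 \<le> x" "x \<le> x'" "x' \<le> 1" "0 \<le> y" "y \<le> y'" "y' \<le> 1"
  shows "C (x', y) + C (x, y') \<le> C (x', y') + C (x, y)"
proof -
  obtain M where M: "prob_space M" "sets M = sets borel" "C = restrict (joint_cdf M) unit_square"
    using assms(1) unfolding copula_def by blast
  interpret prob_space M by fact
  have S: "{..x} \<times> {..y} \<in> sets M" for x y :: real
    unfolding M(2) by (intro borel_closed closed_Times) auto
  have "measure M ({..x'} \<times> {..y} \<union> {..x} \<times> {..y'}) + measure M (({..x'} \<times> {..y}) \<inter> ({..x} \<times> {..y'}))
      = measure M ({..x'} \<times> {..y}) + measure M ({..x} \<times> {..y'})"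
    using S by (simp add: finite_measure_Union' finite_measure_Diff' Int_commute)
  moreover have "measure M ({..x'} \<times> {..y} \<union> {..x} \<times> {..y'}) \<le> measure M ({..x'} \<times> {..y'})"
    using S assms by (intro finite_measure_mono) auto
  moreover have "({..x'} \<times> {..y}) \<inter> ({..x} \<times> {..y'}) = {..x} \<times> {..y}" using assms by auto
  ultimately show ?thesis using assms by (simp add: M(3) joint_cdf_def)
qed

lemma copula_mono:
  assumes "copula C" "0 \<le> x" "x \<le> x'" "x' \<le> 1" "0 \<le> y" "y \<le> y'" "y' \<le> 1"
  shows "C (x, y) \<le> C (x', y')"
proof -
  obtain M where M: "prob_space M" "sets M = sets borel" "C = restrict (joint_cdf M) unit_square"
    using assms(1) unfolding copula_def by blast
  interpret prob_space M by fact
  have "{..x'} \<times> {..y'} \<in> sets M"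
    unfolding M(2) by (intro borel_closed closed_Times) auto
  then have "measure M ({..x} \<times> {..y}) \<le> measure M ({..x'} \<times> {..y'})"
    using assms by (intro finite_measure_mono) auto
  then show ?thesis using assms by (simp add: M(3) joint_cdf_def)
qed

lemma copula_zero:
  assumes "copula C" "x \<in> {0..1}"
  shows "C (x, 0) = 0" "C (0, x) = 0"
  using copula_range[OF assms(1), of "(x, 0)"] copula_range[OF assms(1), of "(0, x)"]
    copula_mono[OF assms(1), of x 1 0 0] copula_mono[OF assms(1), of 0 0 x 1]
    copula_marginals[OF assms(1), of 0] assms(2) by auto

text \<open>A derivative at \<open>0\<close>. It recovers the stable tail dependence function from
  the copula near the corner \<open>(1, 1)\<close>, where the values of \<open>C\<close> have the
  form \<open>exp (- t / n)\<close>.\<close>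

lemma tendsto_mult_one_minus_exp: "(\<lambda>n. real n * (1 - exp (- t / real n))) \<longlonglongrightarrow> t"
proof -
  have "((\<lambda>s. - exp (- (t * s))) has_real_derivative t) (at 0)"
    by (auto intro!: derivative_eq_intros)
  then have "((\<lambda>s. (- exp (- (t * s)) + 1) / s) \<longlongrightarrow> t) (at 0)"
    by (simp add: has_field_derivative_iff)
  moreover have "filterlim (\<lambda>n. 1 / real n) (at 0) sequentially"
    unfolding filterlim_at using lim_1_over_n eventually_gt_at_top[of "0::nat"]
    by (auto elim!: eventually_mono)
  ultimately have "(\<lambda>n. (- exp (- (t * (1 / real n))) + 1) / (1 / real n)) \<longlonglongrightarrow> t"
    by (rule filterlim_compose)
  then show ?thesis by (simp add: algebra_simps)
qed

lemma mono_linear_on_rats: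
  fixes f :: "real \<Rightarrow> real"
  assumes mono: "\<And>r s. 0 < r \<Longrightarrow> r \<le> s \<Longrightarrow> f r \<le> f s"
    and rat: "\<And>q. q \<in> \<rat> \<Longrightarrow> 0 < q \<Longrightarrow> f q = q * c" and c: "0 \<le> c" and r: "0 < r"
  shows "f r = r * c"
proof -
  have "f r \<le> r * c + e" if e: "0 < e" for e
  proof -
    \<comment> \<open>Dividing by \<open>c + 1\<close> rather than \<open>c\<close> keeps the
      estimate valid when \<open>c = 0\<close>.\<close>
    have "r < r + e / (c + 1)" using e c by simp
    then obtain q where q: "q \<in> \<rat>" "r < q" "q < r + e / (c + 1)" using Rats_dense_in_real by blast
    have "f r \<le> q * c" using mono[of r q] rat[of q] r q by simp
    also have "\<dots> \<le> (r + e / (c + 1)) * c" using q c by (intro mult_right_mono) auto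
    also have "\<dots> \<le> r * c + e" using e c by (simp add: field_simps)
    finally show ?thesis .
  qed
  moreover have "r * c \<le> f r + e" if e: "0 < e" for e
  proof -
    have "max 0 (r - e / (c + 1)) < r" using e c r by simp
    then obtain q where q: "q \<in> \<rat>" "max 0 (r - e / (c + 1)) < q" "q < r" using Rats_dense_in_real by blast
    have "r * c \<le> (q + e / (c + 1)) * c" using q c by (intro mult_right_mono) auto
    also have "\<dots> \<le> q * c + e" using e c by (simp add: field_simps)
    also have "q * c \<le> f r" using mono[of q r] rat[of q] q by simp
    finally show ?thesis by simp
  qed
  ultimately show ?thesis
    using field_le_epsilon[of "f r" "r * c"] field_le_epsilon[of "r * c" "f r"] by force
qed

text \<open>Along the subsequence \<open>n * k\<close> the defining limit is the \<open>k\<close>-th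
  power of the limit at \<open>(root k x, root k y)\<close>, since iterated roots multiply their
  orders.\<close>

lemma ev_copula_stable:
  assumes C: "C \<in> ev_copulas" and xy: "x \<in> {0..1}" "y \<in> {0..1}" and k: "0 < k"
  shows "C (root k x, root k y) ^ k = C (x, y)"
proof -
  obtain B where B: "\<And>x y. x \<in> {0..1} \<Longrightarrow> y \<in> {0..1} \<Longrightarrow> (\<lambda>n. B (root n x, root n y) ^ n) \<longlonglongrightarrow> C (x, y)"
    using C unfolding ev_copulas_def by blast
  have "(\<lambda>n. (B (root n (root k x), root n (root k y)) ^ n) ^ k) \<longlonglongrightarrow> C (root k x, root k y) ^ k"
    using xy k by (intro tendsto_power B) auto
  moreover have "(\<lambda>n. B (root (n * k) x, root (n * k) y) ^ (n * k)) \<longlonglongrightarrow> C (x, y)"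
    using filterlim_compose[OF B[OF xy] mult_nat_right_at_top[OF k]] .
  moreover have "(\<lambda>n. B (root (n * k) x, root (n * k) y) ^ (n * k)) = (\<lambda>n. (B (root n (root k x), root n (root k y)) ^ n) ^ k)"
    by (simp add: real_root_mult_exp power_mult)
  ultimately show ?thesis using LIMSEQ_unique by force
qed

text \<open>The stable tail dependence function: on Extreme Value copulas
  \<open>C(exp (- u), exp (- v)) = exp (- tail_fun C u v)\<close>. In these coordinates
  max-stability becomes homogeneity of degree one, and the restriction to \<open>v = 1\<close> is
  the profile.\<close>

definition tail_fun :: "(real \<times> real \<Rightarrow> real) \<Rightarrow> real \<Rightarrow> real \<Rightarrow> real" where
  "tail_fun C u v = - ln (C (exp (- u), exp (- v)))"

section \<open>Homogeneity and convexity of the stable tail dependence function\<close>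

context
  fixes C assumes C: "C \<in> ev_copulas"
begin

lemma ev_copula_copula: "copula C" using C by (simp add: ev_copulas_def)

text \<open>A copula can vanish inside the square, but it is at least \<open>x + y - 1\<close>.
  Roots tend to \<open>1\<close>, so at some root of the point the value is positive, and stability
  carries this back. It makes the logarithm in \<open>tail_fun\<close> meaningful.\<close>

lemma ev_copula_pos:
  assumes xy: "0 < x" "x \<le> 1" "0 < y" "y \<le> 1" shows "0 < C (x, y)"
proof -
  have "(\<lambda>n. root n x + root n y - 1) \<longlonglongrightarrow> 1 + 1 - 1"
    using xy by (intro tendsto_intros LIMSEQ_root_const) auto
  then have "\<forall>\<^sub>F n in sequentially. 0 < root n x + root n y - 1"
    by (rule order_tendstoD) simp
  then have "\<forall>\<^sub>F n in sequentially. 0 < root n x + root n y - 1 \<and> 0 < n"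
    using eventually_gt_at_top[of 0] by eventually_elim simp
  then obtain n where n: "0 < root n x + root n y - 1" "0 < n"
    using eventually_happens by fastforce
  have r: "root n x \<in> {0..1}" "root n y \<in> {0..1}" using xy n by auto
  have "root n x + root n y \<le> C (root n x, root n y) + 1"
    using copula_rectangle[OF ev_copula_copula, of "root n x" 1 "root n y" 1] r
      copula_marginals[OF ev_copula_copula r(1)] copula_marginals[OF ev_copula_copula r(2)]
      copula_marginals[OF ev_copula_copula, of 1] by simp
  then have "0 < C (root n x, root n y) ^ n" using n by simp
  then show ?thesis using ev_copula_stable[OF C, of x y n] xy n by simp
qed

lemma exp_tail_fun: "0 \<le> u \<Longrightarrow> 0 \<le> v \<Longrightarrow> C (exp (- u), exp (- v)) = exp (- tail_fun C u v)"
  using ev_copula_pos[of "exp (- u)" "exp (- v)"] by (simp add: tail_fun_def)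

lemma tail_fun_axes: "0 \<le> u \<Longrightarrow> tail_fun C u 0 = u" "0 \<le> u \<Longrightarrow> tail_fun C 0 u = u"
  using copula_marginals[OF ev_copula_copula, of "exp (- u)"] by (simp_all add: tail_fun_def)

lemma tail_fun_nat:
  assumes "0 \<le> u" "0 \<le> v" shows "tail_fun C (real k * u) (real k * v) = real k * tail_fun C u v"
proof (cases "k = 0")
  case True then show ?thesis using tail_fun_axes[of 0] by simp
next
  case False
  have r: "root k (exp (- (real k * u))) = exp (- u)" for u
    using False by (intro real_root_pos_unique) (auto simp flip: exp_of_nat_mult)
  have "exp (- tail_fun C u v) ^ k = exp (- tail_fun C (real k * u) (real k * v))"
    using ev_copula_stable[OF C, of "exp (- (real k * u))" "exp (- (real k * v))" k] assms False
    by (simp add: r exp_tail_fun)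
  then have "exp (- (real k * tail_fun C u v)) = exp (- tail_fun C (real k * u) (real k * v))"
    by (simp flip: exp_of_nat_mult)
  then show ?thesis by simp
qed

lemma tail_fun_mono:
  assumes "0 \<le> u" "u \<le> u'" "0 \<le> v" "v \<le> v'" shows "tail_fun C u v \<le> tail_fun C u' v'"
proof -
  have "C (exp (- u'), exp (- v')) \<le> C (exp (- u), exp (- v))"
    using assms by (intro copula_mono[OF ev_copula_copula]) auto
  then show ?thesis using assms by (simp add: exp_tail_fun)
qed

text \<open>Stability gives natural factors, hence rational ones, and monotonicity in the factor
  extends the identity to all positive reals.\<close>

lemma tail_fun_homogeneous:
  assumes uv: "0 \<le> u" "0 \<le> v" and r: "0 < r" shows "tail_fun C (r * u) (r * v) = r * tail_fun C u v"
proof (rule mono_linear_on_rats[where f="\<lambda>r. tail_fun C (r * u) (r * v)", OF _ _ _ r])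
  show "tail_fun C (r * u) (r * v) \<le> tail_fun C (s * u) (s * v)" if "0 < r" "r \<le> s" for r s
    using that uv by (intro tail_fun_mono mult_right_mono) auto
  show "0 \<le> tail_fun C u v" using tail_fun_mono[of 0 u 0 v] tail_fun_axes[of 0] uv by simp
  fix q :: real assume "q \<in> \<rat>" "0 < q"
  then obtain m n :: nat where q: "q = real m / real n" "n \<noteq> 0"
    by (metis Rats_abs_nat_div_natE abs_of_pos)
  have "real n * tail_fun C (q * u) (q * v) = tail_fun C (real n * (q * u)) (real n * (q * v))"
    using uv \<open>0 < q\<close> by (simp add: tail_fun_nat)
  also have "\<dots> = real m * tail_fun C u v"
    using uv q by (simp add: tail_fun_nat)
  also have "real m = real n * q" using q by simp
  finally show "tail_fun C (q * u) (q * v) = q * tail_fun C u v"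
    using q(2) by simp
qed

text \<open>The 2-increasing property of \<open>C\<close> is applied to arguments scaled by
  \<open>1 / n\<close>, where homogeneity turns the values of \<open>C\<close> into
  \<open>exp (- tail_fun C u v / n)\<close>. Multiplying \<open>1 - C\<close> by \<open>n\<close>
  and letting \<open>n\<close> tend to infinity gives \<open>tail_fun\<close>, with the inequality
  reversed.\<close>

lemma tail_fun_rectangle:
  assumes "0 \<le> u" "u \<le> u'" "0 \<le> v" "v \<le> v'"
  shows "tail_fun C u' v' + tail_fun C u v \<le> tail_fun C u' v + tail_fun C u v'"
proof -
  let ?e = "\<lambda>t n. real n * (1 - exp (- t / real n))"
  let ?l = "tail_fun C"
  have "?e (?l u' v') n + ?e (?l u v) n \<le> ?e (?l u' v) n + ?e (?l u v') n" if n: "0 < n" for n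
  proof -
    have eq: "C (exp (- (u / real n)), exp (- (v / real n))) = exp (- ?l u v / real n)" if "0 \<le> u" "0 \<le> v" for u v
      using exp_tail_fun[of "u / n" "v / n"] tail_fun_homogeneous[of u v "1 / n"] that n by simp
    have "C (exp (- (u / real n)), exp (- (v' / real n))) + C (exp (- (u' / real n)), exp (- (v / real n)))
       \<le> C (exp (- (u / real n)), exp (- (v / real n))) + C (exp (- (u' / real n)), exp (- (v' / real n)))"
      using assms n by (intro copula_rectangle[OF ev_copula_copula]) (auto simp: divide_right_mono)
    then have "exp (- ?l u v' / real n) + exp (- ?l u' v / real n) \<le> exp (- ?l u v / real n) + exp (- ?l u' v' / real n)"
      using assms by (simp add: eq)
    then have "real n * (exp (- ?l u v' / real n) + exp (- ?l u' v / real n)) \<le> real n * (exp (- ?l u v / real n) + exp (- ?l u' v' / real n))"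
      by (intro mult_left_mono) auto
    then show ?thesis by (simp add: algebra_simps)
  qed
  then have "\<exists>N. \<forall>n\<ge>N. ?e (?l u' v') n + ?e (?l u v) n \<le> ?e (?l u' v) n + ?e (?l u v') n"
    by (intro exI[of _ 1]) auto
  then show ?thesis
    by (rule LIMSEQ_le[OF tendsto_add[OF tendsto_mult_one_minus_exp tendsto_mult_one_minus_exp]
          tendsto_add[OF tendsto_mult_one_minus_exp tendsto_mult_one_minus_exp]])
qed

lemma tail_fun_lipschitz:
  assumes "0 \<le> u" "u \<le> u'" "0 \<le> v" shows "tail_fun C u' v - tail_fun C u v \<le> u' - u"
  using tail_fun_rectangle[of u u' 0 v] tail_fun_axes[of u] tail_fun_axes[of u'] assms by simp

text \<open>By homogeneity \<open>q * h (s / q) = tail_fun C s q\<close>, so the geometric slope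
  condition is the rectangle inequality between the heights \<open>1\<close> and \<open>q\<close>.
  The three bounds come from monotonicity, the rectangle inequality and the values on the
  axes.\<close>

lemma profile_tail_fun: "profile (\<lambda>s. tail_fun C s 1)"
proof
  let ?h = "\<lambda>s. tail_fun C s 1"
  have lip: "\<bar>?h s - ?h t\<bar> \<le> \<bar>s - t\<bar>" if "0 < s" "0 < t" for s t
    using tail_fun_lipschitz[of s t 1] tail_fun_lipschitz[of t s 1] tail_fun_mono[of s t 1 1]
      tail_fun_mono[of t s 1 1] that by (cases "s \<le> t") auto
  show "convex_on {0<..} ?h"
  proof (rule convex_on_geometric_slopes)
    show "continuous_on {0<..} ?h"
      unfolding continuous_on_iff dist_real_def using lip by (meson greaterThan_iff le_less_trans)
    fix b q :: real assume bq: "0 < b" "1 < q"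
    have "q * tail_fun C (s / q) 1 = tail_fun C s q" if "0 \<le> s" for s
      using tail_fun_homogeneous[of "s / q" 1 q] that bq by simp
    from this[of "b * q"] this[of b]
    have "q * (?h b - ?h (b / q)) = tail_fun C (b * q) q - tail_fun C b q"
      using bq by (simp add: algebra_simps)
    also have "\<dots> \<le> ?h (b * q) - ?h b"
      using tail_fun_rectangle[of b "b * q" 1 q] bq by simp
    finally show "q * (?h b - ?h (b / q)) \<le> ?h (b * q) - ?h b" .
  qed
  fix s :: real assume s: "0 < s"
  show "1 \<le> ?h s" using tail_fun_mono[of 0 s 1 1] tail_fun_axes[of 1] s by simp
  show "s \<le> ?h s" using tail_fun_mono[of s s 0 1] tail_fun_axes[of s] s by simp
  show "?h s \<le> 1 + s" using tail_fun_rectangle[of 0 s 0 1] tail_fun_axes[of s] tail_fun_axes[of 1] tail_fun_axes[of 0] s by simp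
qed

lemma ev_of_tail_fun: "ev_of (\<lambda>s. tail_fun C s 1) = C"
proof
  fix z :: "real \<times> real"
  obtain x y where z: "z = (x, y)" by (cases z)
  show "ev_of (\<lambda>s. tail_fun C s 1) z = C z"
  proof (cases "z \<in> unit_square")
    case False
    then show ?thesis
      using extensional_arb[OF copula_extensional[OF ev_copula_copula] False]
      unfolding ev_of_def restrict_apply by (simp only: if_False)
  next
    case True
    then have xy: "x \<in> {0..1}" "y \<in> {0..1}" unfolding z by blast+
    consider "x \<in> {0<..<1}" "y \<in> {0<..<1}" | "x = 0" | "x = 1" | "y = 0" | "y = 1"
      using xy by fastforce
    then have "ev_fun (\<lambda>s. tail_fun C s 1) x y = C (x, y)"
    proof cases
      case 1
      then have "- ln y * tail_fun C (ln x / ln y) 1 = tail_fun C (- ln x) (- ln y)"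
        using tail_fun_homogeneous[of "ln x / ln y" 1 "- ln y"] by (simp add: divide_nonpos_nonpos)
      then have "ln y * tail_fun C (ln x / ln y) 1 = - tail_fun C (- ln x) (- ln y)" by simp
      then show ?thesis
        using 1 exp_tail_fun[of "- ln x" "- ln y"] by (simp add: ev_fun_def)
    qed (use xy copula_zero[OF ev_copula_copula] copula_marginals[OF ev_copula_copula] in \<open>auto simp: ev_fun_def\<close>)
    then show ?thesis
      using True unfolding ev_of_def restrict_apply z by (simp only: if_True prod.case)
  qed
qed

end

lemma ev_copulasE:
  assumes "C \<in> ev_copulas" obtains h where "profile h" "C = ev_of h"
  using profile_tail_fun[OF assms] ev_of_tail_fun[OF assms] by metis

section \<open>The uniform topology\<close>

definition ev_metric :: "(real \<times> real \<Rightarrow> real) metric" where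
  "ev_metric = submetric (funspace unit_square euclidean_metric) ev_copulas"

lemma mspace_ev_metric: "mspace ev_metric = ev_copulas"
  using topspace_ev_topology unfolding ev_topology_def ev_metric_def by simp

lemma ev_copula_in_fspace: "C \<in> ev_copulas \<Longrightarrow> C \<in> Met_TC.fspace unit_square"
  using mspace_ev_metric by (auto simp: ev_metric_def)

lemma mdist_ev_metric_le_iff:
  assumes "C \<in> ev_copulas" "C' \<in> ev_copulas"
  shows "mdist ev_metric C C' \<le> a \<longleftrightarrow> (\<forall>z\<in>unit_square. \<bar>C z - C' z\<bar> \<le> a)"
proof -
  have "(0, 0) \<in> unit_square" by simp
  then have "unit_square \<noteq> {}" by blast
  then show ?thesis
    using Met_TC.funspace_mdist_le[OF ev_copula_in_fspace[OF assms(1)] ev_copula_in_fspace[OF assms(2)]]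
    by (simp add: ev_metric_def dist_real_def)
qed

lemma openin_ev_topologyE:
  assumes "openin ev_topology W" "C \<in> W"
  obtains r where "0 < r" "\<And>C'. C' \<in> ev_copulas \<Longrightarrow> (\<And>z. z \<in> unit_square \<Longrightarrow> \<bar>C z - C' z\<bar> \<le> r) \<Longrightarrow> C' \<in> W"
proof -
  interpret M: Metric_space "mspace ev_metric" "mdist ev_metric" by (rule Metric_space_mspace_mdist)
  have W: "openin M.mtopology W" using assms by (simp add: ev_topology_def ev_metric_def mtopology_of_def)
  then obtain r where r: "0 < r" "M.mball C r \<subseteq> W" using assms(2) unfolding M.openin_mtopology by blast
  have "W \<subseteq> mspace ev_metric" using W unfolding M.openin_mtopology by blast
  then have C: "C \<in> ev_copulas" using assms(2) mspace_ev_metric by blast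
  show thesis
  proof (rule that)
    show "0 < r / 2" using r by simp
    fix C' assume C': "C' \<in> ev_copulas" "\<And>z. z \<in> unit_square \<Longrightarrow> \<bar>C z - C' z\<bar> \<le> r / 2"
    then have "mdist ev_metric C C' \<le> r / 2" using mdist_ev_metric_le_iff[OF C] by blast
    then have "mdist ev_metric C C' < r" using r(1) by linarith
    then have "C' \<in> M.mball C r" 
      unfolding M.in_mball using C C'(1) by (simp add: mspace_ev_metric)
    then show "C' \<in> W" using r by blast
  qed
qed

lemma continuous_map_eval:
  assumes "z \<in> unit_square" shows "continuous_map ev_topology euclideanreal (\<lambda>C. C z)"
proof -
  have "Lipschitz_continuous_map ev_metric euclidean_metric (\<lambda>C. C z)"
    unfolding Lipschitz_continuous_map_def
  proof (intro conjI exI[of _ 1] ballI)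
    fix C C' assume "C \<in> mspace ev_metric" "C' \<in> mspace ev_metric"
    then have "C \<in> ev_copulas" "C' \<in> ev_copulas" by (simp_all add: mspace_ev_metric)
    then have "\<bar>C z - C' z\<bar> \<le> mdist ev_metric C C'"
      using mdist_ev_metric_le_iff[THEN iffD1, OF _ _ order_refl] assms by blast
    then show "mdist euclidean_metric (C z) (C' z) \<le> 1 * mdist ev_metric C C'"
      by (simp add: dist_real_def)
  qed simp
  then show ?thesis
    using Lipschitz_continuous_imp_continuous_map unfolding ev_topology_def ev_metric_def[symmetric] by fastforce
qed

text \<open>Evaluation at a point is continuous for the uniform metric, and positivity of Extreme
  Value copulas keeps the logarithm continuous. All exceptional sets are built from these
  functionals.\<close>

lemma continuous_map_tail_fun:
  assumes "0 \<le> u" "0 \<le> v" shows "continuous_map ev_topology euclideanreal (\<lambda>C. tail_fun C u v)"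
proof -
  let ?z = "(exp (- u), exp (- v))"
  have z: "?z \<in> unit_square" using assms by simp
  have "continuous_map ev_topology (top_of_set {0<..}) (\<lambda>C. C ?z)"
    unfolding continuous_map_in_subtopology
    using continuous_map_eval[OF z] ev_copula_pos[of _ "exp (- u)" "exp (- v)"] assms by simp
  moreover have "continuous_map (top_of_set {0<..}) euclideanreal (\<lambda>x::real. - ln x)"
    unfolding continuous_map_iff_continuous by (intro continuous_intros) auto
  ultimately have "continuous_map ev_topology euclideanreal ((\<lambda>x. - ln x) \<circ> (\<lambda>C. C ?z))"
    by (rule continuous_map_compose)
  then show ?thesis unfolding tail_fun_def o_def .
qed

text \<open>Put \<open>w = v * max 1 s\<close> with \<open>v = - ln y\<close>. The exponents differ
  by at most \<open>e * w\<close> and both values are at most \<open>exp (- w)\<close>, so the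
  difference is at most \<open>e * w * exp (- w) \<le> e\<close>. The weight \<open>max 1 s\<close>
  is the lower bound common to all profiles.\<close>

lemma profile_ev_of_dist:
  assumes h: "profile h" "profile h'" and e: "0 \<le> e"
    and close: "\<And>s. 0 < s \<Longrightarrow> \<bar>h s - h' s\<bar> \<le> e * max 1 s"
    and z: "z \<in> unit_square"
  shows "\<bar>ev_of h z - ev_of h' z\<bar> \<le> e"
proof -
  obtain x y where xy: "z = (x, y)" by (cases z)
  have eq: "ev_of h z = ev_fun h x y" "ev_of h' z = ev_fun h' x y"
    using z unfolding ev_of_def restrict_apply xy by (simp_all only: if_True prod.case)
  show ?thesis
  proof (cases "x \<in> {0<..<1} \<and> y \<in> {0<..<1}")
    case False
    then have "ev_fun h x y = ev_fun h' x y" by (simp only: ev_fun_def if_False)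
    then show ?thesis using eq e by simp
  next
    case True
    define s v where "s = ln x / ln y" and "v = - ln y"
    have s: "0 < s" and v: "0 < v" using True ln_ratio_pos by (auto simp: s_def v_def)
    \<comment> \<open>One direction only; it is used twice with the roles of the two profiles
      exchanged.\<close>
    have *: "exp (- (v * f s)) - exp (- (v * g s)) \<le> e"
      if f: "profile f" and close: "g s - f s \<le> e * max 1 s" for f g
    proof -
      let ?w = "v * max 1 s"
      have w: "?w \<le> v * f s" using v profile.ge_one[OF f s] profile.ge_id[OF f s] by (intro mult_left_mono) auto
      have "1 - exp (- (v * (g s - f s))) \<le> v * (g s - f s)"
        using exp_ge_add_one_self[of "- (v * (g s - f s))"] by simp
      also have "\<dots> \<le> e * ?w" using mult_left_mono[OF close, of v] v by (simp add: algebra_simps)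
      finally have 1: "1 - exp (- (v * (g s - f s))) \<le> e * ?w" .
      have "exp (- (v * f s)) - exp (- (v * g s)) = exp (- (v * f s)) * (1 - exp (- (v * (g s - f s))))"
        by (simp add: right_diff_distrib flip: exp_add)
      also have "\<dots> \<le> exp (- (v * f s)) * (e * ?w)" using 1 by (intro mult_left_mono) auto
      also have "\<dots> \<le> exp (- ?w) * (e * ?w)" using w e v by (intro mult_right_mono) (auto simp: max_def)
      also have "\<dots> = e * (?w * exp (- ?w))" by simp
      also have "?w * exp (- ?w) \<le> 1"
      proof -
        have "?w \<le> exp ?w" using exp_ge_add_one_self[of ?w] by linarith
        then have "?w * exp (- ?w) \<le> exp ?w * exp (- ?w)" by (rule mult_right_mono) simp
        then show ?thesis by (simp flip: exp_add)
      qed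
      then have "e * (?w * exp (- ?w)) \<le> e" using e mult_left_le by blast
      finally show ?thesis .
    qed
    have "ev_fun h x y = exp (- (v * h s))" "ev_fun h' x y = exp (- (v * h' s))"
      using True by (simp_all add: ev_fun_def s_def v_def)
    then show ?thesis
      using *[OF h(1), of h'] *[OF h(2), of h] close[OF s] eq by (simp add: abs_le_iff)
  qed
qed

lemma (in profile) tail_fun_ev_of:
  assumes "0 < s" shows "tail_fun (ev_of h) s 1 = h s"
proof -
  have "(exp (- s), exp (- 1 :: real)) \<in> unit_square" using assms by simp
  then have "ev_of h (exp (- s), exp (- 1)) = ev_fun h (exp (- s)) (exp (- 1))"
    unfolding ev_of_def restrict_apply by (simp only: if_True prod.case)
  also have "\<dots> = exp (- h s)" using assms by (simp add: ev_fun_def)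
  finally show ?thesis by (simp add: tail_fun_def)
qed

text \<open>For a closed set only interior points have to be excluded, and every Extreme Value
  copula comes from a profile; so it is enough to perturb profiles in the weighted distance of
  \<open>profile_ev_of_dist\<close>.\<close>

lemma nowhere_dense_in_ev_topologyI:
  assumes closed: "closedin ev_topology N"
    and dense: "\<And>h e. profile h \<Longrightarrow> ev_of h \<in> N \<Longrightarrow> 0 < e \<Longrightarrow>
      \<exists>h'. profile h' \<and> (\<forall>s>0. \<bar>h s - h' s\<bar> \<le> e * max 1 s) \<and> ev_of h' \<notin> N"
  shows "nowhere_dense_in ev_topology N"
proof -
  have "ev_topology interior_of N = {}"
  proof (rule ccontr)
    let ?W = "ev_topology interior_of N"
    assume "?W \<noteq> {}"
    then obtain C where C: "C \<in> ?W" by blast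
    have CN: "C \<in> N" by (rule subsetD[OF interior_of_subset C])
    then have "C \<in> ev_copulas" using closedin_subset[OF closed] by auto
    then obtain h where h: "profile h" "C = ev_of h" by (rule ev_copulasE)
    obtain r where r: "0 < r" "\<And>C'. C' \<in> ev_copulas \<Longrightarrow> (\<And>z. z \<in> unit_square \<Longrightarrow> \<bar>C z - C' z\<bar> \<le> r) \<Longrightarrow> C' \<in> ?W"
      by (rule openin_ev_topologyE[OF openin_interior_of C]) blast
    obtain h' where h': "profile h'" "\<forall>s>0. \<bar>h s - h' s\<bar> \<le> r * max 1 s" "ev_of h' \<notin> N"
      using dense[OF h(1) _ r(1)] CN h(2) by blast
    have "ev_of h' \<in> ?W"
    proof (rule r(2))
      show "ev_of h' \<in> ev_copulas" using h'(1) by (rule profile.ev_of_in_ev_copulas)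
      fix z assume "z \<in> unit_square"
      then show "\<bar>C z - ev_of h' z\<bar> \<le> r"
        unfolding h(2) by (intro profile_ev_of_dist[OF h(1) h'(1)]) (use h'(2) r(1) in auto)
    qed
    then show False using h'(3) subsetD[OF interior_of_subset] by metis
  qed
  then show ?thesis
    using closedin_subset[OF closed] closure_of_closedin[OF closed] unfolding nowhere_dense_in_def by simp
qed

lemma closedin_le_functional:
  assumes "continuous_map ev_topology euclideanreal f" "continuous_map ev_topology euclideanreal g"
  shows "closedin ev_topology {C \<in> ev_copulas. f C \<le> g C}"
proof -
  have "continuous_map ev_topology euclideanreal (\<lambda>C. f C - g C)"
    using assms by (intro continuous_map_diff)
  then have "closedin ev_topology {C \<in> topspace ev_topology. f C - g C \<in> {..0}}"
    by (rule closedin_continuous_map_preimage) simp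
  then show ?thesis by simp
qed

section \<open>Exceptional sets\<close>

lemma convex_on_supporting_lines:
  fixes f :: "real \<Rightarrow> real"
  assumes "convex C" "\<And>x. x \<in> C \<Longrightarrow> \<exists>d. \<forall>y\<in>C. d * (y - x) \<le> f y - f x"
  shows "convex_on C f"
proof -
  obtain d where "\<And>x y. x \<in> C \<Longrightarrow> y \<in> C \<Longrightarrow> d x * (y - x) \<le> f y - f x"
    using assms(2) by metis
  then show ?thesis using pos_convex_function[OF assms(1)] by metis
qed

lemma profile_one_plus: "profile (\<lambda>s. 1 + s)"
  by (unfold_locales) (auto intro!: convex_on_supporting_lines exI[of _ 1])

lemma profile_mix:
  assumes "profile h" "profile g" "0 \<le> a" "a \<le> 1"
  shows "profile (\<lambda>s. (1 - a) * h s + a * g s)"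
proof
  show "convex_on {0<..} (\<lambda>s. (1 - a) * h s + a * g s)"
    using assms profile.convex by (intro convex_on_add convex_on_cmul) auto
  fix s :: real assume s: "0 < s"
  have *: "(1 - a) * c + a * c = c" for c by (simp add: algebra_simps)
  show "1 \<le> (1 - a) * h s + a * g s" "s \<le> (1 - a) * h s + a * g s"
    using add_mono[OF mult_left_mono[of 1 "h s" "1 - a"] mult_left_mono[of 1 "g s" a]]
      add_mono[OF mult_left_mono[of s "h s" "1 - a"] mult_left_mono[of s "g s" a]]
      assms profile.ge_one[OF assms(1) s] profile.ge_one[OF assms(2) s]
      profile.ge_id[OF assms(1) s] profile.ge_id[OF assms(2) s] *[of 1] *[of s] by simp_all
  show "(1 - a) * h s + a * g s \<le> 1 + s"
    using add_mono[OF mult_left_mono[of "h s" "1 + s" "1 - a"] mult_left_mono[of "g s" "1 + s" a]]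
      assms profile.le_succ[OF assms(1) s] profile.le_succ[OF assms(2) s] *[of "1 + s"] by simp
qed

lemma profile_diff_le_one:
  assumes "profile h" "profile g" "0 < s" shows "\<bar>h s - g s\<bar> \<le> 1"
  using assms profile.ge_one[of h s] profile.ge_one[of g s] profile.ge_id[of h s] profile.ge_id[of g s]
    profile.le_succ[of h s] profile.le_succ[of g s] by auto

lemma profile_mix_dist:
  assumes "profile h" "profile g" "0 \<le> a" "0 < s"
  shows "\<bar>h s - ((1 - a) * h s + a * g s)\<bar> \<le> a * max 1 s"
proof -
  have "h s - ((1 - a) * h s + a * g s) = a * (h s - g s)" by (simp add: algebra_simps)
  then have "\<bar>h s - ((1 - a) * h s + a * g s)\<bar> = a * \<bar>h s - g s\<bar>" using assms by (simp add: abs_mult)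
  also have "\<dots> \<le> a * max 1 s" using assms profile_diff_le_one[of h g s] by (intro mult_left_mono) auto
  finally show ?thesis .
qed

text \<open>At \<open>p\<close> the upper bound \<open>1 + p\<close> lies strictly above
  \<open>max 1 p\<close>, so mixing in any positive amount of \<open>1 + s\<close> leaves the
  set.\<close>

lemma nowhere_dense_touching:
  assumes p: "0 < p" "max 1 p = b"
  shows "nowhere_dense_in ev_topology {C \<in> ev_copulas. tail_fun C p 1 \<le> b}"
proof (rule nowhere_dense_in_ev_topologyI)
  show "closedin ev_topology {C \<in> ev_copulas. tail_fun C p 1 \<le> b}"
    using p by (intro closedin_le_functional continuous_map_tail_fun) auto
  fix h e assume h: "profile h" and e: "0 < (e::real)"
  define a where "a = min e 1"
  have a: "0 < a" "a \<le> 1" "a \<le> e" using e by (auto simp: a_def)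
  let ?g = "\<lambda>s. (1 - a) * h s + a * (1 + s)"
  have g: "profile ?g" using a by (intro profile_mix h profile_one_plus) auto
  have "b \<le> h p" using p profile.ge_one[OF h p(1)] profile.ge_id[OF h p(1)] by auto
  then have "(1 - a) * b \<le> (1 - a) * h p" using a by (intro mult_left_mono) auto
  moreover have "a * b < a * (1 + p)" using a p by auto
  ultimately have "b < ?g p" by (simp add: algebra_simps)
  then have "ev_of ?g \<notin> {C \<in> ev_copulas. tail_fun C p 1 \<le> b}"
    using profile.tail_fun_ev_of[OF g p(1)] by simp
  moreover have "\<forall>s>0. \<bar>h s - ?g s\<bar> \<le> e * max 1 s"
  proof (intro allI impI)
    fix s :: real assume "0 < s"
    then have "\<bar>h s - ?g s\<bar> \<le> a * max 1 s" using a by (intro profile_mix_dist h profile_one_plus) auto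
    also have "\<dots> \<le> e * max 1 s" using a by (intro mult_right_mono) auto
    finally show "\<bar>h s - ?g s\<bar> \<le> e * max 1 s" .
  qed
  ultimately show "\<exists>h'. profile h' \<and> (\<forall>s>0. \<bar>h s - h' s\<bar> \<le> e * max 1 s) \<and> ev_of h' \<notin> {C \<in> ev_copulas. tail_fun C p 1 \<le> b}"
    using g by blast
qed

section \<open>Jumps of the right derivative\<close>

definition slope_jump :: "(real \<Rightarrow> real) \<Rightarrow> real \<Rightarrow> real \<Rightarrow> real" where
  "slope_jump h p r = (h (p + 2 * r) - h (p + r)) / r - (h (p - r) - h (p - 2 * r)) / r"

lemma continuous_map_slope_jump:
  assumes "0 \<le> p - 2 * r" "0 < r"
  shows "continuous_map ev_topology euclideanreal (\<lambda>C. slope_jump (\<lambda>s. tail_fun C s 1) p r)"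
  unfolding slope_jump_def using assms
  by (intro continuous_map_diff continuous_map_real_divide continuous_map_tail_fun) auto

lemma (in profile) slope_jump_tail_fun:
  assumes "0 < p - 2 * r" "0 < r"
  shows "slope_jump (\<lambda>s. tail_fun (ev_of h) s 1) p r = slope_jump h p r"
  unfolding slope_jump_def using assms by (simp add: tail_fun_ev_of)

text \<open>\<open>slope_jump\<close> compares the chord slopes on \<open>[p + r, p + 2 r]\<close>
  and \<open>[p - 2 r, p - r]\<close>, a continuous substitute for the jump of
  \<open>rderiv h\<close> at \<open>p\<close>. Convexity traps it between the increases of
  \<open>rderiv h\<close> over radius \<open>r\<close> and over radius \<open>2 r\<close>: the lower
  bound serves to exclude jumps, the upper bound to estimate and locate them.\<close>

lemma (in profile) slope_jump_bounds:
  assumes "0 < p - 2 * r" "0 < r"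
  shows "rderiv h (p + r) - rderiv h (p - r) \<le> slope_jump h p r"
    and "slope_jump h p r \<le> rderiv h (p + 2 * r) - rderiv h (p - 2 * r)"
  using assms rderiv_le_slope[of "p + r" "p + 2 * r"] slope_le_rderiv[of "p - 2 * r" "p - r"]
    slope_le_rderiv[of "p + r" "p + 2 * r"] rderiv_le_slope[of "p - 2 * r" "p - r"]
  by (simp_all add: slope_jump_def)

text \<open>The factors \<open>a j\<close> have mean \<open>1\<close>, so the bounds
  \<open>s\<close> and \<open>1 + s\<close> reproduce themselves under averaging. Averages of the
  scaled subgradients of \<open>h\<close> are subgradients of the average.\<close>

lemma profile_average:
  fixes a :: "nat \<Rightarrow> real"
  assumes h: "profile h" and M: "0 < M" and a: "\<And>j. j < M \<Longrightarrow> 0 < a j" and sum: "(\<Sum>j<M. a j) = real M"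
  shows "profile (\<lambda>s. (\<Sum>j<M. h (a j * s)) / real M)"
proof
  interpret profile h by fact
  show "convex_on {0<..} (\<lambda>s. (\<Sum>j<M. h (a j * s)) / real M)"
  proof (rule convex_on_supporting_lines)
    fix x :: real assume x: "x \<in> {0<..}"
    have line: "rderiv h u * (t - u) \<le> h t - h u" if "0 < u" "0 < t" for u t
    proof (cases u t rule: linorder_cases)
      case less then show ?thesis using rderiv_le_slope[of u t] that by (simp add: pos_le_divide_eq)
    next
      case greater then show ?thesis using slope_le_rderiv[of t u] that by (simp add: pos_divide_le_eq algebra_simps)
    qed simp
    let ?d = "(\<Sum>j<M. rderiv h (a j * x) * a j) / real M"
    have "?d * (y - x) \<le> (\<Sum>j<M. h (a j * y)) / real M - (\<Sum>j<M. h (a j * x)) / real M" if y: "y \<in> {0<..}" for y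
    proof -
      have "(\<Sum>j<M. rderiv h (a j * x) * (a j * y - a j * x)) \<le> (\<Sum>j<M. h (a j * y) - h (a j * x))"
        using a x y by (intro sum_mono line) auto
      moreover have "(\<Sum>j<M. rderiv h (a j * x) * (a j * y - a j * x)) = (\<Sum>j<M. rderiv h (a j * x) * a j) * (y - x)"
        unfolding sum_distrib_right by (rule sum.cong) (auto simp: algebra_simps)
      ultimately show ?thesis using M by (simp add: sum_subtractf divide_right_mono flip: diff_divide_distrib)
    qed
    then show "\<exists>d. \<forall>y\<in>{0<..}. d * (y - x) \<le> (\<Sum>j<M. h (a j * y)) / real M - (\<Sum>j<M. h (a j * x)) / real M" by blast
  qed simp
  fix s :: real assume s: "0 < s"
  have as: "0 < a j * s" if "j < M" for j using a[OF that] s by simp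
  have ss: "(\<Sum>j<M. a j * s) = M * s" using sum by (simp flip: sum_distrib_right)
  have "(\<Sum>j<M. 1) \<le> (\<Sum>j<M. h (a j * s))" using ge_one as by (intro sum_mono) auto
  then show "1 \<le> (\<Sum>j<M. h (a j * s)) / real M" using M by (simp add: field_simps)
  have "(\<Sum>j<M. a j * s) \<le> (\<Sum>j<M. h (a j * s))" using ge_id as by (intro sum_mono) auto
  then show "s \<le> (\<Sum>j<M. h (a j * s)) / real M" using M ss by (simp add: field_simps)
  have "(\<Sum>j<M. h (a j * s)) \<le> (\<Sum>j<M. 1 + a j * s)" using le_succ as by (intro sum_mono) auto
  then show "(\<Sum>j<M. h (a j * s)) / real M \<le> 1 + s" using M ss by (simp add: sum.distrib field_simps)
qed

text \<open>The intervals from \<open>c j\<close> to \<open>b j\<close> come in order, and the gaps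
  between them contribute nonnegatively to the total increase of \<open>D\<close>.\<close>

lemma sum_disjoint_increments_le:
  fixes D :: "real \<Rightarrow> real"
  assumes mono: "\<And>u v. 0 < u \<Longrightarrow> u \<le> v \<Longrightarrow> D u \<le> D v"
    and "\<And>j. j < M \<Longrightarrow> 0 < c (Suc j) \<and> b j \<le> c (Suc j)" "\<And>j. j \<le> M \<Longrightarrow> 0 < b j"
  shows "(\<Sum>j<Suc M. D (b j) - D (c j)) \<le> D (b M) - D (c (0::nat))"
  using assms(2,3)
proof (induction M)
  case (Suc M)
  have "(\<Sum>j<Suc M. D (b j) - D (c j)) \<le> D (b M) - D (c 0)" using Suc by auto
  moreover have "D (b M) \<le> D (c (Suc M))" using Suc.prems mono by auto
  ultimately show ?case by simp
qed simp

text \<open>The grid of mesh \<open>1 / m\<close> on \<open>[1 / (n + 1), n + 1]\<close> replaces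
  the uncountably many possible jump points: for each \<open>m\<close> the choice of
  \<open>i\<close> is finite, so the set is an intersection of finite unions of closed sets. The
  bound \<open>m > 4 * Suc n\<close> keeps the arguments of \<open>slope_jump\<close>
  positive.\<close>

definition jump_set :: "nat \<Rightarrow> nat \<Rightarrow> (real \<times> real \<Rightarrow> real) set" where
  "jump_set n k = {C \<in> ev_copulas. \<forall>m>4 * Suc n. \<exists>i\<le>m * Suc n.
     1 / real (Suc n) \<le> real i / real m \<and>
     1 / real (Suc k) \<le> slope_jump (\<lambda>s. tail_fun C s 1) (real i / real m) (1 / real m)}"

lemma jump_set_arg:
  assumes "m > 4 * Suc n" "1 / real (Suc n) \<le> p" shows "0 < p - 2 * (1 / real m)"
proof -
  have "2 / real m < 1 / real (Suc n)" using assms(1) by (simp add: field_simps)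
  then show ?thesis using assms(2) by simp
qed

lemma closedin_jump_set: "closedin ev_topology (jump_set n k)"
proof -
  let ?S = "\<lambda>m i. {C \<in> ev_copulas. 1 / real (Suc k) \<le> slope_jump (\<lambda>s. tail_fun C s 1) (real i / real m) (1 / real m)}"
  let ?I = "\<lambda>m. {i. i \<le> m * Suc n \<and> 1 / real (Suc n) \<le> real i / real m}"
  have eq: "jump_set n k = (\<Inter>m\<in>{4 * Suc n<..}. \<Union>i\<in>?I m. ?S m i)"
  proof (intro equalityI subsetI)
    fix C assume C: "C \<in> (\<Inter>m\<in>{4 * Suc n<..}. \<Union>i\<in>?I m. ?S m i)"
    have "Suc (4 * Suc n) \<in> {4 * Suc n<..}" by simp
    then have "C \<in> (\<Union>i\<in>?I (Suc (4 * Suc n)). ?S (Suc (4 * Suc n)) i)" using C by blast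
    then have "C \<in> ev_copulas" by blast
    moreover have "\<exists>i\<le>m * Suc n. 1 / real (Suc n) \<le> real i / real m \<and>
        1 / real (Suc k) \<le> slope_jump (\<lambda>s. tail_fun C s 1) (real i / real m) (1 / real m)" if "4 * Suc n < m" for m
      using C that by blast
    ultimately show "C \<in> jump_set n k" unfolding jump_set_def by blast
  next
    fix C assume "C \<in> jump_set n k"
    then show "C \<in> (\<Inter>m\<in>{4 * Suc n<..}. \<Union>i\<in>?I m. ?S m i)" unfolding jump_set_def by blast
  qed
  show ?thesis
    unfolding eq
  proof (rule closedin_INT)
    fix m assume m: "m \<in> {4 * Suc n<..}"
    show "closedin ev_topology (\<Union>i\<in>?I m. ?S m i)"
    proof (rule closedin_Union)
      fix T assume "T \<in> ?S m ` ?I m"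
      then obtain i where i: "i \<in> ?I m" "T = ?S m i" by blast
      then have "0 < real i / real m - 2 * (1 / real m)" using m by (intro jump_set_arg) auto
      then show "closedin ev_topology T"
        unfolding i(2) using m by (intro closedin_le_functional continuous_map_slope_jump) auto
    qed simp
  qed auto
qed

text \<open>The slope jump of the average at \<open>p\<close> averages \<open>a j\<close> times the
  slope jumps of \<open>h\<close> at \<open>a j * p\<close> with radius \<open>a j * r\<close>. By
  \<open>sep\<close> the intervals involved do not overlap, so they share the total increase of
  \<open>rderiv h\<close>, which is at most \<open>1\<close>; the factor \<open>2\<close> is the
  bound on \<open>a j\<close>.\<close>

lemma (in profile) slope_jump_average_le:
  fixes a :: "nat \<Rightarrow> real"
  assumes M: "0 < M" and r: "0 < r" "0 < p - 2 * r"
    and a: "\<And>j. j < M \<Longrightarrow> 0 < a j \<and> a j \<le> 2"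
    and sep: "\<And>j. Suc j < M \<Longrightarrow> a j * (p + 2 * r) \<le> a (Suc j) * (p - 2 * r)"
  shows "slope_jump (\<lambda>s. (\<Sum>j<M. h (a j * s)) / real M) p r \<le> 2 / real M"
proof -
  let ?D = "\<lambda>j. rderiv h (a j * (p + 2 * r)) - rderiv h (a j * (p - 2 * r))"
  have pos: "0 < a j * (p + 2 * r)" "0 < a j * (p - 2 * r)" if "j < M" for j
    using a[OF that] r by auto
  have each: "(h (a j * (p + 2 * r)) - h (a j * (p + r))) - (h (a j * (p - r)) - h (a j * (p - 2 * r))) \<le> 2 * r * ?D j"
    if j: "j < M" for j
  proof -
    have aj: "0 < a j" "a j \<le> 2" using a[OF j] by auto
    define c where "c = a j * r"
    have c: "0 < c" using aj r by (simp add: c_def)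
    have args: "a j * (p + 2 * r) = a j * p + 2 * c" "a j * (p - 2 * r) = a j * p - 2 * c"
      "a j * (p + r) = a j * p + c" "a j * (p - r) = a j * p - c" by (simp_all add: c_def algebra_simps)
    have "(h (a j * (p + 2 * r)) - h (a j * (p + r))) - (h (a j * (p - r)) - h (a j * (p - 2 * r)))
        = c * slope_jump h (a j * p) c"
      unfolding args slope_jump_def using c by (simp add: field_simps)
    also have "\<dots> \<le> c * ?D j"
      unfolding args using c pos(2)[OF j] by (intro mult_left_mono slope_jump_bounds) (auto simp: args)
    also have "\<dots> \<le> 2 * r * ?D j"
      using aj r pos[OF j] by (intro mult_right_mono) (auto simp: c_def intro!: rderiv_mono mult_left_mono)
    finally show ?thesis .
  qed
  have "(\<Sum>j<M. ?D j) \<le> 1"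
  proof -
    obtain M' where M': "M = Suc M'" using M by (cases M) auto
    have "(\<Sum>j<Suc M'. ?D j) \<le> rderiv h (a M' * (p + 2 * r)) - rderiv h (a 0 * (p - 2 * r))"
      by (rule sum_disjoint_increments_le) (use pos sep M' rderiv_mono in auto)
    also have "\<dots> \<le> 1" using rderiv_le_one[OF pos(1)[of M']] rderiv_nonneg[OF pos(2)[of 0]] M' by simp
    finally show ?thesis unfolding M' .
  qed
  then have D: "2 * r * (\<Sum>j<M. ?D j) \<le> 2 * r" using r by simp
  have "(\<Sum>j<M. (h (a j * (p + 2 * r)) - h (a j * (p + r))) - (h (a j * (p - r)) - h (a j * (p - 2 * r)))) \<le> 2 * r * (\<Sum>j<M. ?D j)"
    unfolding sum_distrib_left by (rule sum_mono) (use each in auto)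
  from order_trans[OF this D] have "(\<Sum>j<M. (h (a j * (p + 2 * r)) - h (a j * (p + r))) - (h (a j * (p - r)) - h (a j * (p - 2 * r)))) / (r * M) \<le> 2 * r / (r * M)"
    using r by (intro divide_right_mono) auto
  moreover have "slope_jump (\<lambda>s. (\<Sum>j<M. h (a j * s)) / real M) p r
    = (\<Sum>j<M. (h (a j * (p + 2 * r)) - h (a j * (p + r))) - (h (a j * (p - r)) - h (a j * (p - 2 * r)))) / (r * M)"
    unfolding slope_jump_def sum_subtractf using r M by (simp add: field_simps)
  ultimately show ?thesis using r by simp
qed

lemma nowhere_dense_jump_set: "nowhere_dense_in ev_topology (jump_set n k)"
proof (rule nowhere_dense_in_ev_topologyI[OF closedin_jump_set])
  fix h e assume h: "profile h" and e: "0 < (e::real)"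
  interpret profile h by fact
  define \<delta> where "\<delta> = min e (1 / 2)"
  have \<delta>: "0 < \<delta>" "\<delta> \<le> e" "\<delta> \<le> 1 / 2" using e by (auto simp: \<delta>_def)
  \<comment> \<open>Large enough that the bound \<open>2 / real M\<close> of
    \<open>slope_jump_average_le\<close> drops below \<open>1 / real (Suc k)\<close>.\<close>
  define M where "M = 2 * Suc k + 1"
  have M: "0 < M" by (simp add: M_def)
  \<comment> \<open>Equally spaced factors, symmetric about \<open>1\<close> and hence with mean
    \<open>1\<close>. All lie within \<open>\<delta>\<close> of \<open>1\<close>, and neighbours are
    \<open>2 * \<delta> / real M\<close> apart.\<close>
  define a where "a j = 1 + \<delta> * (2 * real j + 1 - real M) / real M" for j
  have a_close: "\<bar>a j - 1\<bar> \<le> \<delta>" if "j < M" for j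
  proof -
    define X where "X = 2 * real j + 1 - real M"
    have "\<bar>X\<bar> \<le> real M" using that by (auto simp: X_def)
    then have "\<delta> * \<bar>X\<bar> \<le> \<delta> * real M" using \<delta> by (intro mult_left_mono) auto
    moreover have "a j - 1 = \<delta> * X / real M" by (simp add: a_def X_def)
    then have "\<bar>a j - 1\<bar> = \<delta> * \<bar>X\<bar> / real M" using \<delta> by (simp add: abs_mult)
    ultimately show ?thesis using M by (simp add: pos_divide_le_eq)
  qed
  have a: "0 < a j" "a j \<le> 2" if "j < M" for j using a_close[OF that] \<delta> by (auto simp: abs_le_iff)
  have "(\<Sum>j<m. 2 * real j + 1 - real M) = real m * (real m - real M)" for m
    by (induction m) (auto simp: algebra_simps)
  then have sum: "(\<Sum>j<M. a j) = real M"
    by (simp add: a_def sum.distrib flip: sum_divide_distrib sum_distrib_left)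
  let ?g = "\<lambda>s. (\<Sum>j<M. h (a j * s)) / real M"
  have g: "profile ?g" using profile_average[OF h M a(1) sum] .
  have close: "\<bar>h s - ?g s\<bar> \<le> e * max 1 s" if s: "0 < s" for s
  proof -
    have "\<bar>\<Sum>j<M. h s - h (a j * s)\<bar> \<le> (\<Sum>j<M. \<delta> * s)"
    proof (rule order_trans[OF sum_abs sum_mono])
      fix j assume "j \<in> {..<M}"
      then have j: "j < M" by simp
      have "\<bar>h s - h (a j * s)\<bar> \<le> \<bar>s - a j * s\<bar>" using a(1)[OF j] s by (intro abs_diff_le) auto
      also have "\<dots> = \<bar>a j - 1\<bar> * s" 
      proof -
        have "s - a j * s = (1 - a j) * s" by (simp add: algebra_simps)
        then show ?thesis using s by (simp add: abs_mult abs_minus_commute)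
      qed
      also have "\<dots> \<le> \<delta> * s" using a_close[OF j] s by (intro mult_right_mono) auto
      finally show "\<bar>h s - h (a j * s)\<bar> \<le> \<delta> * s" .
    qed
    moreover have "h s - ?g s = (\<Sum>j<M. h s - h (a j * s)) / real M"
      using M by (simp add: sum_subtractf field_simps)
    ultimately have "\<bar>h s - ?g s\<bar> \<le> \<delta> * s" using M by (simp add: field_simps)
    also have "\<dots> \<le> e * max 1 s" using \<delta> s by (intro mult_mono) auto
    finally show ?thesis .
  qed
  have "ev_of ?g \<notin> jump_set n k"
  proof
    assume "ev_of ?g \<in> jump_set n k"
    \<comment> \<open>For \<open>p \<ge> 1 / real (Suc n)\<close>, neighbouring points
      \<open>a j * p\<close> are at least \<open>2 * \<delta> * p / real M\<close> apart, and the
      radii of their intervals add up to at most \<open>8 / real m\<close>; this mesh makes the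
      former at least as large.\<close>
    define m where "m = nat \<lceil>4 * real M * real (Suc n) / \<delta>\<rceil> + 4 * Suc n + 1"
    have m: "4 * Suc n < m" "4 * real M * real (Suc n) / \<delta> \<le> real m"
      by (simp_all add: m_def) linarith
    obtain i where i: "1 / real (Suc n) \<le> real i / real m"
      "1 / real (Suc k) \<le> slope_jump (\<lambda>s. tail_fun (ev_of ?g) s 1) (real i / real m) (1 / real m)"
      using \<open>ev_of ?g \<in> jump_set n k\<close> m(1) unfolding jump_set_def by blast
    let ?p = "real i / real m" and ?r = "1 / real m"
    have r: "0 < ?r" "0 < ?p - 2 * ?r" using m(1) jump_set_arg[OF m(1) i(1)] by auto
    have "slope_jump ?g ?p ?r \<le> 2 / real M"
    proof (rule slope_jump_average_le[OF M r])
      show "0 < a j \<and> a j \<le> 2" if "j < M" for j using a that by blast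
      fix j assume j: "Suc j < M"
      have "4 * real M * real (Suc n) \<le> \<delta> * real m" using m(2) \<delta> by (simp add: field_simps)
      then have "4 * ?r * real M \<le> \<delta> * (1 / real (Suc n))" using m(1) by (simp add: field_simps)
      also have "\<dots> \<le> \<delta> * ?p" using i(1) \<delta> by (intro mult_left_mono) auto
      finally have *: "4 * ?r * real M \<le> \<delta> * ?p" .
      have aa: "a j + a (Suc j) \<le> 4" using a[of j] a[of "Suc j"] j by auto
      have "2 * ?r * (a j + a (Suc j)) \<le> 2 * ?r * 4" using aa r by (intro mult_left_mono) auto
      also have "\<dots> = 2 * (4 * ?r * real M) / real M" using M by simp
      also have "\<dots> \<le> 2 * (\<delta> * ?p) / real M" using * by (intro divide_right_mono mult_left_mono) auto
      also have "\<dots> = (a (Suc j) - a j) * ?p" by (simp add: a_def field_simps) (simp add: algebra_simps add_divide_distrib diff_divide_distrib)?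
      finally show "a j * (?p + 2 * ?r) \<le> a (Suc j) * (?p - 2 * ?r)"
        by (simp add: algebra_simps add_divide_distrib)
    qed
    moreover have "2 / real M < 1 / real (Suc k)" by (simp add: M_def field_simps)
    ultimately show False
      using i(2) profile.slope_jump_tail_fun[OF g r(2) r(1)] by simp
  qed
  then show "\<exists>h'. profile h' \<and> (\<forall>s>0. \<bar>h s - h' s\<bar> \<le> e * max 1 s) \<and> ev_of h' \<notin> jump_set n k"
    using g close by blast
qed

text \<open>One mesh without large slope jumps keeps the increase of \<open>rderiv h\<close> over
  \<open>[p - r, p + r]\<close> below \<open>e\<close>, where \<open>p\<close> is the grid point
  just below \<open>s\<close> and \<open>r\<close> is the mesh. As \<open>p \<le> s < p + r\<close>,
  this is a neighbourhood of \<open>s\<close>.\<close>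

lemma (in profile) differentiable_if_no_jumps:
  assumes nj: "\<And>n k. ev_of h \<notin> jump_set n k" and s: "0 < s"
  shows "(rderiv h \<longlongrightarrow> rderiv h s) (at s)"
proof (rule tendstoI)
  fix e :: real assume "0 < e"
  then obtain k where k: "1 / real (Suc k) < e" using nat_approx_posE by blast
  \<comment> \<open>The term \<open>2 / s\<close> yields \<open>s > 2 / real (Suc n)\<close>:
    rounding \<open>s\<close> down to the grid may cost up to \<open>1 / real (Suc n)\<close>, and
    that much still remains.\<close>
  obtain n0 where n0: "2 / s + s < real n0" using reals_Archimedean2 by blast
  define n where "n = n0"
  have "0 < 2 / s" using s by simp
  then have n: "2 / s < real (Suc n)" "s < real (Suc n)" using n0 s unfolding n_def of_nat_Suc by linarith+
  obtain m where m: "4 * Suc n < m"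
    "\<And>i. i \<le> m * Suc n \<Longrightarrow> 1 / real (Suc n) \<le> real i / real m \<Longrightarrow>
      \<not> 1 / real (Suc k) \<le> slope_jump (\<lambda>s. tail_fun (ev_of h) s 1) (real i / real m) (1 / real m)"
    using nj[of n k] ev_of_in_ev_copulas unfolding jump_set_def by blast
  define i where "i = nat \<lfloor>real m * s\<rfloor>"
  have i: "real i \<le> real m * s" "real m * s < real i + 1" using s by (simp_all add: i_def)
  let ?p = "real i / real m" and ?r = "1 / real m"
  have m0: "0 < real m" using m(1) by simp
  have ps: "?p \<le> s" "s < ?p + ?r" using i m0 by (simp_all add: field_simps)
  have "?p \<ge> 1 / real (Suc n)"
  proof -
    have "2 < s * real (Suc n)" using n(1) s by (simp add: field_simps)
    then have "2 / real (Suc n) < s" by (simp add: field_simps)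
    moreover have "?r \<le> 1 / real (Suc n)" using m(1) by (simp add: field_simps)
    ultimately show ?thesis using ps by simp
  qed
  moreover have "i \<le> m * Suc n"
  proof -
    have "real i \<le> real m * real (Suc n)" using i(1) mult_left_mono[of s "real (Suc n)" "real m"] n(2) by simp
    then show ?thesis by (simp only: of_nat_mult[symmetric] of_nat_le_iff)
  qed
  ultimately have "\<not> 1 / real (Suc k) \<le> slope_jump (\<lambda>s. tail_fun (ev_of h) s 1) ?p ?r" and r: "0 < ?p - 2 * ?r"
    using m(2) jump_set_arg[OF m(1)] by auto
  then have *: "rderiv h (?p + ?r) - rderiv h (?p - ?r) < e"
    using slope_jump_bounds(1)[OF r] slope_jump_tail_fun[OF r] m0 k by simp
  have "\<forall>\<^sub>F t in at s. t \<in> {?p - ?r<..<?p + ?r}"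
  proof (rule eventually_at_in_open')
    have "0 < ?r" using m0 by simp
    then show "s \<in> {?p - ?r<..<?p + ?r}" unfolding greaterThanLessThan_iff using ps by linarith
  qed simp
  then show "\<forall>\<^sub>F t in at s. dist (rderiv h t) (rderiv h s) < e"
  proof eventually_elim
    case (elim t)
    have "0 < ?r" using m0 by simp
    then have lo: "0 < ?p - ?r" "?p - ?r \<le> s" "s \<le> ?p + ?r" using r ps by linarith+
    have t: "?p - ?r \<le> t" "t \<le> ?p + ?r" using elim unfolding greaterThanLessThan_iff by linarith+
    have "0 < t" using lo(1) t(1) by linarith
    have "rderiv h (?p - ?r) \<le> rderiv h t" "rderiv h t \<le> rderiv h (?p + ?r)"
      "rderiv h (?p - ?r) \<le> rderiv h s" "rderiv h s \<le> rderiv h (?p + ?r)"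
      using rderiv_mono[OF lo(1) t(1)] rderiv_mono[OF \<open>0 < t\<close> t(2)]
        rderiv_mono[OF lo(1,2)] rderiv_mono[OF s lo(3)] by auto
    then show ?case using * by (simp add: dist_real_def abs_less_iff)
  qed
qed

text \<open>Its increment from \<open>1\<close> to \<open>2\<close> is \<open>1 / 2\<close>; mixing
  in a small amount of it brings the increment of any profile below \<open>1\<close>.\<close>

lemma profile_max_line: "profile (\<lambda>s. max (1 + s / 2) s)"
proof
  show "convex_on {0<..} (\<lambda>s::real. max (1 + s / 2) s)"
  proof (rule convex_on_supporting_lines)
    fix x :: real
    show "\<exists>d. \<forall>y\<in>{0<..}. d * (y - x) \<le> max (1 + y / 2) y - max (1 + x / 2) x"
      by (rule exI[of _ "if x < 2 then 1 / 2 else 1"]) (auto simp: max_def)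
  qed simp
qed auto

text \<open>Between grid points both functions increase by at most one mesh width. Below the first
  grid point the bounds \<open>1\<close> and \<open>1 + s\<close> suffice, and beyond
  \<open>m\<close> two profiles differ by at most \<open>1\<close>, which the weight
  \<open>max 1 s\<close> absorbs. So a grid reaching up to \<open>m\<close> is long enough.\<close>

lemma profile_grid_dist:
  assumes h: "profile h" and g: "profile g" and m: "0 < m"
    and grid: "\<And>i. 1 \<le> i \<Longrightarrow> i \<le> m * m \<Longrightarrow> h (real i / real m) = g (real i / real m)"
    and s: "0 < s"
  shows "\<bar>h s - g s\<bar> \<le> 1 / real m * max 1 s"
proof (cases "s \<le> real m")
  case True
  define i where "i = nat \<lfloor>real m * s\<rfloor>"
  let ?p = "real i / real m"
  have i: "real i \<le> real m * s" "real m * s < real i + 1" using s by (simp_all add: i_def)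
  have ps: "?p \<le> s" "s \<le> ?p + 1 / real m" using i m by (simp_all add: field_simps)
  have "\<bar>h s - g s\<bar> \<le> 1 / real m"
  proof (cases "i = 0")
    case True
    then have "s \<le> 1 / real m" using ps by simp
    then show ?thesis
      using profile.ge_one[OF h s] profile.ge_one[OF g s] profile.le_succ[OF h s] profile.le_succ[OF g s] by (simp add: abs_le_iff)
  next
    case False
    have "real m * s \<le> real m * real m" using \<open>s \<le> real m\<close> by (intro mult_left_mono) auto
    then have "real i \<le> real (m * m)" using i(1) by simp
    then have "i \<le> m * m" by (simp only: of_nat_le_iff)
    then have eq: "h ?p = g ?p" using grid False by simp
    have p: "0 < ?p" using False m by simp
    show ?thesis
      using profile.mono[OF h p ps(1)] profile.mono[OF g p ps(1)] profile.lipschitz[OF h p ps(1)]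
        profile.lipschitz[OF g p ps(1)] eq ps by (simp add: abs_le_iff)
  qed
  also have "\<dots> \<le> 1 / real m * max 1 s" using m by (simp add: divide_right_mono)
  finally show ?thesis .
next
  case False
  then have "1 \<le> 1 / real m * s" using m by (simp add: field_simps)
  also have "\<dots> \<le> 1 / real m * max 1 s" using m by (intro mult_left_mono) auto
  finally show ?thesis using profile_diff_le_one[OF h g s] by simp
qed

section \<open>Piecewise linear interpolation of a profile\<close>

definition grid_slope :: "(real \<Rightarrow> real) \<Rightarrow> nat \<Rightarrow> nat \<Rightarrow> real" where
  "grid_slope h m i = (if i < m * m then real m * (h (real (Suc i) / real m) - h (real i / real m)) else 1)"

definition grid_line :: "(real \<Rightarrow> real) \<Rightarrow> nat \<Rightarrow> nat \<Rightarrow> real \<Rightarrow> real" where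
  "grid_line h m i s = h (real i / real m) + grid_slope h m i * (s - real i / real m)"

text \<open>Convexity is immediate for a maximum of lines; that it interpolates is shown afterwards.
  The constant \<open>1\<close> keeps it above \<open>1\<close> to the left of the grid. The last
  line has slope \<open>1\<close>, which makes the interpolant dominate \<open>s\<close> and brings
  its final slope up to \<open>1\<close>.\<close>

definition interpolant :: "(real \<Rightarrow> real) \<Rightarrow> nat \<Rightarrow> real \<Rightarrow> real" where
  "interpolant h m s = Max (insert 1 ((\<lambda>i. grid_line h m i s) ` {1..m * m}))"

context profile
begin

context
  fixes m :: nat assumes m: "2 \<le> m"
begin

lemma grid_pos: "1 \<le> i \<Longrightarrow> 0 < real i / real m"
  using m by simp

lemma grid_step: "real (Suc i) / real m = real i / real m + 1 / real m"
  by (simp add: add_divide_distrib)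

lemma grid_slope_eq:
  "i < m * m \<Longrightarrow> grid_slope h m i = (h (real (Suc i) / real m) - h (real i / real m)) / (real (Suc i) / real m - real i / real m)"
proof -
  assume "i < m * m"
  moreover have "real (Suc i) / real m - real i / real m = 1 / real m" unfolding grid_step by simp
  ultimately show ?thesis by (simp add: grid_slope_def mult.commute)
qed

lemma grid_slope_bounds:
  assumes "1 \<le> i" shows "0 \<le> grid_slope h m i" "grid_slope h m i \<le> 1"
proof -
  have "0 \<le> grid_slope h m i \<and> grid_slope h m i \<le> 1"
  proof (cases "i < m * m")
    case True
    have lt: "0 < real (Suc i) / real m - real i / real m" unfolding grid_step using m by simp
    then have le: "real i / real m \<le> real (Suc i) / real m" by linarith
    show ?thesis
      using mono[OF grid_pos[OF assms] le] lipschitz[OF grid_pos[OF assms] le]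
      unfolding grid_slope_eq[OF True] divide_le_eq_1_pos[OF lt]
      by (intro conjI divide_nonneg_pos[OF _ lt]) (simp_all del: of_nat_Suc)
  qed (simp add: grid_slope_def)
  then show "0 \<le> grid_slope h m i" "grid_slope h m i \<le> 1" by auto
qed

text \<open>The line through two points of a convex graph lies below the graph outside the interval
  between them. For the last line, of slope \<open>1\<close>, the Lipschitz bound takes the place of
  convexity.\<close>

lemma grid_line_le_before:
  assumes i: "1 \<le> i" and s: "0 < s" "s \<le> real i / real m"
  shows "grid_line h m i s \<le> h s"
proof (cases "s = real i / real m")
  case False
  then have s': "s < real i / real m" using s by simp
  have "(h (real i / real m) - h s) / (real i / real m - s) \<le> grid_slope h m i"
  proof (cases "i < m * m")
    case True
    show ?thesis unfolding grid_slope_eq[OF True]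
      using s s' m by (intro slope_mono) (auto simp: divide_strict_right_mono)
  next
    case False
    then show ?thesis using lipschitz[OF s] s' by (simp add: grid_slope_def)
  qed
  then have "h (real i / real m) - h s \<le> grid_slope h m i * (real i / real m - s)"
    using s' by (simp add: pos_divide_le_eq)
  then show ?thesis by (simp add: grid_line_def algebra_simps)
qed (simp add: grid_line_def)

lemma grid_line_next:
  assumes "i < m * m" shows "grid_line h m i (real (Suc i) / real m) = h (real (Suc i) / real m)"
  unfolding grid_line_def grid_slope_eq[OF assms] using m by (simp add: grid_step)

lemma grid_line_le_after:
  assumes i: "1 \<le> i" "i < m * m" and s: "real (Suc i) / real m \<le> s"
  shows "grid_line h m i s \<le> h s"
proof (cases "s = real (Suc i) / real m")
  case True
  then show ?thesis using grid_line_next[OF i(2)] by simp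
next
  case False
  let ?q = "real (Suc i) / real m"
  have s': "?q < s" using s False by simp
  have "grid_slope h m i \<le> (h s - h ?q) / (s - ?q)"
    unfolding grid_slope_eq[OF i(2)] using s' m grid_pos[OF i(1)]
    by (intro slope_mono) (auto simp: divide_strict_right_mono)
  then have "grid_slope h m i * (s - ?q) \<le> h s - h ?q" using s' by (simp add: pos_le_divide_eq)
  moreover have "grid_line h m i s = h ?q + grid_slope h m i * (s - ?q)"
    using grid_line_next[OF i(2)] by (simp add: grid_line_def algebra_simps)
  ultimately show ?thesis by simp
qed

lemma grid_line_le_grid:
  assumes "i \<in> {1..m * m}" "j \<in> {1..m * m}"
  shows "grid_line h m i (real j / real m) \<le> h (real j / real m)"
proof (cases "j \<le> i")
  case True
  then show ?thesis using assms m by (intro grid_line_le_before grid_pos) (auto simp: divide_right_mono)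
next
  case False
  then show ?thesis using assms m by (intro grid_line_le_after) (auto simp: divide_right_mono)
qed

lemma grid_line_le_succ:
  assumes i: "1 \<le> i" and s: "0 < s" shows "grid_line h m i s \<le> 1 + s"
proof (cases "s \<le> real i / real m")
  case True
  then show ?thesis using grid_line_le_before[OF i s] le_succ[OF s] by simp
next
  case False
  then have "grid_slope h m i * (s - real i / real m) \<le> 1 * (s - real i / real m)"
    using grid_slope_bounds[OF i] by (intro mult_right_mono) auto
  then show ?thesis using le_succ[OF grid_pos[OF i]] by (simp add: grid_line_def)
qed

lemma grid_line_le_interpolant: "i \<in> {1..m * m} \<Longrightarrow> grid_line h m i s \<le> interpolant h m s"
  unfolding interpolant_def by (intro Max_ge) auto

lemma one_le_interpolant: "1 \<le> interpolant h m s"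
  unfolding interpolant_def by (intro Max_ge) auto

lemma interpolant_leI:
  assumes "1 \<le> c" "\<And>i. i \<in> {1..m * m} \<Longrightarrow> grid_line h m i s \<le> c"
  shows "interpolant h m s \<le> c"
  unfolding interpolant_def using assms by (subst Max_le_iff) auto

lemma interpolant_cases:
  obtains "interpolant h m s = 1" | i where "i \<in> {1..m * m}" "interpolant h m s = grid_line h m i s"
proof -
  have "interpolant h m s \<in> insert 1 ((\<lambda>i. grid_line h m i s) ` {1..m * m})"
    unfolding interpolant_def by (intro Max_in) auto
  then show thesis using that by blast
qed

lemma last_index: "m * m \<in> {1..m * m}"
  using m by auto

lemma last_line: "grid_line h m (m * m) s = h (real m) + (s - real m)"
  using m by (simp add: grid_line_def grid_slope_def)

lemma profile_interpolant: "profile (interpolant h m)"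
proof
  show "convex_on {0<..} (interpolant h m)"
  proof (rule convex_on_supporting_lines)
    fix x :: real
    show "\<exists>d. \<forall>y\<in>{0<..}. d * (y - x) \<le> interpolant h m y - interpolant h m x"
    proof (cases rule: interpolant_cases[of x])
      case 1
      then show ?thesis using one_le_interpolant by (intro exI[of _ 0]) auto
    next
      case (2 i)
      have "grid_slope h m i * (y - x) = grid_line h m i y - grid_line h m i x" for y
        by (simp add: grid_line_def algebra_simps)
      then show ?thesis
        using grid_line_le_interpolant[OF 2(1)] 2(2) by (intro exI[of _ "grid_slope h m i"]) auto
    qed
  qed simp
  fix s :: real assume s: "0 < s"
  show "1 \<le> interpolant h m s" by (rule one_le_interpolant)
  show "s \<le> interpolant h m s"
    using grid_line_le_interpolant[OF last_index, of s] ge_id[of "real m"] m unfolding last_line by simp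
  show "interpolant h m s \<le> 1 + s"
    using s grid_line_le_succ[OF _ s] by (intro interpolant_leI) auto
qed

text \<open>Every other line is below \<open>grid_line h m i\<close> at both ends of the interval.
  Comparing slopes decides from which end to argue: the left one if the other line is no steeper,
  the right one otherwise.\<close>

lemma interpolant_between:
  assumes i: "1 \<le> i" "i < m * m" and s: "real i / real m \<le> s" "s \<le> real (Suc i) / real m"
  shows "interpolant h m s = grid_line h m i s"
proof (rule antisym)
  show "grid_line h m i s \<le> interpolant h m s" using i by (intro grid_line_le_interpolant) auto
  have line: "grid_line h m j s \<le> grid_line h m i s" if "j \<in> {1..m * m}" for j
  proof (cases "grid_slope h m j \<le> grid_slope h m i")
    case True
    let ?p = "real i / real m"
    have "grid_line h m j ?p \<le> grid_line h m i ?p"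
      using grid_line_le_grid[OF that, of i] i by (simp add: grid_line_def[of h m i])
    moreover have "grid_slope h m j * (s - ?p) \<le> grid_slope h m i * (s - ?p)"
      using True s by (intro mult_right_mono) auto
    ultimately show ?thesis by (simp add: grid_line_def algebra_simps)
  next
    case False
    let ?q = "real (Suc i) / real m"
    have "grid_line h m j ?q \<le> grid_line h m i ?q"
      using grid_line_le_grid[OF that, of "Suc i"] i grid_line_next[OF i(2)] by simp
    moreover have "grid_slope h m i * (?q - s) \<le> grid_slope h m j * (?q - s)"
      using False s by (intro mult_right_mono) auto
    ultimately show ?thesis by (simp add: grid_line_def algebra_simps)
  qed
  show "interpolant h m s \<le> grid_line h m i s"
  proof (rule interpolant_leI[OF _ line])
    have "1 \<le> grid_line h m i (real i / real m)" using ge_one[OF grid_pos[OF i(1)]] by (simp add: grid_line_def)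
    also have "\<dots> \<le> grid_line h m i s"
      using grid_slope_bounds[OF i(1)] s by (simp add: grid_line_def)
    finally show "1 \<le> grid_line h m i s" .
  qed
qed

lemma interpolant_beyond:
  assumes s: "real m \<le> s" shows "interpolant h m s = grid_line h m (m * m) s"
proof (rule antisym)
  show "grid_line h m (m * m) s \<le> interpolant h m s" by (rule grid_line_le_interpolant[OF last_index])
  show "interpolant h m s \<le> grid_line h m (m * m) s"
  proof (rule interpolant_leI)
    show "1 \<le> grid_line h m (m * m) s" unfolding last_line using ge_one[of "real m"] m s by simp
    fix j assume j: "j \<in> {1..m * m}"
    have "grid_line h m j (real m) \<le> h (real m)" using grid_line_le_grid[OF j last_index] m by simp
    moreover have "grid_slope h m j * (s - real m) \<le> 1 * (s - real m)"
      using grid_slope_bounds[of j] j s by (intro mult_right_mono) auto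
    ultimately show "grid_line h m j s \<le> grid_line h m (m * m) s"
      unfolding last_line by (simp add: grid_line_def algebra_simps)
  qed
qed

lemma interpolant_grid:
  assumes "1 \<le> i" "i \<le> m * m" shows "interpolant h m (real i / real m) = h (real i / real m)"
proof (cases "i = m * m")
  case True
  then show ?thesis using interpolant_beyond[of "real m"] m by (simp add: last_line)
next
  case False
  then show ?thesis using interpolant_between[of i "real i / real m"] assms m
    by (simp add: grid_line_def divide_right_mono)
qed

text \<open>Since \<open>2 * r < 1 / real m\<close>, the four points in \<open>slope_jump\<close>
  stay on the two linear pieces meeting at the grid point, and the difference quotients are exact
  slopes.\<close>

lemma slope_jump_interpolant:
  assumes i: "2 \<le> i" "i \<le> m * m" and r: "0 < r" "4 * real m * r \<le> 1"
  shows "slope_jump (interpolant h m) (real i / real m) r = grid_slope h m i - grid_slope h m (i - 1)"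
proof -
  let ?p = "real i / real m"
  have r2: "2 * r < 1 / real m" using r m by (simp add: field_simps)
  have right: "interpolant h m (?p + t) = h ?p + grid_slope h m i * t" if "0 \<le> t" "t \<le> 2 * r" for t
  proof (cases "i = m * m")
    case True
    then have "?p = real m" using m by simp
    then show ?thesis using interpolant_beyond[of "?p + t"] that True by (simp add: grid_line_def)
  next
    case False
    then have "interpolant h m (?p + t) = grid_line h m i (?p + t)"
      using i that r2 by (intro interpolant_between) (auto simp: grid_step simp del: of_nat_Suc)
    then show ?thesis by (simp add: grid_line_def)
  qed
  have left: "interpolant h m (?p - t) = h ?p - grid_slope h m (i - 1) * t" if "0 \<le> t" "t \<le> 2 * r" for t
  proof -
    have i1: "Suc (i - 1) = i" using i by simp
    have p1: "?p = real (i - 1) / real m + 1 / real m" using grid_step[of "i - 1"] i1 by simp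
    have "interpolant h m (?p - t) = grid_line h m (i - 1) (?p - t)"
      using i that r2 p1 by (intro interpolant_between) (auto simp: i1)
    moreover have "grid_line h m (i - 1) ?p = h ?p" using grid_line_next[of "i - 1"] i i1 by simp
    ultimately show ?thesis by (simp add: grid_line_def algebra_simps)
  qed
  show ?thesis
    unfolding slope_jump_def using right[of "2 * r"] right[of r] left[of "2 * r"] left[of r] r
    by (simp add: field_simps)
qed

text \<open>The jumps telescope to the final slope \<open>1\<close> minus the slope just before
  \<open>1\<close>, which convexity bounds by the slope of the chord from \<open>1\<close> to
  \<open>2\<close>. The sum does not depend on \<open>r\<close>, so the neighbourhoods can be made
  as thin as desired.\<close>

lemma sum_slope_jump_interpolant:
  assumes r: "0 < r" "4 * real m * r \<le> 1"
  shows "1 - (h 2 - h 1) \<le> (\<Sum>i=m..m * m. slope_jump (interpolant h m) (real i / real m) r)"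
proof -
  have mm: "m - 1 \<le> m * m" "Suc (m - 1) = m" using m by auto (metis diff_le_self le_square le_trans)
  have "(\<Sum>i=m..m * m. slope_jump (interpolant h m) (real i / real m) r)
      = (\<Sum>i=Suc (m - 1)..m * m. grid_slope h m i - grid_slope h m (i - 1))"
    unfolding mm(2) using m r by (intro sum.cong slope_jump_interpolant) auto
  also have "\<dots> = grid_slope h m (m * m) - grid_slope h m (m - 1)"
    using sum_telescope''[OF mm(1)] .
  also have "\<dots> = 1 - grid_slope h m (m - 1)" by (simp add: grid_slope_def)
  finally have eq: "(\<Sum>i=m..m * m. slope_jump (interpolant h m) (real i / real m) r) = 1 - grid_slope h m (m - 1)" .
  have lt: "m - 1 < m * m" using m by (metis mm(2) le_square lessI less_le_trans)
  have "grid_slope h m (m - 1) = (h 1 - h (real (m - 1) / real m)) / (1 - real (m - 1) / real m)"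
    unfolding grid_slope_eq[OF lt] mm(2) using m by simp
  also have "\<dots> \<le> (h 2 - h 1) / (2 - 1)"
    using m by (intro slope_mono) auto
  finally show ?thesis using eq by simp
qed

end

end

text \<open>
  Outside \<open>thin_jump_set n\<close>, the right derivative increases by more than half of
  \<open>1 - (h 2 - h 1)\<close>, a lower bound for its increase beyond \<open>1\<close>, on neighbourhoods of grid points
  of total length at most \<open>1 / 2 ^ n\<close>.
\<close>

definition thin_jump_set :: "nat \<Rightarrow> (real \<times> real \<Rightarrow> real) set" where
  "thin_jump_set n = {C \<in> ev_copulas. \<forall>m\<ge>2. \<forall>r>0. 4 * real m * r \<le> 1 \<longrightarrow> 4 * r * (real m * real m + 1) \<le> 1 / 2 ^ n \<longrightarrow>
     (\<Sum>i=m..m * m. slope_jump (\<lambda>s. tail_fun C s 1) (real i / real m) r) \<le> (1 - (tail_fun C 2 1 - tail_fun C 1 1)) / 2}"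

text \<open>By the Lipschitz bound such a profile has slope \<open>1\<close> from \<open>1\<close>
  on. The threshold in \<open>thin_jump_set\<close> is then zero, so lying outside those sets
  guarantees no fixed amount of mass; these copulas are excluded separately.\<close>

definition affine_set :: "(real \<times> real \<Rightarrow> real) set" where
  "affine_set = {C \<in> ev_copulas. 1 \<le> tail_fun C 2 1 - tail_fun C 1 1}"

section \<open>Thin jump sets are closed and nowhere dense\<close>

lemma thin_jump_arg:
  assumes "m \<le> i" "0 < m" "4 * real m * r \<le> 1" "0 < r" shows "1 / 2 \<le> real i / real m - 2 * r"
proof -
  have "1 \<le> real i / real m" using assms by simp
  moreover have "4 * 1 * r \<le> 4 * real m * r" using assms by (intro mult_right_mono) auto
  ultimately show ?thesis using assms(3) by linarith
qed

lemma closedin_thin_jump_set: "closedin ev_topology (thin_jump_set n)"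
proof -
  let ?I = "{(m, r). 2 \<le> m \<and> 0 < r \<and> 4 * real m * r \<le> 1 \<and> 4 * r * (real m * real m + 1) \<le> 1 / 2 ^ n}"
  let ?S = "\<lambda>m r. {C \<in> ev_copulas. (\<Sum>i=m..m * m. slope_jump (\<lambda>s. tail_fun C s 1) (real i / real m) r) \<le> (1 - (tail_fun C 2 1 - tail_fun C 1 1)) / 2}"
  have eq: "thin_jump_set n = ev_copulas \<inter> (\<Inter>(m, r)\<in>?I. ?S m r)"
    unfolding thin_jump_set_def by auto
  have "closedin ev_topology (?S m r)" if "(m, r) \<in> ?I" for m r
  proof (rule closedin_le_functional)
    show "continuous_map ev_topology euclideanreal (\<lambda>C. \<Sum>i=m..m * m. slope_jump (\<lambda>s. tail_fun C s 1) (real i / real m) r)"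
    proof (intro continuous_map_sum continuous_map_slope_jump)
      fix i assume "i \<in> {m..m * m}"
      then have "1 / 2 \<le> real i / real m - 2 * r" using that by (intro thin_jump_arg) auto
      then show "0 \<le> real i / real m - 2 * r" by linarith
    qed (use that in auto)
    show "continuous_map ev_topology euclideanreal (\<lambda>C. (1 - (tail_fun C 2 1 - tail_fun C 1 1)) / 2)"
      by (intro continuous_map_diff continuous_map_real_divide continuous_map_tail_fun) auto
  qed
  then have "\<forall>K\<in>(\<lambda>(m, r). ?S m r) ` ?I. closedin ev_topology K" by auto
  moreover have "closedin ev_topology ev_copulas"
    using closedin_topspace[of ev_topology] by simp
  ultimately have "closedin ev_topology (\<Inter>(insert ev_copulas ((\<lambda>(m, r). ?S m r) ` ?I)))"
    by (intro closedin_Inter) auto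
  then show ?thesis unfolding eq by simp
qed

lemma profile_not_affine_near:
  assumes h: "profile h" and e: "0 < (e::real)"
  obtains g where "profile g" "\<And>s. 0 < s \<Longrightarrow> \<bar>h s - g s\<bar> \<le> e * max 1 s" "g 2 - g 1 < 1"
proof -
  define a where "a = min e 1"
  have a: "0 < a" "a \<le> 1" "a \<le> e" using e by (auto simp: a_def)
  let ?g = "\<lambda>s. (1 - a) * h s + a * max (1 + s / 2) s"
  show thesis
  proof (rule that[of ?g])
    show "profile ?g" using a by (intro profile_mix h profile_max_line) auto
    fix s :: real assume "0 < s"
    then have "\<bar>h s - ?g s\<bar> \<le> a * max 1 s" using a by (intro profile_mix_dist h profile_max_line) auto
    also have "\<dots> \<le> e * max 1 s" using a by (intro mult_right_mono) auto
    finally show "\<bar>h s - ?g s\<bar> \<le> e * max 1 s" .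
  next
    have "(1 - a) * (h 2 - h 1) \<le> (1 - a) * 1"
      using profile.lipschitz[OF h, of 1 2] a by (intro mult_left_mono) auto
    moreover have "a * (2 - 3 / 2) < a" using a by simp
    ultimately show "?g 2 - ?g 1 < 1" by (simp add: algebra_simps max_def)
  qed
qed

lemma nowhere_dense_affine_set: "nowhere_dense_in ev_topology affine_set"
proof (rule nowhere_dense_in_ev_topologyI)
  show "closedin ev_topology affine_set"
    unfolding affine_set_def
    by (intro closedin_le_functional continuous_map_diff continuous_map_tail_fun) auto
  fix h e assume "profile h" "0 < (e::real)"
  then obtain g where g: "profile g" "\<And>s. 0 < s \<Longrightarrow> \<bar>h s - g s\<bar> \<le> e * max 1 s" "g 2 - g 1 < 1"
    by (rule profile_not_affine_near) blast
  then have "ev_of g \<notin> affine_set" by (simp add: affine_set_def profile.tail_fun_ev_of)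
  then show "\<exists>h'. profile h' \<and> (\<forall>s>0. \<bar>h s - h' s\<bar> \<le> e * max 1 s) \<and> ev_of h' \<notin> affine_set"
    using g by blast
qed

lemma (in profile) sum_slope_jump_tail_fun:
  assumes "0 < m" "4 * real m * r \<le> 1" "0 < r"
  shows "(\<Sum>i=m..m * m. slope_jump (\<lambda>s. tail_fun (ev_of h) s 1) (real i / real m) r)
    = (\<Sum>i=m..m * m. slope_jump h (real i / real m) r)"
proof (rule sum.cong)
  fix i assume "i \<in> {m..m * m}"
  then have "1 / 2 \<le> real i / real m - 2 * r" using assms by (intro thin_jump_arg) auto
  then have "0 < real i / real m - 2 * r" by linarith
  then show "slope_jump (\<lambda>s. tail_fun (ev_of h) s 1) (real i / real m) r = slope_jump h (real i / real m) r"
    using assms(3) by (rule slope_jump_tail_fun)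
qed simp

lemma nowhere_dense_thin_jump_set: "nowhere_dense_in ev_topology (thin_jump_set n)"
proof (rule nowhere_dense_in_ev_topologyI[OF closedin_thin_jump_set])
  fix h e assume h: "profile h" and e: "0 < (e::real)"
  \<comment> \<open>Half of \<open>e\<close> is spent on an increment below \<open>1\<close> from
    \<open>1\<close> to \<open>2\<close>, the other half on interpolation.\<close>
  then obtain g where g: "profile g" "\<And>s. 0 < s \<Longrightarrow> \<bar>h s - g s\<bar> \<le> e / 2 * max 1 s" "g 2 - g 1 < 1"
    using profile_not_affine_near[OF h, of "e / 2"] by auto
  obtain m0 where m0: "1 / real (Suc m0) < e / 2" using nat_approx_posE[of "e / 2"] e by auto
  define m where "m = Suc (Suc m0)"
  have m: "2 \<le> m" by (simp add: m_def)
  have "1 / real m \<le> 1 / real (Suc m0)" by (simp add: m_def field_simps)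
  then have me: "1 / real m \<le> e / 2" using m0 by simp
  let ?g = "interpolant g m"
  interpret g: profile g by fact
  have pg: "profile ?g" by (rule g.profile_interpolant[OF m])
  have close: "\<bar>h s - ?g s\<bar> \<le> e * max 1 s" if s: "0 < s" for s
  proof -
    have "\<bar>g s - ?g s\<bar> \<le> 1 / real m * max 1 s"
      using m s g.interpolant_grid[OF m] by (intro profile_grid_dist g(1) pg) auto
    also have "\<dots> \<le> e / 2 * max 1 s" using me by (intro mult_right_mono) auto
    finally have "\<bar>h s - g s\<bar> + \<bar>g s - ?g s\<bar> \<le> e / 2 * max 1 s + e / 2 * max 1 s"
      using g(2)[OF s] by (rule add_mono[rotated])
    also have "\<dots> = e * max 1 s" by (simp add: field_simps)
    finally show ?thesis using abs_triangle_ineq[of "h s - g s" "g s - ?g s"] by simp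
  qed
  define r where "r = min (1 / (4 * real m)) (1 / 2 ^ n / (4 * (real m * real m + 1)))"
  have M: "0 < real m" "0 < real m * real m + 1" using m by (auto intro: add_pos_pos)
  have r: "0 < r" "4 * real m * r \<le> 1" "4 * r * (real m * real m + 1) \<le> 1 / 2 ^ n"
  proof -
    show "0 < r" using M by (simp add: r_def)
    have "r \<le> 1 / (4 * real m)" by (simp add: r_def)
    then show "4 * real m * r \<le> 1" using M by (simp add: field_simps)
    have "r \<le> 1 / 2 ^ n / (4 * (real m * real m + 1))" by (simp add: r_def)
    moreover have "0 < 4 * (real m * real m + 1)" using M by simp
    ultimately have "r * (4 * (real m * real m + 1)) \<le> 1 / 2 ^ n" by (simp only: pos_le_divide_eq)
    moreover have "4 * r * (real m * real m + 1) = r * (4 * (real m * real m + 1))" by simp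
    ultimately show "4 * r * (real m * real m + 1) \<le> 1 / 2 ^ n" by (simp only:)
  qed
  \<comment> \<open>The points \<open>1\<close> and \<open>2\<close> are grid points, of index
    \<open>m\<close> and \<open>2 * m \<le> m * m\<close>, so interpolation preserves the increment
    between them.\<close>
  have "m * 1 \<le> m * m" "m * 2 \<le> m * m" using m by (intro mult_le_mono; simp)+
  then have g12: "?g 1 = g 1" "?g 2 = g 2"
    using g.interpolant_grid[OF m, of m] g.interpolant_grid[OF m, of "m * 2"] m by auto
  \<comment> \<open>The sum reaches all of \<open>1 - (g 2 - g 1) > 0\<close>, so the half in the
    definition gives a strict inequality.\<close>
  have "(1 - (?g 2 - ?g 1)) / 2 < (\<Sum>i=m..m * m. slope_jump ?g (real i / real m) r)"
    using g.sum_slope_jump_interpolant[OF m r(1,2)] g(3) g12 by simp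
  then have "\<not> (\<Sum>i=m..m * m. slope_jump (\<lambda>s. tail_fun (ev_of ?g) s 1) (real i / real m) r)
      \<le> (1 - (tail_fun (ev_of ?g) 2 1 - tail_fun (ev_of ?g) 1 1)) / 2"
    using profile.sum_slope_jump_tail_fun[OF pg _ r(2,1)] profile.tail_fun_ev_of[OF pg] m by simp
  then have "ev_of ?g \<notin> thin_jump_set n"
    unfolding thin_jump_set_def using m r by blast
  then show "\<exists>h'. profile h' \<and> (\<forall>s>0. \<bar>h s - h' s\<bar> \<le> e * max 1 s) \<and> ev_of h' \<notin> thin_jump_set n"
    using pg close by blast
qed

section \<open>Simultaneous Lebesgue decomposition of a kernel\<close>

lemma finite_measure_unit_lebesgue: "finite_measure unit_lebesgue"
  using prob_space_unit_lebesgue by (simp add: prob_space_def)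

lemma sigma_finite_unit_lebesgue: "sigma_finite_measure unit_lebesgue"
  using finite_measure_unit_lebesgue by (simp add: finite_measure_def)

lemma pair_sigma_finite_unit_lebesgue: "pair_sigma_finite unit_lebesgue unit_lebesgue"
  using sigma_finite_unit_lebesgue by (simp add: pair_sigma_finite_def)

lemma AE_kernel_emeasure_eq:
  assumes K: "K \<in> unit_lebesgue \<rightarrow>\<^sub>M subprob_algebra unit_lebesgue"
    and K': "K' \<in> unit_lebesgue \<rightarrow>\<^sub>M subprob_algebra unit_lebesgue"
    and F: "F \<in> sets unit_lebesgue"
    and eq: "\<And>E. E \<in> sets unit_lebesgue \<Longrightarrow>
      (\<integral>\<^sup>+x\<in>E. emeasure (K x) F \<partial>unit_lebesgue) = (\<integral>\<^sup>+x\<in>E. emeasure (K' x) F \<partial>unit_lebesgue)"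
  shows "AE x in unit_lebesgue. emeasure (K x) F = emeasure (K' x) F"
  by (rule finite_measure.density_unique_finite_measure[OF finite_measure_unit_lebesgue
        measurable_emeasure_kernel[OF K F] measurable_emeasure_kernel[OF K' F] _ _ eq]) simp_all

text \<open>For each rational \<open>q\<close> the values on \<open>{0..q}\<close> agree almost
  everywhere. Countably many null sets are discarded, and the values at rational \<open>q\<close>
  determine a finite measure on the unit interval.\<close>

lemma AE_kernel_eq:
  assumes K: "K \<in> unit_lebesgue \<rightarrow>\<^sub>M subprob_algebra unit_lebesgue"
    and K': "K' \<in> unit_lebesgue \<rightarrow>\<^sub>M subprob_algebra unit_lebesgue"
    and eq: "\<And>E F. E \<in> sets unit_lebesgue \<Longrightarrow> F \<in> sets unit_lebesgue \<Longrightarrow>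
      (\<integral>\<^sup>+x\<in>E. emeasure (K x) F \<partial>unit_lebesgue) = (\<integral>\<^sup>+x\<in>E. emeasure (K' x) F \<partial>unit_lebesgue)"
  shows "AE x in unit_lebesgue. K x = K' x"
proof -
  have "AE x in unit_lebesgue. \<forall>q\<in>\<rat> \<inter> {0..1}. emeasure (K x) {0..q} = emeasure (K' x) {0..q}"
  proof (rule AE_ball_countable')
    show "countable (\<rat> \<inter> {0..1::real})" by (intro countable_Int1 countable_rat)
    fix q :: real assume "q \<in> \<rat> \<inter> {0..1}"
    then have q: "{0..q} \<in> sets unit_lebesgue" by (intro Icc_in_sets_unit) simp_all
    show "AE x in unit_lebesgue. emeasure (K x) {0..q} = emeasure (K' x) {0..q}"
      by (rule AE_kernel_emeasure_eq[OF K K' q eq[OF _ q]])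
  qed
  then show ?thesis
  proof (rule AE_mp, intro AE_I2 impI)
    fix x assume x: "x \<in> space unit_lebesgue"
      and q: "\<forall>q\<in>\<rat> \<inter> {0..1}. emeasure (K x) {0..q} = emeasure (K' x) {0..q}"
    have "subprob_space (K x)" "subprob_space (K' x)"
      using subprob_space_kernel[OF K x] subprob_space_kernel[OF K' x] .
    then show "K x = K' x"
      using sets_kernel[OF K x] sets_kernel[OF K' x] q
      by (intro unit_measure_eqI) (auto simp: subprob_space_def)
  qed
qed

lemma emeasure_kernel_measure_sections:
  assumes K: "K \<in> unit_lebesgue \<rightarrow>\<^sub>M subprob_algebra unit_lebesgue" and A: "A \<in> sets unit_lebesgue2"
  shows "emeasure (kernel_measure K) A = (\<integral>\<^sup>+x. emeasure (K x) (Pair x -` A) \<partial>unit_lebesgue)"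
proof -
  let ?L = unit_lebesgue
  note K[measurable]
  have "(\<lambda>x. distr (K x) (?L \<Otimes>\<^sub>M ?L) (Pair x)) \<in> ?L \<rightarrow>\<^sub>M subprob_algebra (?L \<Otimes>\<^sub>M ?L)"
    by (rule measurable_distr2[where M = ?L]) (use K in measurable)
  then have "emeasure (kernel_measure K) A = (\<integral>\<^sup>+x. emeasure (distr (K x) (?L \<Otimes>\<^sub>M ?L) (Pair x)) A \<partial>?L)"
    unfolding kernel_measure_def using A by (intro emeasure_bind) auto
  also have "\<dots> = (\<integral>\<^sup>+x. emeasure (K x) (Pair x -` A) \<partial>?L)"
  proof (rule nn_integral_cong)
    fix x assume x: "x \<in> space ?L"
    have P: "Pair x \<in> K x \<rightarrow>\<^sub>M ?L \<Otimes>\<^sub>M ?L"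
      using measurable_Pair1'[OF x, of ?L] by (simp add: measurable_cong_sets[OF sets_kernel[OF K x] refl])
    have "Pair x -` A \<subseteq> space (K x)"
      using sets.sets_into_space[OF sets_Pair1[OF A, of x]] sets_eq_imp_space_eq[OF sets_kernel[OF K x]] by simp
    then show "emeasure (distr (K x) (?L \<Otimes>\<^sub>M ?L) (Pair x)) A = emeasure (K x) (Pair x -` A)"
      by (subst emeasure_distr[OF P A]) (simp add: Int_absorb2)
  qed
  finally show ?thesis .
qed

text \<open>The indicator of a section serves as a density, instead of a restricted space, so that
  all restricted measures stay on the whole unit interval and form a sub-Markov kernel.\<close>

definition restrict_kernel :: "(real \<Rightarrow> real measure) \<Rightarrow> (real \<times> real) set \<Rightarrow> real \<Rightarrow> real measure" where
  "restrict_kernel K A x = density (K x) (indicator (Pair x -` A))"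

lemma emeasure_restrict_kernel:
  assumes K: "K \<in> unit_lebesgue \<rightarrow>\<^sub>M subprob_algebra unit_lebesgue" and A: "A \<in> sets unit_lebesgue2"
    and x: "x \<in> unit_interval" and F: "F \<in> sets unit_lebesgue"
  shows "emeasure (restrict_kernel K A x) F = emeasure (K x) (F \<inter> Pair x -` A)"
proof -
  have s: "sets (K x) = sets unit_lebesgue" using x by (intro sets_kernel[OF K]) simp
  then have "Pair x -` A \<in> sets (K x)" using sets_Pair1[OF A] by simp
  then show ?thesis
    unfolding restrict_kernel_def using F s
    by (subst emeasure_density) (auto simp: indicator_inter_arith[symmetric] Int_commute)
qed

lemma restrict_kernel_measurable:
  assumes K: "K \<in> unit_lebesgue \<rightarrow>\<^sub>M subprob_algebra unit_lebesgue" and A: "A \<in> sets unit_lebesgue2"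
  shows "restrict_kernel K A \<in> unit_lebesgue \<rightarrow>\<^sub>M subprob_algebra unit_lebesgue"
proof (rule measurable_subprob_algebra)
  fix x assume x: "x \<in> space unit_lebesgue"
  have s: "sets (K x) = sets unit_lebesgue" by (rule sets_kernel[OF K x])
  then show s': "sets (restrict_kernel K A x) = sets unit_lebesgue" by (simp add: restrict_kernel_def)
  interpret Kx: subprob_space "K x" by (rule subprob_space_kernel[OF K x])
  show "subprob_space (restrict_kernel K A x)"
  proof (rule subprob_spaceI)
    have sp: "space (restrict_kernel K A x) = unit_interval" using sets_eq_imp_space_eq[OF s'] by simp
    have "emeasure (restrict_kernel K A x) unit_interval \<le> emeasure (K x) (space (K x))"
      using x Icc_in_sets_unit by (subst emeasure_restrict_kernel[OF K A]) (auto intro: emeasure_space)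
    also have "\<dots> \<le> 1" by (rule Kx.emeasure_space_le_1)
    finally show "emeasure (restrict_kernel K A x) (space (restrict_kernel K A x)) \<le> 1" unfolding sp .
    show "space (restrict_kernel K A x) \<noteq> {}" unfolding sp by simp
  qed
next
  fix F assume F: "F \<in> sets unit_lebesgue"
  have "(\<lambda>x. emeasure (K x) (F \<inter> Pair x -` A)) \<in> borel_measurable unit_lebesgue"
  proof (rule emeasure_measurable_subprob_algebra2[OF _ K])
    have "(SIGMA x:space unit_lebesgue. F \<inter> Pair x -` A) = (space unit_lebesgue \<times> F) \<inter> A"
      using sets.sets_into_space[OF A] by (auto simp: space_pair_measure)
    then show "(SIGMA x:space unit_lebesgue. F \<inter> Pair x -` A) \<in> sets unit_lebesgue2"
      using A F by (simp only:) (intro sets.Int pair_measureI sets.top)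
  qed
  then show "(\<lambda>x. emeasure (restrict_kernel K A x) F) \<in> borel_measurable unit_lebesgue"
    by (rule measurable_cong[THEN iffD1, rotated]) (use F in \<open>simp add: emeasure_restrict_kernel[OF K A]\<close>)
qed

text \<open>Exhaustion: the union \<open>S\<close> of null sets whose \<open>\<mu>\<close>-masses
  approach the supremum attains it, so no null set has mass outside \<open>S\<close>. The complement
  of \<open>S\<close> carries the absolutely continuous part.\<close>

lemma Lebesgue_decomposition_set:
  assumes "finite_measure \<mu>" and sets: "sets \<mu> = sets M"
  obtains S where "S \<in> null_sets M" "\<And>A. A \<in> null_sets M \<Longrightarrow> emeasure \<mu> (A - S) = 0"
proof -
  interpret finite_measure \<mu> by fact
  have "null_sets M \<noteq> {}" by auto
  from ennreal_SUP_countable_SUP[OF this, of "emeasure \<mu>"]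
  obtain f :: "nat \<Rightarrow> ennreal" where f: "range f \<subseteq> emeasure \<mu> ` null_sets M"
    "(SUP N\<in>null_sets M. emeasure \<mu> N) = Sup (range f)" by blast
  then have "\<forall>i. \<exists>N\<in>null_sets M. f i = emeasure \<mu> N" by blast
  then obtain N where N: "\<And>i. N i \<in> null_sets M" "\<And>i. f i = emeasure \<mu> (N i)" by metis
  define S where "S = (\<Union>i. N i)"
  have S: "S \<in> null_sets M" unfolding S_def using N(1) by blast
  have max: "emeasure \<mu> A \<le> emeasure \<mu> S" if "A \<in> null_sets M" for A
  proof -
    have "emeasure \<mu> A \<le> Sup (range f)" unfolding f(2)[symmetric] using that by (rule SUP_upper)
    also have "\<dots> \<le> emeasure \<mu> S"
      using N S sets by (intro SUP_least) (auto simp: S_def intro!: emeasure_mono)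
    finally show ?thesis .
  qed
  show thesis
  proof (rule that[OF S])
    fix A assume A: "A \<in> null_sets M"
    have SA: "S \<in> sets \<mu>" "A \<in> sets \<mu>" using S A sets by auto
    have "emeasure \<mu> S + emeasure \<mu> (A - S) = emeasure \<mu> (S \<union> (A - S))"
      using SA by (intro plus_emeasure) auto
    also have "S \<union> (A - S) = S \<union> A" by auto
    also have "emeasure \<mu> (S \<union> A) \<le> emeasure \<mu> S + 0" using max[OF null_sets.Un[OF S A]] by simp
    finally show "emeasure \<mu> (A - S) = 0" by simp
  qed
qed

lemma null_measure_kernel: "(\<lambda>_. null_measure unit_lebesgue) \<in> unit_lebesgue \<rightarrow>\<^sub>M subprob_algebra unit_lebesgue"
  by (intro measurable_const) (simp add: space_subprob_algebra subprob_space_null_measure)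

lemma measurable_kernel_If:
  assumes "K \<in> unit_lebesgue \<rightarrow>\<^sub>M P" "K' \<in> unit_lebesgue \<rightarrow>\<^sub>M P" "N \<in> sets unit_lebesgue"
  shows "(\<lambda>x. if x \<in> N then K x else K' x) \<in> unit_lebesgue \<rightarrow>\<^sub>M P"
proof (rule measurable_If[OF assms(1,2)])
  have "{x \<in> space unit_lebesgue. x \<in> N} = N" using sets.sets_into_space[OF assms(3)] by blast
  then show "{x \<in> space unit_lebesgue. x \<in> N} \<in> sets unit_lebesgue" using assms(3) by (simp only:)
qed

text \<open>The Lebesgue decomposition of the measure on the square, applied to the sections of its
  singular set, decomposes almost every kernel measure simultaneously and measurably.\<close>

lemma AE_restrict_kernel_absolutely_continuous:
  assumes K: "K \<in> unit_lebesgue \<rightarrow>\<^sub>M subprob_algebra unit_lebesgue" and S: "S \<in> sets unit_lebesgue2"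
    and null: "\<And>A. A \<in> null_sets unit_lebesgue2 \<Longrightarrow> emeasure (kernel_measure K) (A - S) = 0"
  shows "AE x in unit_lebesgue. absolutely_continuous unit_lebesgue (restrict_kernel K (space unit_lebesgue2 - S) x)"
proof -
  let ?L = unit_lebesgue and ?C = "space unit_lebesgue2 - S"
  interpret P: pair_sigma_finite ?L ?L by (rule pair_sigma_finite_unit_lebesgue)
  have C: "?C \<in> sets unit_lebesgue2" using S by simp
  note R = restrict_kernel_measurable[OF K C]
  define \<nu> where "\<nu> = kernel_measure (restrict_kernel K ?C)"
  have s\<nu>: "sets \<nu> = sets unit_lebesgue2" unfolding \<nu>_def by (rule sets_kernel_measure[OF R])
  have \<nu>_eq: "emeasure \<nu> A = emeasure (kernel_measure K) (A - S)" if A: "A \<in> sets unit_lebesgue2" for A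
  proof -
    have "emeasure \<nu> A = (\<integral>\<^sup>+x. emeasure (restrict_kernel K ?C x) (Pair x -` A) \<partial>?L)"
      unfolding \<nu>_def by (rule emeasure_kernel_measure_sections[OF R A])
    also have "\<dots> = (\<integral>\<^sup>+x. emeasure (K x) (Pair x -` (A - S)) \<partial>?L)"
    proof (rule nn_integral_cong)
      fix x assume "x \<in> space ?L"
      moreover have "Pair x -` A \<inter> Pair x -` ?C = Pair x -` (A - S)"
        using sets.sets_into_space[OF A] by blast
      ultimately show "emeasure (restrict_kernel K ?C x) (Pair x -` A) = emeasure (K x) (Pair x -` (A - S))"
        using emeasure_restrict_kernel[OF K C _ sets_Pair1[OF A]] by simp
    qed
    also have "\<dots> = emeasure (kernel_measure K) (A - S)"
      using A S by (intro emeasure_kernel_measure_sections[OF K, symmetric]) auto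
    finally show ?thesis .
  qed
  have "sigma_finite_measure unit_lebesgue2" by (rule P.sigma_finite_measure_axioms)
  moreover have "absolutely_continuous unit_lebesgue2 \<nu>"
    unfolding absolutely_continuous_def
    using null \<nu>_eq s\<nu> by (auto simp: null_sets_def)
  ultimately obtain f where f: "f \<in> borel_measurable unit_lebesgue2" "density unit_lebesgue2 f = \<nu>"
    using sigma_finite_measure.Radon_Nikodym[OF _ _ s\<nu>] by blast
  define g where "g x = (\<integral>\<^sup>+y. f (x, y) \<partial>?L)" for x
  have g: "g \<in> borel_measurable ?L" unfolding g_def by (rule sigma_finite_measure.borel_measurable_nn_integral_fst[OF sigma_finite_unit_lebesgue f(1)])
  have sec: "(\<lambda>y. f (x, y)) \<in> borel_measurable ?L" if "x \<in> space ?L" for x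
    using measurable_compose[OF measurable_Pair1'[OF that] f(1)] .
  have rect: "(\<integral>\<^sup>+x\<in>E. emeasure (restrict_kernel K ?C x) F \<partial>?L) = (\<integral>\<^sup>+x\<in>E. (\<integral>\<^sup>+y\<in>F. f (x, y) \<partial>?L) \<partial>?L)"
    if E: "E \<in> sets ?L" and F: "F \<in> sets ?L" for E F
  proof -
    have "(\<integral>\<^sup>+x\<in>E. emeasure (restrict_kernel K ?C x) F \<partial>?L) = emeasure \<nu> (E \<times> F)"
      unfolding \<nu>_def by (rule emeasure_kernel_measure[OF R E F, symmetric])
    also have "\<dots> = (\<integral>\<^sup>+z. f z * indicator (E \<times> F) z \<partial>unit_lebesgue2)"
      unfolding f(2)[symmetric] using f(1) E F by (intro emeasure_density) auto
    also have "\<dots> = (\<integral>\<^sup>+x. \<integral>\<^sup>+y. f (x, y) * indicator (E \<times> F) (x, y) \<partial>?L \<partial>?L)"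
      using f(1) E F by (intro sigma_finite_measure.nn_integral_fst[OF sigma_finite_unit_lebesgue, symmetric]) auto
    also have "\<dots> = (\<integral>\<^sup>+x\<in>E. (\<integral>\<^sup>+y\<in>F. f (x, y) \<partial>?L) \<partial>?L)"
    proof (rule nn_integral_cong)
      fix x assume x: "x \<in> space ?L"
      have "(\<integral>\<^sup>+y. f (x, y) * indicator (E \<times> F) (x, y) \<partial>?L) = (\<integral>\<^sup>+y. f (x, y) * indicator F y * indicator E x \<partial>?L)"
        by (intro nn_integral_cong) (auto simp: indicator_def)
      also have "\<dots> = (\<integral>\<^sup>+y\<in>F. f (x, y) \<partial>?L) * indicator E x"
        using sec[OF x] F by (intro nn_integral_multc) auto
      finally show "(\<integral>\<^sup>+y. f (x, y) * indicator (E \<times> F) (x, y) \<partial>?L) = (\<integral>\<^sup>+y\<in>F. f (x, y) \<partial>?L) * indicator E x" .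
    qed
    finally show ?thesis .
  qed
  have L1: "space ?L \<in> sets ?L" by (rule sets.top)
  have g_eq: "(\<integral>\<^sup>+y\<in>space ?L. f (x, y) \<partial>?L) = g x" for x
    unfolding g_def by (rule nn_integral_cong) simp
  have "AE x in ?L. emeasure (restrict_kernel K ?C x) (space ?L) = g x"
    by (rule finite_measure.density_unique_finite_measure[OF finite_measure_unit_lebesgue
          measurable_emeasure_kernel[OF R L1] g])
      (use rect[OF _ L1] in \<open>simp_all only: g_eq zero_le simp_thms AE_I2\<close>)
  then have g_le: "AE x in ?L. g x \<le> 1"
  proof (rule AE_mp, intro AE_I2 impI)
    fix x assume x: "x \<in> space ?L" and eq: "emeasure (restrict_kernel K ?C x) (space ?L) = g x"
    interpret subprob_space "restrict_kernel K ?C x" by (rule subprob_space_kernel[OF R x])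
    show "g x \<le> 1"
      unfolding eq[symmetric] using emeasure_space_le_1 sets_eq_imp_space_eq[OF sets_kernel[OF R x]] by simp
  qed
  \<comment> \<open>Where the section of the density has mass above \<open>1\<close>, which happens
    only on a null set of \<open>x\<close>, the null measure keeps \<open>K'\<close> sub-Markov, as
    \<open>AE_kernel_eq\<close> requires.\<close>
  define K' where "K' x = (if g x \<le> 1 then density ?L (\<lambda>y. f (x, y)) else null_measure ?L)" for x
  have K'_em: "emeasure (K' x) F = (if g x \<le> 1 then (\<integral>\<^sup>+y\<in>F. f (x, y) \<partial>?L) else 0)"
    if "x \<in> space ?L" "F \<in> sets ?L" for x F
    using that sec by (auto simp: K'_def emeasure_density)
  have K': "K' \<in> ?L \<rightarrow>\<^sub>M subprob_algebra ?L"
  proof (rule measurable_subprob_algebra)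
    fix x assume x: "x \<in> space ?L"
    show s: "sets (K' x) = sets ?L" by (simp add: K'_def)
    show "subprob_space (K' x)"
    proof (rule subprob_spaceI)
      show "space (K' x) \<noteq> {}" using sets_eq_imp_space_eq[OF s] by simp
      show "emeasure (K' x) (space (K' x)) \<le> 1"
        unfolding sets_eq_imp_space_eq[OF s] K'_em[OF x L1] g_eq by simp
    qed
  next
    fix F assume F: "F \<in> sets ?L"
    have "(\<lambda>z. f z * indicator F (snd z)) \<in> borel_measurable unit_lebesgue2"
      using f(1) F by measurable
    from sigma_finite_measure.borel_measurable_nn_integral_fst[OF sigma_finite_unit_lebesgue this]
    have "(\<lambda>x. \<integral>\<^sup>+y\<in>F. f (x, y) \<partial>?L) \<in> borel_measurable ?L" by simp
    then have "(\<lambda>x. if g x \<le> 1 then (\<integral>\<^sup>+y\<in>F. f (x, y) \<partial>?L) else 0) \<in> borel_measurable ?L"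
      using g by measurable
    then show "(\<lambda>x. emeasure (K' x) F) \<in> borel_measurable ?L"
      by (rule measurable_cong[THEN iffD1, rotated]) (use K'_em F in simp)
  qed
  have "AE x in ?L. restrict_kernel K ?C x = K' x"
  proof (rule AE_kernel_eq[OF R K'])
    fix E F assume E: "E \<in> sets ?L" and F: "F \<in> sets ?L"
    have "AE x in ?L. (\<integral>\<^sup>+y\<in>F. f (x, y) \<partial>?L) * indicator E x = emeasure (K' x) F * indicator E x"
      using g_le by (rule AE_mp) (use K'_em F in \<open>auto intro!: AE_I2\<close>)
    then show "(\<integral>\<^sup>+x\<in>E. emeasure (restrict_kernel K ?C x) F \<partial>?L) = (\<integral>\<^sup>+x\<in>E. emeasure (K' x) F \<partial>?L)"
      unfolding rect[OF E F] by (rule nn_integral_cong_AE)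
  qed
  then show ?thesis
  proof (rule AE_mp, intro AE_I2 impI)
    fix x assume x: "x \<in> space ?L" and eq: "restrict_kernel K ?C x = K' x"
    show "absolutely_continuous ?L (restrict_kernel K ?C x)"
      unfolding eq K'_def
      using absolutely_continuousI_density[OF sec[OF x]] by (auto simp: absolutely_continuous_def null_sets_def)
  qed
qed

lemma unit_lebesgue_singleton: "emeasure unit_lebesgue {y} = 0"
proof (cases "y \<in> unit_interval")
  case True then show ?thesis by (subst emeasure_restrict_space) auto
next
  case False
  then have "{y} \<notin> sets unit_lebesgue" by (simp add: sets_unit_lebesgue_iff)
  then show ?thesis by (rule emeasure_notin_sets)
qed

text \<open>\<open>copula_kernel_parts\<close> is given by a choice operator, so its properties rest
  on the existence of a decomposition. For an atomless kernel the discrete part can be zero, and a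
  Lebesgue decomposition on the square supplies the other two. As
  \<open>kernel_decomposition\<close> speaks of every \<open>x\<close>, the kernel is changed on a
  null set.\<close>

lemma kernel_decomposition_exists:
  assumes K: "K \<in> unit_lebesgue \<rightarrow>\<^sub>M prob_algebra unit_lebesgue"
    and atomless: "\<And>x y. x \<in> unit_interval \<Longrightarrow> y \<in> unit_interval \<Longrightarrow> emeasure (K x) {y} = 0"
  obtains K' P where "K' \<in> unit_lebesgue \<rightarrow>\<^sub>M prob_algebra unit_lebesgue"
    "AE x in unit_lebesgue. K x = K' x" "kernel_decomposition K' P"
proof -
  let ?L = unit_lebesgue
  have Ks: "K \<in> ?L \<rightarrow>\<^sub>M subprob_algebra ?L" using K by (rule measurable_prob_algebraD)
  interpret P: pair_sigma_finite ?L ?L by (rule pair_sigma_finite_unit_lebesgue)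
  have fin: "finite_measure (kernel_measure K)"
  proof (rule finite_measureI)
    have "emeasure (kernel_measure K) (space (kernel_measure K)) = (\<integral>\<^sup>+x. emeasure (K x) unit_interval * indicator unit_interval x \<partial>?L)"
      using emeasure_kernel_measure[OF Ks Icc_in_sets_unit Icc_in_sets_unit, of 0 1 0 1]
        sets_eq_imp_space_eq[OF sets_kernel_measure[OF Ks]] by (simp add: space_pair_measure)
    also have "\<dots> \<le> (\<integral>\<^sup>+x. 1 \<partial>?L)"
    proof (rule nn_integral_mono)
      fix x assume x: "x \<in> space ?L"
      interpret subprob_space "K x" by (rule subprob_space_kernel[OF Ks x])
      show "emeasure (K x) unit_interval * indicator unit_interval x \<le> 1"
        using emeasure_space_le_1 sets_eq_imp_space_eq[OF sets_kernel[OF Ks x]] by (simp add: indicator_def)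
    qed
    also have "\<dots> < \<infinity>" using prob_space.emeasure_space_1[OF prob_space_unit_lebesgue] by simp
    finally show "emeasure (kernel_measure K) (space (kernel_measure K)) \<noteq> \<infinity>" by simp
  qed
  obtain S where S: "S \<in> null_sets unit_lebesgue2"
    "\<And>A. A \<in> null_sets unit_lebesgue2 \<Longrightarrow> emeasure (kernel_measure K) (A - S) = 0"
    using Lebesgue_decomposition_set[OF fin sets_kernel_measure[OF Ks]] by metis
  have S': "S \<in> sets unit_lebesgue2" using S(1) by auto
  let ?C = "space unit_lebesgue2 - S"
  have C: "?C \<in> sets unit_lebesgue2" using S' by simp
  have "AE x in ?L. absolutely_continuous ?L (restrict_kernel K ?C x)"
    by (rule AE_restrict_kernel_absolutely_continuous[OF Ks S']) (rule S(2))
  moreover have "AE x in ?L. AE y in ?L. (x, y) \<notin> S" by (rule P.AE_pair[OF AE_not_in[OF S(1)]])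
  ultimately have "AE x in ?L. absolutely_continuous ?L (restrict_kernel K ?C x) \<and> (AE y in ?L. (x, y) \<notin> S)"
    by eventually_elim simp
  then obtain N where N0: "\<And>x. x \<in> space ?L - N \<Longrightarrow>
      absolutely_continuous ?L (restrict_kernel K ?C x) \<and> (AE y in ?L. (x, y) \<notin> S)" "N \<in> null_sets ?L"
    by (rule AE_E3) (rule that)
  note N = N0(2) N0(1)[unfolded space_unit_lebesgue]
  have N': "N \<in> sets ?L" using N(1) by auto
  have Lp: "(\<lambda>_. ?L) \<in> ?L \<rightarrow>\<^sub>M prob_algebra ?L"
    using prob_space_unit_lebesgue by (intro measurable_const) (simp add: space_prob_algebra)
  \<comment> \<open>On the exceptional set Lebesgue measure is the default, since it is its own
    absolutely continuous part.\<close>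
  define K' where "K' x = (if x \<in> N then ?L else K x)" for x
  define Ka where "Ka x = (if x \<in> N then ?L else restrict_kernel K ?C x)" for x
  define Ksing where "Ksing x = (if x \<in> N then null_measure ?L else restrict_kernel K S x)" for x
  have "K' \<in> ?L \<rightarrow>\<^sub>M prob_algebra ?L"
    unfolding K'_def by (rule measurable_kernel_If[OF Lp K N'])
  moreover have "AE x in ?L. K x = K' x"
    using AE_not_in[OF N(1)] by (rule AE_mp) (simp add: K'_def)
  moreover have "kernel_decomposition K' (Ka, \<lambda>_. null_measure ?L, Ksing)"
    unfolding kernel_decomposition_def prod.case
  proof (intro conjI ballI null_measure_kernel)
    show "Ka \<in> ?L \<rightarrow>\<^sub>M subprob_algebra ?L"
      unfolding Ka_def by (rule measurable_kernel_If[OF measurable_prob_algebraD[OF Lp] restrict_kernel_measurable[OF Ks C] N'])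
    show "Ksing \<in> ?L \<rightarrow>\<^sub>M subprob_algebra ?L"
      unfolding Ksing_def by (rule measurable_kernel_If[OF null_measure_kernel restrict_kernel_measurable[OF Ks S'] N'])
    fix x assume x: "x \<in> unit_interval"
    then have xs: "x \<in> space ?L" by simp
    show "absolutely_continuous ?L (Ka x)"
      using N(2) x by (cases "x \<in> N") (auto simp: Ka_def absolutely_continuous_def)
    show "discrete_measure (null_measure ?L)"
      unfolding discrete_measure_def by (intro bexI[of _ "{}"]) auto
    have sK: "sets (K x) = sets ?L" by (rule sets_kernel[OF Ks xs])
    show "singular_measure (Ksing x)"
    proof (cases "x \<in> N")
      case True
      then show ?thesis by (auto simp: Ksing_def singular_measure_def)
    next
      case False
      then have Kx: "Ksing x = restrict_kernel K S x" by (simp add: Ksing_def)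
      have s: "sets (restrict_kernel K S x) = sets ?L" using sK by (simp add: restrict_kernel_def)
      have sp: "space (restrict_kernel K S x) = unit_interval" using sets_eq_imp_space_eq[OF s] by simp
      let ?T = "Pair x -` S"
      have T: "?T \<in> sets ?L" by (rule sets_Pair1[OF S'])
      have "AE y in ?L. y \<notin> ?T" using N(2) x False by simp
      then have "?T \<in> null_sets ?L" using T AE_iff_null_sets by blast
      moreover have "emeasure (restrict_kernel K S x) (unit_interval - ?T) = 0"
      proof -
        have "unit_interval - ?T \<in> sets ?L" using T Icc_in_sets_unit[of 0 1] by blast
        from emeasure_restrict_kernel[OF Ks S' x this]
        have "emeasure (restrict_kernel K S x) (unit_interval - ?T) = emeasure (K x) ((unit_interval - ?T) \<inter> ?T)" .
        moreover have "(unit_interval - ?T) \<inter> ?T = {}" by blast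
        ultimately show ?thesis by (simp only: emeasure_empty)
      qed
      moreover have "emeasure (restrict_kernel K S x) {y} = 0" if y: "y \<in> unit_interval" for y
      proof -
        have Y: "{y} \<in> sets ?L" using y by (simp add: sets_unit_lebesgue_iff)
        have "emeasure (restrict_kernel K S x) {y} = emeasure (K x) ({y} \<inter> ?T)"
          by (rule emeasure_restrict_kernel[OF Ks S' x Y])
        also have "\<dots> \<le> emeasure (K x) {y}" using Y sK by (intro emeasure_mono) auto
        finally show ?thesis using atomless[OF x y] by simp
      qed
      ultimately show ?thesis unfolding Kx singular_measure_def sp by blast
    qed
    fix F assume F: "F \<in> sets ?L"
    show "emeasure (K' x) F = emeasure (Ka x) F + emeasure (null_measure ?L) F + emeasure (Ksing x) F"
    proof (cases "x \<in> N")
      case True then show ?thesis by (simp add: K'_def Ka_def Ksing_def)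
    next
      case False
      have "emeasure (K x) (F \<inter> Pair x -` ?C) + emeasure (K x) (F \<inter> Pair x -` S)
          = emeasure (K x) ((F \<inter> Pair x -` ?C) \<union> (F \<inter> Pair x -` S))"
        using F sK sets_Pair1[OF C] sets_Pair1[OF S'] by (intro plus_emeasure) auto
      also have "(F \<inter> Pair x -` ?C) \<union> (F \<inter> Pair x -` S) = F"
        using sets.sets_into_space[OF F] xs by (auto simp: space_pair_measure)
      finally show ?thesis
        using False emeasure_restrict_kernel[OF Ks C x F] emeasure_restrict_kernel[OF Ks S' x F]
        by (simp add: K'_def Ka_def Ksing_def)
    qed
  qed
  ultimately show thesis using that by blast
qed

section \<open>Typical Extreme Value copulas\<close>

text \<open>Borel-Cantelli: the summable masses make \<open>limsup A\<close> a null set of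
  \<open>M\<close>, hence of \<open>N\<close>; but it is a decreasing limit of unions that all have
  \<open>N\<close>-mass at least \<open>c\<close>.\<close>

lemma absolutely_continuous_small_sets:
  assumes M: "finite_measure M" and N: "finite_measure N" and sets: "sets N = sets M"
    and ac: "absolutely_continuous M N" and A: "\<And>n::nat. A n \<in> sets M"
    and small: "\<And>n. measure M (A n) \<le> C / 2 ^ n" and big: "\<And>n. c \<le> measure N (A n)"
  shows "c \<le> 0"
proof -
  interpret M: finite_measure M by fact
  interpret N: finite_measure N by fact
  have "summable (\<lambda>n. C * (1 / 2) ^ n)" by (intro summable_mult summable_geometric) simp
  then have "summable (\<lambda>n. measure M (A n))"
  proof (rule summable_comparison_test')
    fix n show "norm (measure M (A n)) \<le> C * (1 / 2) ^ n"
      using small[of n] by (simp add: power_one_over)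
  qed
  then have "limsup A \<in> null_sets M"
    using A by (intro borel_cantelli_limsup1) (auto simp: M.emeasure_eq_measure)
  then have "limsup A \<in> null_sets N" using ac by (auto simp: absolutely_continuous_def)
  moreover have "limsup A = (\<Inter>n. \<Union>k\<in>{n..}. A k)" by (simp add: limsup_INF_SUP)
  ultimately have 0: "measure N (\<Inter>n. \<Union>k\<in>{n..}. A k) = 0" by (simp add: null_sets_def measure_def)
  have "(\<lambda>n. measure N (\<Union>k\<in>{n..}. A k)) \<longlonglongrightarrow> measure N (\<Inter>n. \<Union>k\<in>{n..}. A k)"
  proof (rule N.finite_Lim_measure_decseq)
    show "range (\<lambda>n. \<Union>k\<in>{n..}. A k) \<subseteq> sets N" using A sets by auto
    show "decseq (\<lambda>n. \<Union>k\<in>{n..}. A k)" unfolding decseq_def by (intro allI impI UN_mono) auto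
  qed
  moreover have "c \<le> measure N (\<Union>k\<in>{n..}. A k)" for n
  proof -
    have "A n \<subseteq> (\<Union>k\<in>{n..}. A k)" by blast
    then have "measure N (A n) \<le> measure N (\<Union>k\<in>{n..}. A k)"
      using A sets by (intro N.finite_measure_mono) auto
    then show ?thesis using big[of n] by linarith
  qed
  ultimately show ?thesis unfolding 0 by (intro LIMSEQ_le_const) auto
qed

lemma AE_unit_lebesgue_interior: "AE x in unit_lebesgue. x \<in> {0<..<1}"
proof -
  have "AE x in lborel. x \<noteq> 0 \<and> x \<noteq> (1::real)"
    using AE_lborel_singleton[of "0::real"] AE_lborel_singleton[of "1::real"] by eventually_elim simp
  then have "AE x in lborel. x \<in> unit_interval \<longrightarrow> x \<in> {0<..<1::real}"
    by eventually_elim auto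
  then show ?thesis by (subst AE_restrict_space_iff) auto
qed

section \<open>Atoms and absolute continuity of the conditional distributions\<close>

context profile
begin

lemma cond_kernel_Ioc:
  assumes x: "x \<in> {0<..<1}" and y: "0 \<le> a" "a \<le> b" "b \<le> 1"
  shows "measure (cond_kernel h x) {a<..b} = cond_cdf h x b - cond_cdf h x a"
proof -
  interpret prob_space "cond_kernel h x" by (rule prob_space_cond_kernel)
  have m: "measure (cond_kernel h x) {0..t} = cond_cdf h x t" if "0 \<le> t" "t \<le> 1" for t
    using emeasure_cond_kernel_Icc[OF x that] cond_cdf_bounds(1)[OF x] by (simp add: measure_def)
  have S: "{0..b} \<in> sets (cond_kernel h x)" "{0..a} \<in> sets (cond_kernel h x)"
    unfolding sets_cond_kernel using y by (intro Icc_in_sets_unit; simp)+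
  have "{0..b} - {0..a} = {a<..b}" using y by auto
  moreover have "measure (cond_kernel h x) ({0..b} - {0..a}) = measure (cond_kernel h x) {0..b} - measure (cond_kernel h x) {0..a}"
    using S y by (intro finite_measure_Diff) auto
  ultimately show ?thesis using m y by simp
qed

text \<open>For \<open>y < 1\<close> this is continuity of the factors. As \<open>y\<close> tends to
  \<open>1\<close>, the argument of \<open>rderiv h\<close> tends to infinity, and
  \<open>s \<le> h s\<close> forces the slopes of chords starting at \<open>1\<close>, hence
  \<open>rderiv h\<close>, up to \<open>1\<close>; so no mass sits at \<open>y = 1\<close>.\<close>

lemma tendsto_cond_cdf_left:
  assumes cont: "\<And>s. 0 < s \<Longrightarrow> (rderiv h \<longlongrightarrow> rderiv h s) (at s)"
    and x: "x \<in> {0<..<1}" and y: "0 < y" "y \<le> 1"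
  shows "(cond_cdf h x \<longlongrightarrow> cond_cdf h x y) (at_left y)"
proof (cases "y < 1")
  case True
  then have y': "y \<in> {0<..<1}" using y by simp
  have "((\<lambda>t. ev_fun h x t / x * rderiv h (ln x / ln t)) \<longlongrightarrow> ev_fun h x y / x * rderiv h (ln x / ln y)) (at_left y)"
  proof (intro tendsto_intros isCont_tendsto_compose[where g="rderiv h"])
    show "(ev_fun h x \<longlongrightarrow> ev_fun h x y) (at_left y)"
      using continuous_ev_fun_right[OF x y'] by (rule tendsto_within_subset) simp
    show "isCont (rderiv h) (ln x / ln y)" using cont[OF ln_ratio_pos[OF x y']] by (simp add: isCont_def)
  qed (use x y' in auto)
  moreover have "\<forall>\<^sub>F t in at_left y. ev_fun h x t / x * rderiv h (ln x / ln t) = cond_cdf h x t"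
    using eventually_at_left_real[OF y(1)] by eventually_elim (use True in \<open>simp add: cond_cdf_def\<close>)
  ultimately have "(cond_cdf h x \<longlongrightarrow> ev_fun h x y / x * rderiv h (ln x / ln y)) (at_left y)"
    by (rule Lim_transform_eventually)
  moreover have "cond_cdf h x y = ev_fun h x y / x * rderiv h (ln x / ln y)"
    using y' by (simp add: cond_cdf_def)
  ultimately show ?thesis by simp
next
  case False
  then have y1: "y = 1" using y by simp
  have "(cond_cdf h x \<longlongrightarrow> 1) (at_left 1)"
  proof (rule tendsto_sandwich)
    show "\<forall>\<^sub>F t in at_left 1. cond_cdf h x t \<le> 1" using cond_cdf_bounds[OF x] by simp
    have "x < 1" using x by simp
    from eventually_at_left_real[OF this]
    show "\<forall>\<^sub>F t in at_left 1. t * (1 - (h 1 - 1) * ln t / (ln x - ln t)) \<le> cond_cdf h x t"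
    proof eventually_elim
      case (elim t)
      then have t: "t \<in> {0<..<1}" "x < t" using x by auto
      define s where "s = ln x / ln t"
      have lns: "ln x < ln t" "ln t < 0" using t x by auto
      then have s: "1 < s" by (simp add: s_def neg_less_divide_eq)
      \<comment> \<open>The explicit bound is the chord-slope estimate
        \<open>(s - h 1) / (s - 1)\<close> written in terms of \<open>t\<close>, so that its limit
        at \<open>1\<close> can be computed directly.\<close>
      have "1 - (h 1 - 1) * ln t / (ln x - ln t) = (s - h 1) / (s - 1)"
        using lns by (simp add: s_def field_simps)
      also have "\<dots> \<le> (h s - h 1) / (s - 1)" using ge_id[of s] s by (intro divide_right_mono) auto
      also have "\<dots> \<le> rderiv h s" using s by (intro slope_le_rderiv) auto
      finally have 1: "1 - (h 1 - 1) * ln t / (ln x - ln t) \<le> rderiv h s" .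
      have 2: "t \<le> ev_fun h x t / x" using ev_fun_ge_mult[OF x t(1)] x by (simp add: field_simps)
      have "t * (1 - (h 1 - 1) * ln t / (ln x - ln t)) \<le> t * rderiv h s"
        using 1 t by (intro mult_left_mono) auto
      also have "\<dots> \<le> ev_fun h x t / x * rderiv h s"
        using 2 rderiv_nonneg[of s] s by (intro mult_right_mono) auto
      finally show ?case using t by (simp add: cond_cdf_def s_def)
    qed
    have "((\<lambda>t. t * (1 - (h 1 - 1) * ln t / (ln x - ln t))) \<longlongrightarrow> 1 * (1 - (h 1 - 1) * ln 1 / (ln x - ln 1))) (at_left 1)"
      using x by (intro tendsto_intros) auto
    then show "((\<lambda>t. t * (1 - (h 1 - 1) * ln t / (ln x - ln t))) \<longlongrightarrow> 1) (at_left 1)" by simp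
  qed simp
  then show ?thesis by (simp add: y1 cond_cdf_def[of h x 1])
qed

lemma cond_kernel_atomless:
  assumes cont: "\<And>s. 0 < s \<Longrightarrow> (rderiv h \<longlongrightarrow> rderiv h s) (at s)"
    and x: "x \<in> unit_interval" and y: "y \<in> unit_interval"
  shows "emeasure (cond_kernel h x) {y} = 0"
proof (cases "x \<in> {0<..<1}")
  case False
  then show ?thesis using unit_lebesgue_singleton by (simp only: cond_kernel_def if_False)
next
  case True
  interpret prob_space "cond_kernel h x" by (rule prob_space_cond_kernel)
  show ?thesis
  proof (cases "y = 0")
    case True
    then show ?thesis using emeasure_cond_kernel_Icc[OF \<open>x \<in> {0<..<1}\<close>, of 0] by (simp add: cond_cdf_def)
  next
    case False
    then have y': "0 < y" "y \<le> 1" using y by auto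
    have "measure (cond_kernel h x) {y} \<le> 0"
    proof (rule tendsto_lowerbound)
      show "((\<lambda>z. cond_cdf h x y - cond_cdf h x z) \<longlongrightarrow> 0) (at_left y)"
        using tendsto_diff[OF tendsto_const tendsto_cond_cdf_left[OF cont True y'], of "cond_cdf h x y"] by simp
      show "\<forall>\<^sub>F z in at_left y. measure (cond_kernel h x) {y} \<le> cond_cdf h x y - cond_cdf h x z"
        using eventually_at_left_real[OF y'(1)]
      proof eventually_elim
        case (elim z)
        have "{z<..y} \<in> sets (cond_kernel h x)"
          unfolding sets_cond_kernel sets_unit_lebesgue_iff using elim y' by auto
        then have "measure (cond_kernel h x) {y} \<le> measure (cond_kernel h x) {z<..y}"
          using elim by (intro finite_measure_mono) auto
        then show ?case using cond_kernel_Ioc[OF True, of z y] elim y' by simp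
      qed
    qed simp
    then show ?thesis using measure_nonneg[of "cond_kernel h x" "{y}"] by (simp add: emeasure_eq_measure)
  qed
qed

text \<open>\<open>exp (ln x / p)\<close> is the \<open>y\<close> at which
  \<open>ln x / ln y\<close> equals \<open>p\<close>; it transports intervals of arguments of
  \<open>h\<close> to intervals of \<open>y\<close>.\<close>

lemma cond_cdf_level:
  fixes x p :: real
  assumes x: "x \<in> {0<..<1}" and p: "0 < p"
  shows "exp (ln x / p) \<in> {0<..<1}" "ln x / ln (exp (ln x / p)) = p"
  using x p by (auto simp: divide_neg_pos)

text \<open>The neighbourhoods of grid points are transported to \<open>y\<close> by
  \<open>p \<mapsto> exp (ln x / p)\<close>. As they lie beyond \<open>1 / 2\<close>, lengths grow
  at most by the factor \<open>- 4 * ln x\<close>, and the images lie above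
  \<open>exp (2 * ln x)\<close>. There \<open>ev_fun h x y / x \<ge> y \<ge> exp (2 * ln x)\<close>,
  which turns the increase of \<open>rderiv h\<close> into mass.\<close>

lemma thin_sets_exist:
  assumes x: "x \<in> {0<..<1}" and h: "ev_of h \<notin> thin_jump_set n"
  obtains A where "A \<in> sets unit_lebesgue" "measure unit_lebesgue A \<le> (- 4 * ln x) / 2 ^ n"
    "exp (2 * ln x) * ((1 - (h 2 - h 1)) / 2) \<le> measure (cond_kernel h x) A"
proof -
  obtain m r where m: "2 \<le> m" and r: "0 < r" "4 * real m * r \<le> 1" "4 * r * (real m * real m + 1) \<le> 1 / 2 ^ n"
    and "\<not> (\<Sum>i=m..m * m. slope_jump (\<lambda>s. tail_fun (ev_of h) s 1) (real i / real m) r)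
      \<le> (1 - (tail_fun (ev_of h) 2 1 - tail_fun (ev_of h) 1 1)) / 2"
    using h ev_of_in_ev_copulas unfolding thin_jump_set_def by blast
  then have jumps: "(1 - (h 2 - h 1)) / 2 < (\<Sum>i=m..m * m. slope_jump h (real i / real m) r)"
    using sum_slope_jump_tail_fun[OF _ r(2,1)] tail_fun_ev_of by simp
  define lo hi where "lo i = real i / real m - 2 * r" and "hi i = real i / real m + 2 * r" for i
  let ?y = "\<lambda>p. exp (ln x / p)" and ?I = "{m..m * m}"
  let ?B = "\<lambda>i. {?y (lo i)<..?y (hi i)}"
  have lo: "1 / 2 \<le> lo i" if "i \<in> ?I" for i
    unfolding lo_def using that m r by (intro thin_jump_arg) auto
  have hi: "lo i < hi i" for i using r by (simp add: lo_def hi_def)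
  have lnx: "ln x < 0" using x by simp
  have ymono: "?y p \<le> ?y q" if "0 < p" "p \<le> q" for p q
    using that lnx by (simp add: divide_left_mono_neg)
  have Bsets: "?B i \<in> sets unit_lebesgue" if "i \<in> ?I" for i
  proof -
    have "0 < hi i" using lo[OF that] hi[of i] by linarith
    then have "?y (hi i) \<le> 1" using cond_cdf_level(1)[OF x] by force
    have "?B i \<subseteq> unit_interval"
    proof
      fix t assume "t \<in> ?B i"
      then have "?y (lo i) < t" "t \<le> ?y (hi i)" by simp_all
      then show "t \<in> unit_interval"
        unfolding atLeastAtMost_iff using exp_gt_zero[of "ln x / lo i"] \<open>?y (hi i) \<le> 1\<close> by linarith
    qed
    then show ?thesis by (simp add: sets_unit_lebesgue_iff)
  qed
  have sepa: "hi i \<le> lo j" if "i < j" for i j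
  proof -
    have "4 * r \<le> 1 / real m" using r(2) m by (simp add: field_simps)
    moreover have "real i / real m + 1 / real m \<le> real j / real m"
      using that m by (simp add: divide_right_mono flip: add_divide_distrib)
    ultimately show ?thesis by (simp add: lo_def hi_def)
  qed
  have disj: "disjoint_family_on ?B ?I"
    unfolding disjoint_family_on_def
  proof (intro ballI impI)
    have *: "?B i \<inter> ?B j = {}" if "i \<in> ?I" "i < j" for i j
    proof -
      have "?y (hi i) \<le> ?y (lo j)" using lo[OF that(1)] hi[of i] sepa[OF that(2)] by (intro ymono) auto
      then show ?thesis by auto
    qed
    fix i j assume "i \<in> ?I" "j \<in> ?I" "i \<noteq> j"
    then show "?B i \<inter> ?B j = {}" using *[of i j] *[of j i] by (cases "i < j") auto
  qed
  show thesis
  proof (rule that[of "\<Union>i\<in>?I. ?B i"])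
    show "(\<Union>i\<in>?I. ?B i) \<in> sets unit_lebesgue" using Bsets by (intro sets.finite_UN) auto
    interpret K: prob_space "cond_kernel h x" by (rule prob_space_cond_kernel)
    interpret L: prob_space unit_lebesgue by (rule prob_space_unit_lebesgue)
    have "measure unit_lebesgue (\<Union>i\<in>?I. ?B i) = (\<Sum>i\<in>?I. measure unit_lebesgue (?B i))"
      using Bsets disj by (intro L.finite_measure_finite_Union) auto
    also have "\<dots> \<le> (\<Sum>i\<in>?I. - 16 * ln x * r)"
    proof (rule sum_mono)
      fix i assume i: "i \<in> ?I"
      have pos: "1 / 2 \<le> lo i" "1 / 2 \<le> hi i" using lo[OF i] hi[of i] by auto
      have le: "ln x / lo i \<le> ln x / hi i" using pos hi[of i] lnx by (simp add: divide_left_mono_neg)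
      have neg: "ln x / hi i \<le> 0" using pos lnx by (simp add: divide_nonpos_pos)
      have "measure unit_lebesgue (?B i) = measure lborel (?B i)"
        using Bsets[OF i] by (intro measure_restrict_space) (auto simp: sets_unit_lebesgue_iff)
      also have "\<dots> = ?y (hi i) - ?y (lo i)" using le by simp
      also have "\<dots> = ?y (hi i) * (1 - exp (ln x / lo i - ln x / hi i))"
        by (simp add: right_diff_distrib flip: exp_add)
      also have "\<dots> \<le> 1 * (1 - exp (ln x / lo i - ln x / hi i))"
        using neg le by (intro mult_right_mono) auto
      also have "\<dots> \<le> ln x / hi i - ln x / lo i"
      proof -
        define w where "w = ln x / lo i - ln x / hi i"
        have "1 + w \<le> exp w" by (rule exp_ge_add_one_self)
        then have "1 * (1 - exp w) \<le> - w" by (simp del: exp_ge_add_one_self)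
        then show ?thesis by (simp only: w_def minus_diff_eq)
      qed
      also have "\<dots> = - ln x * (4 * r) / (lo i * hi i)"
      proof -
        have "hi i - lo i = 4 * r" by (simp add: lo_def hi_def)
        moreover have "ln x / hi i - ln x / lo i = - ln x * (hi i - lo i) / (lo i * hi i)"
          using pos by (simp add: field_simps)
        ultimately show ?thesis by simp
      qed
      also have "\<dots> \<le> - ln x * (4 * r) / (1 / 4)"
      proof (rule divide_left_mono)
        have "1 / 2 * (1 / 2) \<le> lo i * hi i" using pos by (intro mult_mono) auto
        then show "1 / 4 \<le> lo i * hi i" by simp
        then show "0 < lo i * hi i * (1 / 4)" by simp
        show "0 \<le> - ln x * (4 * r)" using lnx r by (intro mult_nonneg_nonneg) auto
      qed
      finally show "measure unit_lebesgue (?B i) \<le> - 16 * ln x * r" by simp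
    qed
    also have "\<dots> = real (card ?I) * (- 16 * ln x * r)" by simp
    also have "\<dots> \<le> (real m * real m + 1) * (- 16 * ln x * r)"
    proof (rule mult_right_mono)
      have "card ?I \<le> m * m + 1" using m by simp
      then have "real (card ?I) \<le> real (m * m + 1)" by (simp only: of_nat_le_iff)
      then show "real (card ?I) \<le> real m * real m + 1" by simp
      show "0 \<le> - 16 * ln x * r" using lnx r by (simp add: mult_nonpos_nonneg)
    qed
    also have "\<dots> = (- 4 * ln x) * (4 * r * (real m * real m + 1))" by (simp add: algebra_simps)
    also have "\<dots> \<le> (- 4 * ln x) * (1 / 2 ^ n)" using r(3) lnx by (intro mult_left_mono) auto
    finally show "measure unit_lebesgue (\<Union>i\<in>?I. ?B i) \<le> (- 4 * ln x) / 2 ^ n" by simp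
    have "exp (2 * ln x) * ((1 - (h 2 - h 1)) / 2) \<le> exp (2 * ln x) * (\<Sum>i\<in>?I. slope_jump h (real i / real m) r)"
      using jumps by (intro mult_left_mono) auto
    also have "\<dots> = (\<Sum>i\<in>?I. exp (2 * ln x) * slope_jump h (real i / real m) r)" by (rule sum_distrib_left)
    also have "\<dots> \<le> (\<Sum>i\<in>?I. measure (cond_kernel h x) (?B i))"
    proof (rule sum_mono)
      fix i assume i: "i \<in> ?I"
      have pos: "0 < lo i" "0 < hi i" using lo[OF i] hi[of i] by auto
      note ylo = cond_cdf_level[OF x pos(1)] and yhi = cond_cdf_level[OF x pos(2)]
      have D: "slope_jump h (real i / real m) r \<le> rderiv h (hi i) - rderiv h (lo i)"
        unfolding hi_def lo_def using pos r by (intro slope_jump_bounds(2)) (auto simp: lo_def)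
      have D0: "0 \<le> rderiv h (hi i) - rderiv h (lo i)" using rderiv_mono[of "lo i" "hi i"] pos hi[of i] by simp
      have "2 * ln x \<le> ln x / lo i"
        using divide_left_mono_neg[of "1 / 2" "lo i" "ln x"] lo[OF i] lnx by simp
      then have "exp (2 * ln x) \<le> ?y (lo i)" by simp
      also have "\<dots> \<le> ev_fun h x (?y (lo i)) / x" using ev_fun_ge_mult[OF x ylo(1)] x by (simp add: field_simps)
      finally have c: "exp (2 * ln x) \<le> ev_fun h x (?y (lo i)) / x" .
      have "exp (2 * ln x) * slope_jump h (real i / real m) r \<le> exp (2 * ln x) * (rderiv h (hi i) - rderiv h (lo i))"
        using D by (intro mult_left_mono) auto
      also have "\<dots> \<le> ev_fun h x (?y (lo i)) / x * (rderiv h (hi i) - rderiv h (lo i))"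
        using c D0 by (intro mult_right_mono)
      also have "\<dots> \<le> cond_cdf h x (?y (hi i)) - cond_cdf h x (?y (lo i))"
        using cond_cdf_diff(1)[OF x ylo(1) yhi(1)] ymono[of "lo i" "hi i"] pos hi[of i]
        unfolding ylo(2) yhi(2) by simp
      also have "\<dots> = measure (cond_kernel h x) (?B i)"
        using ylo(1) yhi(1) ymono[of "lo i" "hi i"] pos hi[of i] by (intro cond_kernel_Ioc[OF x, symmetric]) auto
      finally show "exp (2 * ln x) * slope_jump h (real i / real m) r \<le> measure (cond_kernel h x) (?B i)" .
    qed
    also have "\<dots> = measure (cond_kernel h x) (\<Union>i\<in>?I. ?B i)"
      using Bsets disj by (intro K.finite_measure_finite_Union[symmetric]) (auto simp: sets_cond_kernel)
    finally show "exp (2 * ln x) * ((1 - (h 2 - h 1)) / 2) \<le> measure (cond_kernel h x) (\<Union>i\<in>?I. ?B i)" .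
  qed
qed

text \<open>Outside all thin jump sets there are sets of geometrically small measure whose mass is
  bounded below, and outside \<open>affine_set\<close> that lower bound is positive.\<close>

lemma cond_kernel_not_absolutely_continuous:
  assumes x: "x \<in> {0<..<1}" and h: "\<And>n. ev_of h \<notin> thin_jump_set n" "ev_of h \<notin> affine_set"
  shows "\<not> absolutely_continuous unit_lebesgue (cond_kernel h x)"
proof
  assume ac: "absolutely_continuous unit_lebesgue (cond_kernel h x)"
  have "\<forall>n. \<exists>A. A \<in> sets unit_lebesgue \<and> measure unit_lebesgue A \<le> (- 4 * ln x) / 2 ^ n \<and>
    exp (2 * ln x) * ((1 - (h 2 - h 1)) / 2) \<le> measure (cond_kernel h x) A"
    using thin_sets_exist[OF x h(1)] by metis
  then obtain A where A: "\<And>n. A n \<in> sets unit_lebesgue" "\<And>n. measure unit_lebesgue (A n) \<le> (- 4 * ln x) / 2 ^ n"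
    "\<And>n. exp (2 * ln x) * ((1 - (h 2 - h 1)) / 2) \<le> measure (cond_kernel h x) (A n)" by metis
  have "finite_measure (cond_kernel h x)"
    using prob_space_cond_kernel by (simp add: prob_space_def)
  then have "exp (2 * ln x) * ((1 - (h 2 - h 1)) / 2) \<le> 0"
    by (rule absolutely_continuous_small_sets[OF finite_measure_unit_lebesgue _ sets_cond_kernel ac A])
  moreover have "h 2 - h 1 < 1" using h(2) ev_of_in_ev_copulas by (simp add: affine_set_def tail_fun_ev_of)
  ultimately show False by (simp add: mult_le_0_iff)
qed

section \<open>Components of the copula of a profile\<close>

lemma is_copula_kernelD:
  assumes "is_copula_kernel C K"
  shows "K \<in> unit_lebesgue \<rightarrow>\<^sub>M prob_algebra unit_lebesgue"
    and "E \<in> sets unit_lebesgue \<Longrightarrow> F \<in> sets unit_lebesgue \<Longrightarrow>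
      emeasure (copula_measure C) (E \<times> F) = (\<integral>\<^sup>+x\<in>E. emeasure (K x) F \<partial>unit_lebesgue)"
  using assms unfolding is_copula_kernel_def by blast+

lemma is_copula_kernel_AE:
  assumes K: "is_copula_kernel (ev_of h) K" shows "AE x in unit_lebesgue. K x = cond_kernel h x"
proof (rule AE_kernel_eq[OF _ cond_kernel_measurable_subprob])
  show "K \<in> unit_lebesgue \<rightarrow>\<^sub>M subprob_algebra unit_lebesgue"
    by (rule measurable_prob_algebraD[OF is_copula_kernelD(1)[OF K]])
  fix E F assume EF: "E \<in> sets unit_lebesgue" "F \<in> sets unit_lebesgue"
  show "(\<integral>\<^sup>+x\<in>E. emeasure (K x) F \<partial>unit_lebesgue) = (\<integral>\<^sup>+x\<in>E. emeasure (cond_kernel h x) F \<partial>unit_lebesgue)"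
    using is_copula_kernelD(2)[OF K EF] is_copula_kernelD(2)[OF is_copula_kernel_cond_kernel EF] by simp
qed

text \<open>The chosen parts belong to some version \<open>K\<close> of the kernel, which agrees
  with \<open>cond_kernel h\<close> for almost every \<open>x\<close> by
  \<open>is_copula_kernel_AE\<close>; for total masses this is enough.\<close>

lemma copula_kernel_partsE:
  assumes atomless: "\<And>x y. x \<in> unit_interval \<Longrightarrow> y \<in> unit_interval \<Longrightarrow> emeasure (cond_kernel h x) {y} = 0"
  obtains K Ka Kd Ks where "copula_kernel_parts (ev_of h) = (Ka, Kd, Ks)"
    "is_copula_kernel (ev_of h) K" "kernel_decomposition K (Ka, Kd, Ks)"
proof -
  obtain K' P where K': "K' \<in> unit_lebesgue \<rightarrow>\<^sub>M prob_algebra unit_lebesgue"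
    "AE x in unit_lebesgue. cond_kernel h x = K' x" "kernel_decomposition K' P"
    using kernel_decomposition_exists[OF cond_kernel_measurable atomless] by metis
  have "is_copula_kernel (ev_of h) K'"
    unfolding is_copula_kernel_def
  proof (intro conjI ballI K'(1))
    fix E F assume EF: "E \<in> sets unit_lebesgue" "F \<in> sets unit_lebesgue"
    have "emeasure (copula_measure (ev_of h)) (E \<times> F) = (\<integral>\<^sup>+x\<in>E. emeasure (cond_kernel h x) F \<partial>unit_lebesgue)"
      by (rule is_copula_kernelD(2)[OF is_copula_kernel_cond_kernel EF])
    also have "\<dots> = (\<integral>\<^sup>+x\<in>E. emeasure (K' x) F \<partial>unit_lebesgue)"
      by (rule nn_integral_cong_AE) (use K'(2) in \<open>eventually_elim, simp\<close>)
    finally show "emeasure (copula_measure (ev_of h)) (E \<times> F) = (\<integral>\<^sup>+x\<in>E. emeasure (K' x) F \<partial>unit_lebesgue)" .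
  qed
  then have "\<exists>P K. is_copula_kernel (ev_of h) K \<and> kernel_decomposition K P" using K'(3) by blast
  then have "\<exists>K. is_copula_kernel (ev_of h) K \<and> kernel_decomposition K (copula_kernel_parts (ev_of h))"
    unfolding copula_kernel_parts_def by (rule someI_ex)
  then show thesis using that by (metis prod_cases3)
qed

lemma emeasure_kernel_measure_square:
  assumes K: "K \<in> unit_lebesgue \<rightarrow>\<^sub>M subprob_algebra unit_lebesgue"
  shows "emeasure (kernel_measure K) unit_square = (\<integral>\<^sup>+x. emeasure (K x) unit_interval \<partial>unit_lebesgue)"
  using emeasure_kernel_measure[OF K Icc_in_sets_unit Icc_in_sets_unit, of 0 1 0 1]
  by (simp cong: nn_integral_cong_simp)

text \<open>A discrete measure dominated by one without atoms vanishes: it lives on a countable set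
  whose points all have mass zero.\<close>

lemma dis_component_null:
  assumes atomless: "\<And>x y. x \<in> unit_interval \<Longrightarrow> y \<in> unit_interval \<Longrightarrow> emeasure (cond_kernel h x) {y} = 0"
  shows "emeasure (dis_component (ev_of h)) unit_square = 0"
proof -
  obtain K Ka Kd Ks where parts: "copula_kernel_parts (ev_of h) = (Ka, Kd, Ks)"
    "is_copula_kernel (ev_of h) K" "kernel_decomposition K (Ka, Kd, Ks)"
    using copula_kernel_partsE[OF atomless] by metis
  have Kd: "Kd \<in> unit_lebesgue \<rightarrow>\<^sub>M subprob_algebra unit_lebesgue"
    using parts(3) unfolding kernel_decomposition_def prod.case by blast
  have "AE x in unit_lebesgue. emeasure (Kd x) unit_interval = 0"
    using is_copula_kernel_AE[OF parts(2)]
  proof (rule AE_mp, intro AE_I2 impI)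
    fix x assume x: "x \<in> space unit_lebesgue" and eq: "K x = cond_kernel h x"
    then have x': "x \<in> unit_interval" by simp
    have s: "sets (Kd x) = sets unit_lebesgue" by (rule sets_kernel[OF Kd x])
    have sp: "space (Kd x) = unit_interval" using sets_eq_imp_space_eq[OF s] by simp
    have dec: "emeasure (K x) F = emeasure (Ka x) F + emeasure (Kd x) F + emeasure (Ks x) F" if "F \<in> sets unit_lebesgue" for F
      using parts(3) x' that unfolding kernel_decomposition_def prod.case by blast
    have atom: "emeasure (Kd x) {y} = 0" if y: "y \<in> unit_interval" for y
    proof -
      have "{y} \<in> sets unit_lebesgue" using y by (simp add: sets_unit_lebesgue_iff)
      from dec[OF this] show ?thesis using atomless[OF x' y] eq by simp
    qed
    obtain S where S: "S \<in> sets (Kd x)" "countable S" "emeasure (Kd x) (space (Kd x) - S) = 0"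
      using parts(3) x' unfolding kernel_decomposition_def prod.case discrete_measure_def by blast
    have "S \<subseteq> unit_interval" using sets.sets_into_space[OF S(1)] sp by simp
    then have "{y} \<in> null_sets (Kd x)" if "y \<in> S" for y
      using that atom s by (auto simp: null_sets_def sets_unit_lebesgue_iff)
    then have "(\<Union>y\<in>S. {y}) \<in> null_sets (Kd x)" by (intro null_sets_UN' S(2))
    moreover have "space (Kd x) - S \<in> null_sets (Kd x)" using S by (auto simp: null_sets_def)
    ultimately have "(\<Union>y\<in>S. {y}) \<union> (space (Kd x) - S) \<in> null_sets (Kd x)" by (rule null_sets.Un)
    moreover have "(\<Union>y\<in>S. {y}) \<union> (space (Kd x) - S) = unit_interval"
      using \<open>S \<subseteq> unit_interval\<close> unfolding sp by blast
    ultimately show "emeasure (Kd x) unit_interval = 0" by (simp only: null_sets_def mem_Collect_eq)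
  qed
  then have "(\<integral>\<^sup>+x. emeasure (Kd x) unit_interval \<partial>unit_lebesgue) = (\<integral>\<^sup>+x. 0 \<partial>unit_lebesgue)"
    by (rule nn_integral_cong_AE)
  then show ?thesis
    unfolding dis_component_def parts(1) fst_conv snd_conv emeasure_kernel_measure_square[OF Kd] by simp
qed

text \<open>Total mass \<open>1\<close> forces the absolutely continuous part to have mass
  \<open>1\<close> for almost every \<open>x\<close>; the other two parts then vanish, and almost
  every kernel measure would be absolutely continuous.\<close>

lemma abs_component_ne_one:
  assumes atomless: "\<And>x y. x \<in> unit_interval \<Longrightarrow> y \<in> unit_interval \<Longrightarrow> emeasure (cond_kernel h x) {y} = 0"
    and not_ac: "\<And>x. x \<in> {0<..<1} \<Longrightarrow> \<not> absolutely_continuous unit_lebesgue (cond_kernel h x)"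
  shows "emeasure (abs_component (ev_of h)) unit_square \<noteq> 1"
proof
  assume one: "emeasure (abs_component (ev_of h)) unit_square = 1"
  interpret L: prob_space unit_lebesgue by (rule prob_space_unit_lebesgue)
  obtain K Ka Kd Ks where parts: "copula_kernel_parts (ev_of h) = (Ka, Kd, Ks)"
    "is_copula_kernel (ev_of h) K" "kernel_decomposition K (Ka, Kd, Ks)"
    using copula_kernel_partsE[OF atomless] by metis
  have Ka: "Ka \<in> unit_lebesgue \<rightarrow>\<^sub>M subprob_algebra unit_lebesgue"
    using parts(3) unfolding kernel_decomposition_def prod.case by blast
  have K: "K \<in> unit_lebesgue \<rightarrow>\<^sub>M prob_algebra unit_lebesgue"
    by (rule is_copula_kernelD(1)[OF parts(2)])
  have I: "unit_interval \<in> sets unit_lebesgue" by (intro Icc_in_sets_unit) simp_all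
  have meas: "(\<lambda>x. emeasure (Ka x) unit_interval) \<in> borel_measurable unit_lebesgue"
    by (rule measurable_emeasure_kernel[OF Ka I])
  have int: "(\<integral>\<^sup>+x. emeasure (Ka x) unit_interval \<partial>unit_lebesgue) = 1"
    using one unfolding abs_component_def parts(1) fst_conv emeasure_kernel_measure_square[OF Ka] .
  have le: "emeasure (Ka x) unit_interval \<le> 1" if x: "x \<in> space unit_lebesgue" for x
  proof -
    interpret subprob_space "Ka x" by (rule subprob_space_kernel[OF Ka x])
    show ?thesis using emeasure_space_le_1 sets_eq_imp_space_eq[OF sets_kernel[OF Ka x]] by simp
  qed
  have "(\<integral>\<^sup>+x. 1 - emeasure (Ka x) unit_interval \<partial>unit_lebesgue)
      = (\<integral>\<^sup>+x. 1 \<partial>unit_lebesgue) - (\<integral>\<^sup>+x. emeasure (Ka x) unit_interval \<partial>unit_lebesgue)"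
    using le meas int by (intro nn_integral_diff AE_I2) auto
  also have "\<dots> = 0" unfolding int using L.emeasure_space_1 by simp
  finally have "AE x in unit_lebesgue. 1 - emeasure (Ka x) unit_interval = 0"
    using meas by (subst (asm) nn_integral_0_iff_AE) auto
  then have "AE x in unit_lebesgue. False"
    using is_copula_kernel_AE[OF parts(2)] AE_unit_lebesgue_interior AE_space
  proof eventually_elim
    case (elim x)
    have xs: "x \<in> space unit_lebesgue" by fact
    then have x': "x \<in> unit_interval" by simp
    have g1: "emeasure (Ka x) unit_interval = 1"
      using elim(1) le[OF xs] by (metis ennreal_minus_eq_0 antisym)
    have dec: "emeasure (K x) F = emeasure (Ka x) F + emeasure (Kd x) F + emeasure (Ks x) F" if "F \<in> sets unit_lebesgue" for F
      using parts(3) x' that unfolding kernel_decomposition_def prod.case by blast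
    have "emeasure (K x) unit_interval = 1" unfolding elim(2) by (rule emeasure_cond_kernel_space)
    then have "1 + (emeasure (Kd x) unit_interval + emeasure (Ks x) unit_interval) = 1 + 0"
      using dec[OF I] g1 by (simp add: add.assoc)
    then have "emeasure (Kd x) unit_interval + emeasure (Ks x) unit_interval = 0"
      by (subst (asm) ennreal_add_left_cancel) simp
    then have z: "emeasure (Kd x) unit_interval = 0" "emeasure (Ks x) unit_interval = 0" by auto
    have s: "sets (Kd x) = sets unit_lebesgue" "sets (Ks x) = sets unit_lebesgue"
      using parts(3) sets_kernel[OF _ xs] unfolding kernel_decomposition_def prod.case by blast+
    have KF: "emeasure (K x) F = emeasure (Ka x) F" if F: "F \<in> sets unit_lebesgue" for F
    proof -
      have "F \<subseteq> unit_interval" using F sets_unit_lebesgue_iff by blast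
      then have "emeasure (Kd x) F \<le> emeasure (Kd x) unit_interval" "emeasure (Ks x) F \<le> emeasure (Ks x) unit_interval"
        using I s by (auto intro!: emeasure_mono)
      then show ?thesis using z dec[OF F] by simp
    qed
    have "absolutely_continuous unit_lebesgue (Ka x)"
      using parts(3) x' unfolding kernel_decomposition_def prod.case by blast
    then have "emeasure (Ka x) N = 0" if "N \<in> null_sets unit_lebesgue" for N
      using that by (auto simp: absolutely_continuous_def)
    then have "absolutely_continuous unit_lebesgue (cond_kernel h x)"
      using KF sets_cond_kernel elim(2) by (auto simp: absolutely_continuous_def null_sets_def)
    then show False using not_ac[OF elim(3)] by blast
  qed
  then show False using L.AE_False by blast
qed

text \<open>Near \<open>0\<close> the profile is at most \<open>1 + r < h s\<close>, so a chord
  ending at \<open>s\<close> has positive slope.\<close>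

lemma rderiv_pos:
  assumes "\<And>s. 0 < s \<Longrightarrow> 1 < h s" "0 < s" shows "0 < rderiv h s"
proof -
  define r where "r = min (s / 2) ((h s - 1) / 2)"
  have "0 < h s - 1" using assms(1)[OF assms(2)] by simp
  then have r: "0 < r" "r < s" "1 + r < h s" using assms(2) by (auto simp: r_def min_def field_simps)
  have "0 < (h s - h r) / (s - r)" using le_succ[OF r(1)] r by simp
  then show ?thesis using slope_le_rderiv[OF r(1,2)] by simp
qed

text \<open>For each \<open>x\<close> the mass of \<open>(c, d]\<close> is at least a product in
  which \<open>s < h s\<close> makes the increase of \<open>ev_fun h\<close> in \<open>y\<close>
  positive and \<open>1 < h s\<close> makes \<open>rderiv h\<close> positive.\<close>

lemma ev_measure_rectangle_pos:
  assumes gt: "\<And>s. 0 < s \<Longrightarrow> 1 < h s" "\<And>s. 0 < s \<Longrightarrow> s < h s"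
    and ab: "0 < a" "a < b" "b < 1" and cd: "0 < c" "c < d" "d < 1"
  shows "0 < emeasure ev_measure ({a..b} \<times> {c..d})"
proof (rule ccontr)
  have S: "{a..b} \<in> sets unit_lebesgue" "{c..d} \<in> sets unit_lebesgue"
    using ab cd by (intro Icc_in_sets_unit; simp)+
  assume "\<not> 0 < emeasure ev_measure ({a..b} \<times> {c..d})"
  then have "(\<integral>\<^sup>+x\<in>{a..b}. emeasure (cond_kernel h x) {c..d} \<partial>unit_lebesgue) = 0"
    using emeasure_ev_measure[OF S] by (simp add: not_gr_zero)
  moreover have "(\<lambda>x. emeasure (cond_kernel h x) {c..d} * indicator {a..b} x) \<in> borel_measurable unit_lebesgue"
    using measurable_emeasure_kernel[OF cond_kernel_measurable_subprob S(2)] S(1) by measurable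
  ultimately have "AE x in unit_lebesgue. emeasure (cond_kernel h x) {c..d} * indicator {a..b} x = 0"
    by (subst (asm) nn_integral_0_iff_AE)
  then have "AE x in unit_lebesgue. x \<notin> {a..b}"
  proof (rule AE_mp, intro AE_I2 impI)
    fix x assume zero: "emeasure (cond_kernel h x) {c..d} * indicator {a..b} x = 0"
    show "x \<notin> {a..b}"
    proof
      assume xab: "x \<in> {a..b}"
      then have x: "x \<in> {0<..<1}" using ab by auto
      have y: "c \<in> {0<..<1}" "d \<in> {0<..<1}" using cd by auto
      interpret prob_space "cond_kernel h x" by (rule prob_space_cond_kernel)
      have "0 < (ev_fun h x d - ev_fun h x c) / x * rderiv h (ln x / ln c)"
        using x ev_fun_strict_mono_right[OF x y cd(2) gt(2)[OF ln_ratio_pos[OF x y(1)]]]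
          rderiv_pos[OF gt(1) ln_ratio_pos[OF x y(1)]] by simp
      also have "\<dots> \<le> cond_cdf h x d - cond_cdf h x c"
        using cond_cdf_diff(2)[OF x y] cd by simp
      also have "\<dots> = measure (cond_kernel h x) {c<..d}"
        using cd by (intro cond_kernel_Ioc[OF x, symmetric]) auto
      also have "\<dots> \<le> measure (cond_kernel h x) {c..d}"
        using S by (intro finite_measure_mono) (auto simp: sets_cond_kernel)
      finally show False using zero xab by (simp add: emeasure_eq_measure)
    qed
  qed
  then have "{a..b} \<in> null_sets unit_lebesgue" using S(1) AE_iff_null_sets by blast
  moreover have "emeasure unit_lebesgue {a..b} = ennreal (b - a)"
    using ab by (subst emeasure_restrict_space) auto
  ultimately show False using ab by (simp add: null_sets_def)
qed

lemma open_contains_Icc_interior: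
  fixes A :: "real set"
  assumes "open A" "x \<in> A" "x \<in> {0..1}" obtains a b where "0 < a" "a < b" "b < 1" "{a..b} \<subseteq> A"
proof -
  obtain e where e: "0 < e" "\<And>t. \<bar>t - x\<bar> < e \<Longrightarrow> t \<in> A"
    using assms(1,2) unfolding open_dist dist_real_def by blast
  \<comment> \<open>Small enough to stay within \<open>e\<close> of \<open>x\<close> and, moving
    from \<open>x\<close> towards the middle, inside the open unit interval.\<close>
  define k where "k = min e 1 / 4"
  have k: "0 < k" "4 * k \<le> e" "4 * k \<le> 1" using e(1) by (auto simp: k_def)
  show thesis
  proof (cases "x \<le> 1 / 2")
    case True
    show thesis
      by (rule that[of "x + k" "x + (3 / 2) * k"]) (use True k assms(3) e(2) in auto)
  next
    case False
    show thesis
      by (rule that[of "x - (3 / 2) * k" "x - k"]) (use False k assms(3) e(2) in auto)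
  qed
qed

lemma full_support:
  assumes gt: "\<And>s. 0 < s \<Longrightarrow> 1 < h s" "\<And>s. 0 < s \<Longrightarrow> s < h s"
  shows "measure_support (copula_measure (ev_of h)) = unit_square"
proof -
  have sets: "sets ev_measure = sets unit_lebesgue2" by (rule sets_kernel_measure[OF cond_kernel_measurable_subprob])
  have sp: "space ev_measure = unit_square" using sets_eq_imp_space_eq[OF sets] by (simp add: space_pair_measure)
  have pos: "0 < emeasure ev_measure (U \<inter> unit_square)" if U: "open U" "(x, y) \<in> U" and xy: "x \<in> {0..1}" "y \<in> {0..1}" for U x y
  proof -
    obtain A B where AB: "open A" "open B" "(x, y) \<in> A \<times> B" "A \<times> B \<subseteq> U" using open_prod_elim[OF U] by metis
    obtain a b where ab: "0 < a" "a < b" "b < 1" "{a..b} \<subseteq> A" using open_contains_Icc_interior[OF AB(1) _ xy(1)] AB(3) by blast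
    obtain c d where cd: "0 < c" "c < d" "d < 1" "{c..d} \<subseteq> B" using open_contains_Icc_interior[OF AB(2) _ xy(2)] AB(3) by blast
    have "{a..b} \<subseteq> unit_interval" "{c..d} \<subseteq> unit_interval" using ab cd by auto
    then have "{a..b} \<times> {c..d} \<subseteq> U \<inter> unit_square" using ab(4) cd(4) AB(4) by blast
    moreover have "U \<inter> unit_square \<in> sets ev_measure"
    proof -
      have "(\<lambda>z. z) -` U \<inter> space unit_lebesgue2 \<in> sets unit_lebesgue2"
        using unit_lebesgue2_to_borel U(1) by (intro measurable_sets) auto
      then show ?thesis unfolding sets by (simp add: space_pair_measure)
    qed
    ultimately have "emeasure ev_measure ({a..b} \<times> {c..d}) \<le> emeasure ev_measure (U \<inter> unit_square)"
      by (intro emeasure_mono)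
    then show ?thesis using ev_measure_rectangle_pos[OF gt ab(1-3) cd(1-3)] by simp
  qed
  show ?thesis
    unfolding measure_support_def copula_measure_ev_of sp using pos by fast
qed

end

text \<open>Countably many test points suffice for \<open>h s > max 1 s\<close>:
  \<open>1 < h s\<close> spreads to the right by monotonicity, so points tending to \<open>0\<close>
  are tested; \<open>s < h s\<close> spreads to the left because \<open>h s - s\<close> is
  nonincreasing, so points tending to infinity are tested.\<close>

definition exceptional_sets :: "(real \<times> real \<Rightarrow> real) set set" where
  "exceptional_sets = range (\<lambda>n. {C \<in> ev_copulas. tail_fun C (1 / real (Suc n)) 1 \<le> 1})
     \<union> range (\<lambda>n. {C \<in> ev_copulas. tail_fun C (real (Suc n)) 1 \<le> real (Suc n)})
     \<union> range (\<lambda>(n, k). jump_set n k) \<union> range thin_jump_set \<union> {affine_set}"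

lemma comeager_typical: "comeager_in ev_topology (ev_copulas - \<Union>exceptional_sets)"
proof -
  have "nowhere_dense_in ev_topology N" if "N \<in> exceptional_sets" for N
  proof -
    consider n where "N = {C \<in> ev_copulas. tail_fun C (1 / real (Suc n)) 1 \<le> 1}"
      | n where "N = {C \<in> ev_copulas. tail_fun C (real (Suc n)) 1 \<le> real (Suc n)}"
      | n k where "N = jump_set n k" | n where "N = thin_jump_set n" | "N = affine_set"
      using \<open>N \<in> exceptional_sets\<close> unfolding exceptional_sets_def by auto
    then show ?thesis
    proof cases
      case 1 then show ?thesis by (simp only:) (intro nowhere_dense_touching; simp)
    next
      case 2 then show ?thesis by (simp only:) (intro nowhere_dense_touching; simp)
    next
      case 3 then show ?thesis using nowhere_dense_jump_set by simp
    next
      case 4 then show ?thesis using nowhere_dense_thin_jump_set by simp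
    next
      case 5 then show ?thesis using nowhere_dense_affine_set by simp
    qed
  qed
  moreover have "countable exceptional_sets" unfolding exceptional_sets_def by simp
  ultimately have "meager_in ev_topology (ev_copulas - (ev_copulas - \<Union>exceptional_sets))"
    unfolding meager_in_def by (intro exI[of _ exceptional_sets]) blast
  then show ?thesis unfolding comeager_in_def topspace_ev_topology by blast
qed

lemma comeager_in_superset:
  assumes "comeager_in X A" "A \<subseteq> B" "B \<subseteq> topspace X" shows "comeager_in X B"
proof -
  obtain \<N> where N: "countable \<N>" "\<forall>N\<in>\<N>. nowhere_dense_in X N" "topspace X - A \<subseteq> \<Union>\<N>"
    using assms(1) unfolding comeager_in_def meager_in_def by blast
  have "topspace X - B \<subseteq> \<Union>\<N>" using N(3) assms(2) by blast
  then have "meager_in X (topspace X - B)" unfolding meager_in_def using N(1,2) by blast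
  then show ?thesis unfolding comeager_in_def using assms(3) by blast
qed

lemma typicalE:
  assumes "C \<in> ev_copulas - \<Union>exceptional_sets"
  obtains h where "profile h" "C = ev_of h"
    "\<And>s. 0 < s \<Longrightarrow> 1 < h s" "\<And>s. 0 < s \<Longrightarrow> s < h s"
    "\<And>s. 0 < s \<Longrightarrow> (rderiv h \<longlongrightarrow> rderiv h s) (at s)"
    "\<And>n. ev_of h \<notin> thin_jump_set n" "ev_of h \<notin> affine_set"
proof -
  obtain h where h: "profile h" "C = ev_of h" using assms ev_copulasE by blast
  interpret profile h by fact
  have notin: "ev_of h \<notin> N" if "N \<in> exceptional_sets" for N using assms h that by blast
  have "1 < h s" if s: "0 < s" for s
  proof -
    obtain n where n: "1 / real (Suc n) < s" using nat_approx_posE[OF s] by blast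
    have "ev_of h \<notin> {C \<in> ev_copulas. tail_fun C (1 / real (Suc n)) 1 \<le> 1}"
      by (rule notin) (simp add: exceptional_sets_def)
    then have "1 < h (1 / real (Suc n))" using ev_of_in_ev_copulas tail_fun_ev_of[of "1 / real (Suc n)"] by simp
    also have "\<dots> \<le> h s" using n by (intro mono) auto
    finally show ?thesis .
  qed
  moreover have "s < h s" if s: "0 < s" for s
  proof -
    obtain n where n: "s < real n" using reals_Archimedean2 by blast
    have "ev_of h \<notin> {C \<in> ev_copulas. tail_fun C (real (Suc n)) 1 \<le> real (Suc n)}"
      by (rule notin) (simp add: exceptional_sets_def)
    then have "real (Suc n) < h (real (Suc n))" using ev_of_in_ev_copulas tail_fun_ev_of[of "real (Suc n)"] by simp
    then show ?thesis using lipschitz[OF s, of "real (Suc n)"] n by simp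
  qed
  moreover have "(rderiv h \<longlongrightarrow> rderiv h s) (at s)" if "0 < s" for s
    using that by (intro differentiable_if_no_jumps notin) (auto simp: exceptional_sets_def)
  moreover have "ev_of h \<notin> thin_jump_set n" for n by (rule notin) (simp add: exceptional_sets_def)
  moreover have "ev_of h \<notin> affine_set" by (rule notin) (simp add: exceptional_sets_def)
  ultimately show thesis using that[OF h] by blast
qed

theorem corollary4p23:
  shows "comeager_in ev_topology
           {C \<in> ev_copulas.
              emeasure (dis_component C) unit_square = 0 \<and>
              emeasure (abs_component C) unit_square \<noteq> 1 \<and>
              measure_support (copula_measure C) = unit_square}
       \<and> (\<exists>T. comeager_in ev_topology T \<and>
            (\<forall>C\<in>T. \<forall>x\<in>{0<..<1}. \<forall>y\<in>{0<..<1}.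
               (\<lambda>t. C (t, y)) differentiable (at x)))"
\<comment> \<open>One co-meager set settles both claims: it is contained in the first set and is
  itself the witness for the second.\<close>
proof (intro conjI exI[of _ "ev_copulas - \<Union>exceptional_sets"] comeager_typical ballI)
  show "comeager_in ev_topology
           {C \<in> ev_copulas.
              emeasure (dis_component C) unit_square = 0 \<and>
              emeasure (abs_component C) unit_square \<noteq> 1 \<and>
              measure_support (copula_measure C) = unit_square}"
  proof (rule comeager_in_superset[OF comeager_typical], rule subsetI)
    fix C assume C: "C \<in> ev_copulas - \<Union>exceptional_sets"
    then obtain h where h: "profile h" "C = ev_of h"
      "\<And>s. 0 < s \<Longrightarrow> 1 < h s" "\<And>s. 0 < s \<Longrightarrow> s < h s"
      "\<And>s. 0 < s \<Longrightarrow> (rderiv h \<longlongrightarrow> rderiv h s) (at s)"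
      "\<And>n. ev_of h \<notin> thin_jump_set n" "ev_of h \<notin> affine_set"
      by (rule typicalE) (rule that)
    interpret profile h by fact
    note atomless = cond_kernel_atomless[OF h(5)]
    have "emeasure (dis_component C) unit_square = 0"
      unfolding h(2) by (rule dis_component_null[OF atomless])
    moreover have "emeasure (abs_component C) unit_square \<noteq> 1"
      unfolding h(2) by (rule abs_component_ne_one[OF atomless cond_kernel_not_absolutely_continuous[OF _ h(6,7)]])
    moreover have "measure_support (copula_measure C) = unit_square"
      unfolding h(2) by (rule full_support[OF h(3,4)])
    ultimately show "C \<in> {C \<in> ev_copulas.
              emeasure (dis_component C) unit_square = 0 \<and>
              emeasure (abs_component C) unit_square \<noteq> 1 \<and>
              measure_support (copula_measure C) = unit_square}"
      using C by blast
  qed simp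
next
  fix C and x y :: real
  assume C: "C \<in> ev_copulas - \<Union>exceptional_sets" and x: "x \<in> {0<..<1}" and y: "y \<in> {0<..<1}"
  obtain h where h: "profile h" "C = ev_of h" "\<And>s. 0 < s \<Longrightarrow> (rderiv h \<longlongrightarrow> rderiv h s) (at s)"
    using typicalE[OF C] by metis
  interpret profile h by fact
  have "(\<lambda>t. ev_fun h t y) differentiable (at x)"
    by (rule differentiable_ev_fun[OF x y has_real_derivative_rderiv[OF ln_ratio_pos[OF x y] h(3)[OF ln_ratio_pos[OF x y]]]])
  then obtain D where "((\<lambda>t. ev_fun h t y) has_real_derivative D) (at x)" using real_differentiable_def by blast
  then have "((\<lambda>t. C (t, y)) has_real_derivative D) (at x)"
  proof (rule has_field_derivative_transform_within_open[of _ _ _ "{0<..<1}"])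
    fix t :: real assume "t \<in> {0<..<1}"
    then have "(t, y) \<in> unit_square" using y by auto
    then show "ev_fun h t y = C (t, y)"
      unfolding h(2) ev_of_def restrict_apply by (simp only: if_True prod.case)
  qed (use x in auto)
  then show "(\<lambda>t. C (t, y)) differentiable (at x)" using real_differentiable_def by blast
qed

end
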